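(* Assume that there are constants $C_\epsilon$ ($\epsilon>0$) with $C_\epsilon\to 0$ as $\epsilon\to 0$ such that for all $f\in B_\phi$ we have $\|M_r^\epsilon f\|_B\le C_\epsilon\|f\|_B$. If convolution with $\phi$, $f\mapsto f*\phi$, is continuous $B\to B$, then one can choose $\epsilon>0$ small enough that for any $U_\epsilon$-BUPU $\{\psi_i\}$ with $\mathrm{supp}(\psi_i)\subseteq x_iU_\epsilon$ the operator $T_1:B_\phi\to B_\phi$ given by $$T_1f=\sum_i f(x_i)(\psi_i*\phi)$$ is invertible. The convergence of the sum is pointwise, and if $C_c(G)$ (the compactly supported continuous functions) is dense in $B$ then the convergence is also in norm.
   Context: $G$ is a Lie group of dimension $n$ with Lie algebra $\mathfrak g$, exponential map $\exp$, and left Haar measure $dx$; $X_1,\dots,X_n$ is a fixed basis of $\mathfrak g$. For $\epsilon>0$, $U_\epsilon=\{\exp(t_1X_1)\exp(t_2X_2)\cdots\exp(t_nX_n): -\epsilon\le t_k\le\epsilon\}$, and $M_r^\epsilon f(x)=\sup_{u\in U_\epsilon}|f(xu^{-1})-f(x)|$. Translations: $\ell_xf(y)=f(x^{-1}y)$, $r_xf(y)=f(yx)$. Convolution: $f*g(y)=\int_G f(x)g(x^{-1}y)\,dx$. Standing assumptions: $B$ is a Banach space of (measurable) functions on $G$ that is solid ($|f|\le|g|$ and $g\in B$ imply $f\in B$), left and right translation invariant with, for each compact $U\subseteq G$, a constant $C_U$ such that $\sup_{y\in U}\|\ell_yf\|_B\le C_U\|f\|_B$ and $\sup_{y\in U}\|r_yf\|_B\le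 C_U\|f\|_B$ for all $f\in B$; convergence in $B$ implies convergence locally in measure. There is a non-zero $\phi\in B$ with $\left|\int_G f(y)\phi(y^{-1})\,dy\right|\le C\|f\|_B$ for all $f\in B$ and $\phi*\phi=\phi$. Put $B_\phi=\{f\in B: f=f*\phi\}$, a reproducing kernel Banach space with the norm of $B$. For a compact neighbourhood $U$ of the identity, $\{x_i\}_{i\in I}$ is $U$-relatively separated if $G\subseteq\bigcup_i x_iU$ and there is $N$ with $\sup_i\#\{j: x_iU\cap x_jU\ne\emptyset\}\le N$. A $U$-BUPU (bounded uniform partition of unity subordinate to $U$) is a family of non-negative functions $\psi_i$ for which there is a $U$-relatively separated sequence $\{x_i\}$ with $\mathrm{supp}(\psi_i)\subseteq x_iU$ and $\sum_i\psi_i=1$. *)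

theory Defs
  imports "HOL-Analysis.Analysis" "HOL-Algebra.Coset"
begin

section \<open>Smooth maps and Lie groups\<close>

primrec higher_differentiable_on ::
    "nat \<Rightarrow> ('a::real_normed_vector \<Rightarrow> 'b::real_normed_vector) \<Rightarrow> 'a set \<Rightarrow> bool" where
  "higher_differentiable_on 0 f S \<longleftrightarrow> continuous_on S f"
| "higher_differentiable_on (Suc k) f S \<longleftrightarrow>
     (\<forall>x\<in>S. f differentiable (at x)) \<and>
     (\<forall>v. higher_differentiable_on k (\<lambda>x. frechet_derivative f (at x) v) S)"

text \<open>Only used for open \<open>S\<close> in finite-dimensional spaces, where this is the usual \<open>C\<^sup>\<infinity>\<close>.\<close>

definition smooth_on :: "'a::real_normed_vector set \<Rightarrow> ('a \<Rightarrow> 'b::real_normed_vector) \<Rightarrow> bool" where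
  "smooth_on S f \<longleftrightarrow> (\<forall>k. higher_differentiable_on k f S)"

type_synonym ('m, 'e) chart = "'m set \<times> ('m \<Rightarrow> 'e)"

definition smooth_atlas :: "('m::topological_space, 'e::real_normed_vector) chart set \<Rightarrow> bool" where
  "smooth_atlas A \<longleftrightarrow>
     (\<Union>(U, c)\<in>A. U) = UNIV \<and>
     (\<forall>(U, c)\<in>A. open U \<and> open (c ` U) \<and> homeomorphism U (c ` U) c (inv_into U c)) \<and>
     (\<forall>(U, c)\<in>A. \<forall>(V, d)\<in>A. smooth_on (c ` (U \<inter> V)) (d \<circ> inv_into U c))"

definition smooth_map ::
    "('m::topological_space, 'e::real_normed_vector) chart set \<Rightarrow>
     ('k::topological_space, 'd::real_normed_vector) chart set \<Rightarrow> ('m \<Rightarrow> 'k) \<Rightarrow> bool" where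
  "smooth_map A A' f \<longleftrightarrow>
     continuous_on UNIV f \<and>
     (\<forall>(U, c)\<in>A. \<forall>(V, d)\<in>A'. smooth_on (c ` (U \<inter> f -` V)) (d \<circ> f \<circ> inv_into U c))"

definition prod_atlas :: "('m, 'e) chart set \<Rightarrow> ('k, 'd) chart set \<Rightarrow> ('m \<times> 'k, 'e \<times> 'd) chart set" where
  "prod_atlas A A' = {(U \<times> V, map_prod c d) | U c V d. (U, c) \<in> A \<and> (V, d) \<in> A'}"

definition real_atlas :: "(real, real) chart set" where
  "real_atlas = {(UNIV, id)}"

text \<open>The model space \<open>'e\<close> is any normed space of dimension \<open>n\<close>; class \<open>euclidean_space\<close> would
  exclude \<open>n = 0\<close>.\<close>

locale lie_group = group G
  for G :: "'g::{t2_space, second_countable_topology} monoid" (structure) +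
  fixes A :: "('g, 'e::real_normed_vector) chart set" and n :: nat
  assumes carrier_UNIV: "carrier G = UNIV"
    and model_dimension: "\<exists>b::'e set. finite b \<and> card b = n \<and> independent b \<and> span b = UNIV"
    and atlas: "smooth_atlas A"
    and smooth_mult: "smooth_map (prod_atlas A A) A (\<lambda>(x, y). x \<otimes> y)"
    and smooth_inv: "smooth_map A A (\<lambda>x. inv x)"

definition smooth_functions :: "('g::topological_space, 'e::real_normed_vector) chart set \<Rightarrow> ('g \<Rightarrow> real) set" where
  "smooth_functions A = {f. smooth_map A real_atlas f}"

text \<open>The Lie algebra as the space of left-invariant smooth vector fields, a vector field being a
  derivation of the algebra of smooth real functions. Since HOL functions are total, a derivation is
  extended by \<open>0\<close> to all other functions, so that equality of derivations is equality of HOL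
  functions. The bracket is not needed here.\<close>

type_synonym 'g vfield = "('g \<Rightarrow> real) \<Rightarrow> 'g \<Rightarrow> real"

definition lie_algebra ::
    "('g::topological_space) monoid \<Rightarrow> ('g, 'e::real_normed_vector) chart set \<Rightarrow> 'g vfield set" where
  "lie_algebra G A = {X.
     (\<forall>f. f \<notin> smooth_functions A \<longrightarrow> X f = (\<lambda>_. 0)) \<and>
     (\<forall>f\<in>smooth_functions A. X f \<in> smooth_functions A) \<and>
     (\<forall>f\<in>smooth_functions A. \<forall>g\<in>smooth_functions A. \<forall>a b.
        X (\<lambda>y. a * f y + b * g y) = (\<lambda>y. a * X f y + b * X g y)) \<and>
     (\<forall>f\<in>smooth_functions A. \<forall>g\<in>smooth_functions A.
        X (\<lambda>y. f y * g y) = (\<lambda>y. f y * X g y + X f y * g y)) \<and>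
     (\<forall>f\<in>smooth_functions A. \<forall>a. X (\<lambda>y. f (a \<otimes>\<^bsub>G\<^esub> y)) = (\<lambda>y. X f (a \<otimes>\<^bsub>G\<^esub> y)))}"

definition vf_scale :: "real \<Rightarrow> 'g vfield \<Rightarrow> 'g vfield" where
  "vf_scale t X = (\<lambda>f y. t * X f y)"

definition lie_algebra_basis ::
    "('g::topological_space) monoid \<Rightarrow> ('g, 'e::real_normed_vector) chart set \<Rightarrow> nat \<Rightarrow>
     (nat \<Rightarrow> 'g vfield) \<Rightarrow> bool" where
  "lie_algebra_basis G A n X \<longleftrightarrow>
     (\<forall>k\<in>{1..n}. X k \<in> lie_algebra G A) \<and>
     (\<forall>c. (\<lambda>f y. \<Sum>k=1..n. vf_scale (c k) (X k) f y) = (\<lambda>f y. 0) \<longrightarrow> (\<forall>k\<in>{1..n}. c k = 0)) \<and>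
     (\<forall>Y\<in>lie_algebra G A. \<exists>c. Y = (\<lambda>f y. \<Sum>k=1..n. vf_scale (c k) (X k) f y))"

text \<open>The exponential map: for each \<open>X\<close> in the Lie algebra, \<open>t \<mapsto> exp (t X)\<close> is the integral
  curve of \<open>X\<close> through the identity (the one-parameter subgroup generated by \<open>X\<close>). By uniqueness of
  integral curves this determines the map on the Lie algebra.\<close>

definition exponential_map ::
    "('g::topological_space) monoid \<Rightarrow> ('g, 'e::real_normed_vector) chart set \<Rightarrow> ('g vfield \<Rightarrow> 'g) \<Rightarrow> bool" where
  "exponential_map G A E \<longleftrightarrow> (\<forall>X\<in>lie_algebra G A.
     smooth_map real_atlas A (\<lambda>t. E (vf_scale t X)) \<and>
     E (vf_scale 0 X) = \<one>\<^bsub>G\<^esub> \<and>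
     (\<forall>f\<in>smooth_functions A. \<forall>t.
        ((\<lambda>s. f (E (vf_scale s X))) has_real_derivative X f (E (vf_scale t X))) (at t)))"

text \<open>\<open>exp_box G E X n \<epsilon>\<close> is the set \<open>U\<^sub>\<epsilon>\<close>.\<close>

definition exp_box ::
    "'g monoid \<Rightarrow> ('g vfield \<Rightarrow> 'g) \<Rightarrow> (nat \<Rightarrow> 'g vfield) \<Rightarrow> nat \<Rightarrow> real \<Rightarrow> 'g set" where
  "exp_box G E X n \<epsilon> =
     {foldr (\<lambda>k a. E (vf_scale (t k) (X k)) \<otimes>\<^bsub>G\<^esub> a) [1..<Suc n] \<one>\<^bsub>G\<^esub> | t.
        \<forall>k\<in>{1..n}. -\<epsilon> \<le> t k \<and> t k \<le> \<epsilon>}"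

text \<open>Regularity is automatic for Borel measures finite on compact sets, as \<open>G\<close> is second
  countable and locally compact.\<close>

definition left_haar_measure :: "('g::topological_space) monoid \<Rightarrow> 'g measure \<Rightarrow> bool" where
  "left_haar_measure G \<mu> \<longleftrightarrow>
     sets \<mu> = sets borel \<and>
     emeasure \<mu> UNIV \<noteq> 0 \<and>
     (\<forall>K. compact K \<longrightarrow> emeasure \<mu> K < \<infinity>) \<and>
     (\<forall>x. distr \<mu> \<mu> (\<lambda>y. x \<otimes>\<^bsub>G\<^esub> y) = \<mu>)"

section \<open>Function spaces\<close>

text \<open>Below, \<open>M\<close> is always the completion of the Haar measure, so measurability means Haar
  measurability. (For Borel measurability, the supremum of \<open>right_osc\<close> would leave the class.)\<close>

definition left_translate :: "'g monoid \<Rightarrow> 'g \<Rightarrow> ('g \<Rightarrow> complex) \<Rightarrow> 'g \<Rightarrow> complex" where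
  "left_translate G x f = (\<lambda>y. f (inv\<^bsub>G\<^esub> x \<otimes>\<^bsub>G\<^esub> y))"

definition right_translate :: "'g monoid \<Rightarrow> 'g \<Rightarrow> ('g \<Rightarrow> complex) \<Rightarrow> 'g \<Rightarrow> complex" where
  "right_translate G x f = (\<lambda>y. f (y \<otimes>\<^bsub>G\<^esub> x))"

definition conv :: "'g monoid \<Rightarrow> 'g measure \<Rightarrow> ('g \<Rightarrow> complex) \<Rightarrow> ('g \<Rightarrow> complex) \<Rightarrow> 'g \<Rightarrow> complex" where
  "conv G M f g = (\<lambda>y. \<integral>x. f x * g (inv\<^bsub>G\<^esub> x \<otimes>\<^bsub>G\<^esub> y) \<partial>M)"

definition right_osc :: "'g monoid \<Rightarrow> 'g set \<Rightarrow> ('g \<Rightarrow> complex) \<Rightarrow> 'g \<Rightarrow> real" where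
  "right_osc G U f = (\<lambda>x. SUP u\<in>U. norm (f (x \<otimes>\<^bsub>G\<^esub> inv\<^bsub>G\<^esub> u) - f x))"

text \<open>A Banach space of measurable functions, given by the set \<open>B\<close> of all representatives of its
  elements: functions that agree almost everywhere represent the same element, so \<open>nrm\<close> vanishes
  exactly on the null functions. Values of \<open>nrm\<close> outside \<open>B\<close> carry no meaning.\<close>

locale banach_function_space =
  fixes M :: "'g::topological_space measure"
    and B :: "('g \<Rightarrow> complex) set" and nrm :: "('g \<Rightarrow> complex) \<Rightarrow> real"
  assumes B_measurable: "B \<subseteq> borel_measurable M"
    and B_zero: "(\<lambda>_. 0) \<in> B"
    and B_add: "\<And>f g. f \<in> B \<Longrightarrow> g \<in> B \<Longrightarrow> (\<lambda>y. f y + g y) \<in> B"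
    and B_scale: "\<And>f c. f \<in> B \<Longrightarrow> (\<lambda>y. c * f y) \<in> B"
    and nrm_nonneg: "\<And>f. f \<in> B \<Longrightarrow> 0 \<le> nrm f"
    and nrm_triangle: "\<And>f g. f \<in> B \<Longrightarrow> g \<in> B \<Longrightarrow> nrm (\<lambda>y. f y + g y) \<le> nrm f + nrm g"
    and nrm_scale: "\<And>f c. f \<in> B \<Longrightarrow> nrm (\<lambda>y. c * f y) = norm c * nrm f"
    and nrm_eq_0_iff: "\<And>f. f \<in> B \<Longrightarrow> nrm f = 0 \<longleftrightarrow> (AE y in M. f y = 0)"
    and B_complete: "\<And>F. (\<And>k::nat. F k \<in> B) \<Longrightarrow>
        (\<And>e. e > 0 \<Longrightarrow> \<exists>N. \<forall>j\<ge>N. \<forall>k\<ge>N. nrm (\<lambda>y. F j y - F k y) < e) \<Longrightarrow>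
        \<exists>f\<in>B. (\<lambda>k. nrm (\<lambda>y. F k y - f y)) \<longlonglongrightarrow> 0"
    and B_convergence_in_measure: "\<And>F f K \<delta>. (\<And>k::nat. F k \<in> B) \<Longrightarrow> f \<in> B \<Longrightarrow>
        (\<lambda>k. nrm (\<lambda>y. F k y - f y)) \<longlonglongrightarrow> 0 \<Longrightarrow> compact K \<Longrightarrow> \<delta> > 0 \<Longrightarrow>
        (\<lambda>k. measure M {y\<in>K. \<delta> \<le> norm (F k y - f y)}) \<longlonglongrightarrow> 0"

definition solid :: "'g measure \<Rightarrow> ('g \<Rightarrow> complex) set \<Rightarrow> bool" where
  "solid M B \<longleftrightarrow>
     (\<forall>f g. f \<in> borel_measurable M \<longrightarrow> g \<in> B \<longrightarrow> (AE y in M. norm (f y) \<le> norm (g y)) \<longrightarrow> f \<in> B)"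

definition translation_invariant ::
    "('g::topological_space) monoid \<Rightarrow> ('g \<Rightarrow> complex) set \<Rightarrow> (('g \<Rightarrow> complex) \<Rightarrow> real) \<Rightarrow> bool" where
  "translation_invariant G B nrm \<longleftrightarrow>
     (\<forall>f\<in>B. \<forall>y. left_translate G y f \<in> B \<and> right_translate G y f \<in> B) \<and>
     (\<forall>U. compact U \<longrightarrow> (\<exists>C. \<forall>f\<in>B. \<forall>y\<in>U.
        nrm (left_translate G y f) \<le> C * nrm f \<and> nrm (right_translate G y f) \<le> C * nrm f))"

definition convolution_continuous ::
    "'g monoid \<Rightarrow> 'g measure \<Rightarrow> ('g \<Rightarrow> complex) set \<Rightarrow> (('g \<Rightarrow> complex) \<Rightarrow> real) \<Rightarrow> ('g \<Rightarrow> complex) \<Rightarrow> bool" where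
  "convolution_continuous G M B nrm \<phi> \<longleftrightarrow>
     (\<forall>f\<in>B. conv G M f \<phi> \<in> B) \<and>
     (\<forall>f\<in>B. \<forall>e>0. \<exists>d>0. \<forall>g\<in>B. nrm (\<lambda>y. g y - f y) < d \<longrightarrow>
        nrm (\<lambda>y. conv G M g \<phi> y - conv G M f \<phi> y) < e)"

text \<open>The equation \<open>f = f * \<phi>\<close> is required at every point. This picks from each class the
  representative \<open>f * \<phi>\<close>, which gives point evaluations on the space their meaning.\<close>

definition reproducing_space ::
    "'g monoid \<Rightarrow> 'g measure \<Rightarrow> ('g \<Rightarrow> complex) set \<Rightarrow> ('g \<Rightarrow> complex) \<Rightarrow> ('g \<Rightarrow> complex) set" where
  "reproducing_space G M B \<phi> = {f\<in>B. f = conv G M f \<phi>}"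

definition Cc :: "('g::topological_space \<Rightarrow> complex) set" where
  "Cc = {g. continuous_on UNIV g \<and> compact (closure {y. g y \<noteq> 0})}"

definition Cc_dense :: "('g::topological_space \<Rightarrow> complex) set \<Rightarrow> (('g \<Rightarrow> complex) \<Rightarrow> real) \<Rightarrow> bool" where
  "Cc_dense B nrm \<longleftrightarrow> Cc \<subseteq> B \<and> (\<forall>f\<in>B. \<forall>e>0. \<exists>g\<in>Cc. nrm (\<lambda>y. f y - g y) < e)"

section \<open>Partitions of unity and the sampling operator\<close>

text \<open>Sequences are indexed by an arbitrary, possibly finite, set \<open>I\<close> of natural numbers.
  The set \<open>U\<close> is meant to be a compact neighbourhood of the identity, as \<open>exp_box\<close> is for
  \<open>\<epsilon> > 0\<close>.\<close>

definition relatively_separated :: "'g monoid \<Rightarrow> 'g set \<Rightarrow> nat set \<Rightarrow> (nat \<Rightarrow> 'g) \<Rightarrow> bool" where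
  "relatively_separated G U I x \<longleftrightarrow>
     UNIV = (\<Union>i\<in>I. x i <#\<^bsub>G\<^esub> U) \<and>
     (\<exists>N::nat. \<forall>i\<in>I.
        finite {j\<in>I. (x i <#\<^bsub>G\<^esub> U) \<inter> (x j <#\<^bsub>G\<^esub> U) \<noteq> {}} \<and>
        card {j\<in>I. (x i <#\<^bsub>G\<^esub> U) \<inter> (x j <#\<^bsub>G\<^esub> U) \<noteq> {}} \<le> N)"

definition bupu ::
    "('g::topological_space) monoid \<Rightarrow> 'g measure \<Rightarrow> 'g set \<Rightarrow> nat set \<Rightarrow> (nat \<Rightarrow> 'g) \<Rightarrow>
     (nat \<Rightarrow> 'g \<Rightarrow> real) \<Rightarrow> bool" where
  "bupu G M U I x \<psi> \<longleftrightarrow>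
     relatively_separated G U I x \<and>
     (\<forall>i\<in>I. \<psi> i \<in> borel_measurable M \<and> (\<forall>y. 0 \<le> \<psi> i y) \<and>
        closure {y. \<psi> i y \<noteq> 0} \<subseteq> x i <#\<^bsub>G\<^esub> U) \<and>
     (\<forall>y. ((\<lambda>i. \<psi> i y) has_sum 1) I)"

definition sampling_term ::
    "'g monoid \<Rightarrow> 'g measure \<Rightarrow> ('g \<Rightarrow> complex) \<Rightarrow> (nat \<Rightarrow> 'g) \<Rightarrow> (nat \<Rightarrow> 'g \<Rightarrow> real) \<Rightarrow>
     ('g \<Rightarrow> complex) \<Rightarrow> nat \<Rightarrow> 'g \<Rightarrow> complex" where
  "sampling_term G M \<phi> x \<psi> f i = (\<lambda>y. f (x i) * conv G M (\<lambda>z. complex_of_real (\<psi> i z)) \<phi> y)"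

definition sampling_operator ::
    "'g monoid \<Rightarrow> 'g measure \<Rightarrow> ('g \<Rightarrow> complex) \<Rightarrow> nat set \<Rightarrow> (nat \<Rightarrow> 'g) \<Rightarrow> (nat \<Rightarrow> 'g \<Rightarrow> real) \<Rightarrow>
     ('g \<Rightarrow> complex) \<Rightarrow> 'g \<Rightarrow> complex" where
  "sampling_operator G M \<phi> I x \<psi> f = (\<lambda>y. \<Sum>\<^sub>\<infinity>i\<in>I. sampling_term G M \<phi> x \<psi> f i y)"

definition bounded_operator_on ::
    "('g \<Rightarrow> complex) set \<Rightarrow> (('g \<Rightarrow> complex) \<Rightarrow> real) \<Rightarrow> (('g \<Rightarrow> complex) \<Rightarrow> 'g \<Rightarrow> complex) \<Rightarrow> bool" where
  "bounded_operator_on V nrm T \<longleftrightarrow>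
     (\<forall>f\<in>V. T f \<in> V) \<and>
     (\<forall>f\<in>V. \<forall>g\<in>V. T (\<lambda>y. f y + g y) = (\<lambda>y. T f y + T g y)) \<and>
     (\<forall>f\<in>V. \<forall>c. T (\<lambda>y. c * f y) = (\<lambda>y. c * T f y)) \<and>
     (\<exists>K. \<forall>f\<in>V. nrm (T f) \<le> K * nrm f)"

definition invertible_operator_on ::
    "('g \<Rightarrow> complex) set \<Rightarrow> (('g \<Rightarrow> complex) \<Rightarrow> real) \<Rightarrow> (('g \<Rightarrow> complex) \<Rightarrow> 'g \<Rightarrow> complex) \<Rightarrow> bool" where
  "invertible_operator_on V nrm T \<longleftrightarrow>
     bounded_operator_on V nrm T \<and>
     (\<exists>S. bounded_operator_on V nrm S \<and> (\<forall>f\<in>V. S (T f) = f \<and> T (S f) = f))"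

text \<open>Unconditional convergence of \<open>\<Sum>i\<in>I. g i\<close> to \<open>s\<close> in the norm of \<open>B\<close>; compare \<open>has_sum\<close>.\<close>

definition norm_has_sum ::
    "('g \<Rightarrow> complex) set \<Rightarrow> (('g \<Rightarrow> complex) \<Rightarrow> real) \<Rightarrow> (nat \<Rightarrow> 'g \<Rightarrow> complex) \<Rightarrow>
     ('g \<Rightarrow> complex) \<Rightarrow> nat set \<Rightarrow> bool" where
  "norm_has_sum B nrm g s I \<longleftrightarrow>
     s \<in> B \<and> (\<forall>i\<in>I. g i \<in> B) \<and>
     ((\<lambda>F. nrm (\<lambda>y. (\<Sum>i\<in>F. g i y) - s y)) \<longlongrightarrow> 0) (finite_subsets_at_top I)"

end

theory Submission
  imports Defs
begin

text \<open>
  For \<open>f\<close> in the reproducing space \<open>B\<^sub>\<phi>\<close>, let \<open>F = \<Sum>i. f (x i) \<psi> i\<close> be its quasi-interpolant, called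
  \<open>interpolant f\<close> below. Then \<open>T\<^sub>1 f = F * \<phi>\<close>, and since \<open>f = f * \<phi>\<close> this gives
  \<open>T\<^sub>1 f - f = (F - f) * \<phi>\<close>. Wherever \<open>\<psi> i y \<noteq> 0\<close> one has \<open>x i = y u\<^sup>-\<^sup>1\<close> with \<open>u\<close> in the box
  \<open>U\<^sub>\<epsilon>\<close>, so \<open>|F - f| \<le> M\<^sub>r f\<close> pointwise, and \<open>\<parallel>T\<^sub>1 f - f\<parallel> \<le> const C\<^sub>\<epsilon> \<parallel>f\<parallel>\<close>. For small
  \<open>\<epsilon>\<close> the Neumann series inverts \<open>T\<^sub>1\<close> on \<open>B\<^sub>\<phi>\<close>. Several steps of this sketch need an argument of
  their own.

  \<^item> Solidity is a statement about membership: it contains no inequality between norms, and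
    \<open>\<parallel>F - f\<parallel> \<le> D \<parallel>M\<^sub>r f\<parallel>\<close> with \<open>D\<close> independent of \<open>f\<close> and of the partition has to be extracted from
    completeness. Zabreiko's lemma (\<open>countably_subadditive_bounded\<close>), a form of the Baire argument
    behind the closed graph theorem, is applied twice to obtain it (\<open>ideal_bound\<close>).

  \<^item> That \<open>T\<^sub>1\<close> maps into \<open>B\<^sub>\<phi>\<close>, and that \<open>B\<^sub>\<phi>\<close> is complete, both rest on \<open>(f * \<phi>) * \<phi> = f * \<phi>\<close>
    for all \<open>f\<close> in \<open>B\<close> (\<open>conv_idempotent\<close>). Fubini's theorem may fail to apply to \<open>f\<close> itself: the
    hypotheses put \<open>f * \<phi>\<close> into \<open>B\<close>, but not \<open>|f| * |\<phi>|\<close>, so the double integral need not converge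
    absolutely. Instead \<open>f\<close> is cut into countably many pieces for which the identity follows from
    dominated convergence, and the pieces are reassembled by a gliding hump argument of the type of
    Schur, Phillips and Nikodym (\<open>nikodym_vanishing\<close>).

  \<^item> A function \<open>f\<close> in \<open>B\<^sub>\<phi>\<close> is bounded on compact sets, because \<open>f y\<close> is the value of a bounded
    functional at a translate of \<open>f\<close>. Hence the supremum in \<open>M\<^sub>r f\<close> is a true supremum.

  \<^item> For convergence in norm, \<open>|f| + M\<^sub>r f\<close> is approximated by a \<open>g\<close> in \<open>C\<^sub>c\<close>. Once a finite index set
    contains every \<open>i\<close> for which \<open>x i U\<^sub>\<epsilon>\<close> meets the support of \<open>g\<close>, the remainder of the series for \<open>F\<close> is
    dominated by \<open>|f| + M\<^sub>r f - g\<close>. There are finitely many such \<open>i\<close>, by a comparison of Haar measures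
    (\<open>relatively_separated_locally_finite\<close>).

  Limits in \<open>B\<close> are identified locally in measure, on each of countably many compact sets that cover \<open>G\<close>. If a partition of unity exists for some \<open>\<epsilon>\<close>, the translates
  \<open>x i U\<^sub>\<epsilon>\<close> are such a cover; if none exists for any \<open>\<epsilon>\<close>, the claim is vacuous.
\<close>

section \<open>Zabreiko's lemma and Neumann series\<close>

text \<open>Used for three spaces: \<open>B\<close> itself, the bounded measurable functions with the supremum norm, and the
  reproducing space.\<close>

locale complete_seminorm =
  fixes V :: "('a \<Rightarrow> complex) set" and N :: "('a \<Rightarrow> complex) \<Rightarrow> real"
  assumes zero_in: "(\<lambda>_. 0) \<in> V"
    and add_in: "\<And>f g. f \<in> V \<Longrightarrow> g \<in> V \<Longrightarrow> (\<lambda>y. f y + g y) \<in> V"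
    and scale_in: "\<And>f c. f \<in> V \<Longrightarrow> (\<lambda>y. c * f y) \<in> V"
    and nonneg: "\<And>f. f \<in> V \<Longrightarrow> 0 \<le> N f"
    and triangle: "\<And>f g. f \<in> V \<Longrightarrow> g \<in> V \<Longrightarrow> N (\<lambda>y. f y + g y) \<le> N f + N g"
    and scale: "\<And>f c. f \<in> V \<Longrightarrow> N (\<lambda>y. c * f y) = norm c * N f"
    and complete: "\<And>F. (\<And>k::nat. F k \<in> V) \<Longrightarrow>
        (\<And>e. e > 0 \<Longrightarrow> \<exists>m. \<forall>j\<ge>m. \<forall>k\<ge>m. N (\<lambda>y. F j y - F k y) < e) \<Longrightarrow>
        \<exists>f\<in>V. (\<lambda>k. N (\<lambda>y. F k y - f y)) \<longlonglongrightarrow> 0"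
begin

lemma diff_in: "f \<in> V \<Longrightarrow> g \<in> V \<Longrightarrow> (\<lambda>y. f y - g y) \<in> V"
  using add_in[of f "\<lambda>y. (-1) * g y"] scale_in[of g "-1"] by simp

lemma sum_in: "finite J \<Longrightarrow> (\<And>j. j \<in> J \<Longrightarrow> F j \<in> V) \<Longrightarrow> (\<lambda>y. \<Sum>j\<in>J. F j y) \<in> V"
  by (induction rule: finite_induct) (auto intro: zero_in add_in)

lemma N_zero: "N (\<lambda>_. 0) = 0"
  using scale[OF zero_in, of 0] by simp

lemma N_minus_commute: "f \<in> V \<Longrightarrow> g \<in> V \<Longrightarrow> N (\<lambda>y. f y - g y) = N (\<lambda>y. g y - f y)"
  using scale[OF diff_in, of f g "-1"] by simp

lemma triangle_diff: "f \<in> V \<Longrightarrow> g \<in> V \<Longrightarrow> N (\<lambda>y. f y - g y) \<le> N f + N g"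
  using triangle[of f "\<lambda>y. (-1) * g y"] scale_in[of g "-1"] scale[of g "-1"] by simp

lemma triangle_via:
  "f \<in> V \<Longrightarrow> g \<in> V \<Longrightarrow> h \<in> V \<Longrightarrow> N (\<lambda>y. f y - h y) \<le> N (\<lambda>y. f y - g y) + N (\<lambda>y. g y - h y)"
  using triangle[OF diff_in diff_in, of f g g h] by simp

lemma triangle_sum:
  "finite J \<Longrightarrow> (\<And>j. j \<in> J \<Longrightarrow> F j \<in> V) \<Longrightarrow> N (\<lambda>y. \<Sum>j\<in>J. F j y) \<le> (\<Sum>j\<in>J. N (F j))"
proof (induction rule: finite_induct)
  case empty then show ?case by (simp add: N_zero)
next
  case (insert a J)
  have "N (\<lambda>y. F a y + (\<Sum>j\<in>J. F j y)) \<le> N (F a) + N (\<lambda>y. \<Sum>j\<in>J. F j y)"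
    using insert by (intro triangle sum_in) auto
  with insert show ?case by auto
qed

text \<open>Completeness in the form used for iterations: the tail bound \<open>r k\<close> survives in the limit.\<close>

lemma complete_nested:
  assumes g: "\<And>k::nat. g k \<in> V" and r0: "r \<longlonglongrightarrow> 0"
    and d: "\<And>k m. k \<le> m \<Longrightarrow> N (\<lambda>y. g m y - g k y) \<le> r k"
  obtains f where "f \<in> V" "\<And>k. N (\<lambda>y. g k y - f y) \<le> r k"
    "(\<lambda>k. N (\<lambda>y. g k y - f y)) \<longlonglongrightarrow> 0"
proof -
  have "\<exists>m. \<forall>j\<ge>m. \<forall>k\<ge>m. N (\<lambda>y. g j y - g k y) < e" if "e > 0" for e :: real
  proof -
    obtain m where m: "\<And>k. k \<ge> m \<Longrightarrow> r k < e"
      using order_tendstoD(2)[OF r0 \<open>e > 0\<close>] by (auto simp: eventually_sequentially)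
    have "N (\<lambda>y. g j y - g k y) < e" if "j \<ge> m" "k \<ge> m" for j k
      using d[of j k] d[of k j] m[of j] m[of k] N_minus_commute[OF g g, of j k] that
      by (cases "j \<le> k") auto
    then show ?thesis by blast
  qed
  from complete[OF g this] obtain f where f: "f \<in> V" "(\<lambda>k. N (\<lambda>y. g k y - f y)) \<longlonglongrightarrow> 0"
    by blast
  have "N (\<lambda>y. g k y - f y) \<le> r k" for k
  proof (rule field_le_epsilon)
    fix e :: real assume "e > 0"
    then obtain m where m: "\<And>l. l \<ge> m \<Longrightarrow> N (\<lambda>y. g l y - f y) < e"
      using order_tendstoD(2)[OF f(2)] by (auto simp: eventually_sequentially)
    let ?l = "max m k"
    have "N (\<lambda>y. g k y - f y) \<le> N (\<lambda>y. g k y - g ?l y) + N (\<lambda>y. g ?l y - f y)"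
      by (intro triangle_via g f)
    also have "\<dots> \<le> r k + e"
      using d[of k ?l] m[of ?l] N_minus_commute[OF g g, of k ?l] by simp
    finally show "N (\<lambda>y. g k y - f y) \<le> r k + e" .
  qed
  with f that show ?thesis by blast
qed

text \<open>The Baire step. If no level set \<open>{p \<le> n}\<close> were dense in a ball, then for every \<open>n\<close> each ball would
  contain a smaller one that avoids \<open>{p \<le> n}\<close>. A common point \<open>f\<close> of a nested sequence of such balls
  would satisfy \<open>p f > n\<close> for all \<open>n\<close>, although \<open>p f\<close> is a real number.\<close>

lemma countably_subadditive_dense_somewhere:
  fixes p :: "('a \<Rightarrow> complex) \<Rightarrow> real"
  shows "\<exists>(n::nat) g r. g \<in> V \<and> r > 0 \<and>
    (\<forall>f\<in>V. N (\<lambda>y. f y - g y) < r \<longrightarrow> (\<forall>e>0. \<exists>f'\<in>V. p f' \<le> real n \<and> N (\<lambda>y. f y - f' y) < e))"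
proof (rule ccontr)
  assume neg: "\<not> ?thesis"
  have step: "\<exists>f s. f \<in> V \<and> 0 < s \<and> s \<le> r / 2 \<and> N (\<lambda>y. f y - g y) + s \<le> r \<and>
      (\<forall>f'\<in>V. p f' \<le> real n \<longrightarrow> s < N (\<lambda>y. f y - f' y))" if "g \<in> V" "r > 0" for n g r
  proof -
    have "\<not> (\<forall>f\<in>V. N (\<lambda>y. f y - g y) < r \<longrightarrow>
        (\<forall>e>0. \<exists>f'\<in>V. p f' \<le> real n \<and> N (\<lambda>y. f y - f' y) < e))"
      using neg that by blast
    then obtain f e where f: "f \<in> V" "N (\<lambda>y. f y - g y) < r" "e > 0"
        "\<And>f'. f' \<in> V \<Longrightarrow> p f' \<le> real n \<Longrightarrow> e \<le> N (\<lambda>y. f y - f' y)"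
      by (auto simp: not_less)
    define t where "t = min (r/2) (min (e/2) (r - N (\<lambda>y. f y - g y)))"
    have t: "0 < t" "t \<le> r / 2" "t < e" "N (\<lambda>y. f y - g y) + t \<le> r"
      using f(2,3) \<open>r > 0\<close> unfolding t_def by linarith+
    show ?thesis
    proof (intro exI conjI ballI impI)
      fix f' assume "f' \<in> V" "p f' \<le> real n"
      from f(4)[OF this] t(3) show "t < N (\<lambda>y. f y - f' y)" by simp
    qed (use f t in auto)
  qed
  have "\<exists>s. \<forall>n. (fst (s n) \<in> V \<and> 0 < snd (s n)) \<and>
     (snd (s (Suc n)) \<le> snd (s n) / 2 \<and>
      N (\<lambda>y. fst (s (Suc n)) y - fst (s n) y) + snd (s (Suc n)) \<le> snd (s n) \<and>
      (\<forall>f'\<in>V. p f' \<le> real n \<longrightarrow> snd (s (Suc n)) < N (\<lambda>y. fst (s (Suc n)) y - f' y)))"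
  proof (rule dependent_nat_choice)
    show "\<exists>x. fst x \<in> V \<and> 0 < (snd x :: real)"
      by (rule exI[of _ "(\<lambda>_. 0, 1)"]) (simp add: zero_in)
  next
    fix x :: "('a \<Rightarrow> complex) \<times> real" and n
    assume "fst x \<in> V \<and> 0 < snd x"
    then show "\<exists>y. (fst y \<in> V \<and> 0 < snd y) \<and> snd y \<le> snd x / 2 \<and>
      N (\<lambda>z. fst y z - fst x z) + snd y \<le> snd x \<and>
      (\<forall>f'\<in>V. p f' \<le> real n \<longrightarrow> snd y < N (\<lambda>z. fst y z - f' z))"
      using step[of "fst x" "snd x" n] by simp
  qed
  then obtain s where s: "\<And>n. fst (s n) \<in> V" "\<And>n. 0 < snd (s n)"
      "\<And>n. snd (s (Suc n)) \<le> snd (s n) / 2"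
      "\<And>n. N (\<lambda>y. fst (s (Suc n)) y - fst (s n) y) + snd (s (Suc n)) \<le> snd (s n)"
      "\<And>n f'. f' \<in> V \<Longrightarrow> p f' \<le> real n \<Longrightarrow> snd (s (Suc n)) < N (\<lambda>y. fst (s (Suc n)) y - f' y)"
    by blast
  define g r where "g = (\<lambda>n. fst (s n))" and "r = (\<lambda>n. snd (s n))"
  have "r n \<le> r 0 * (1/2) ^ n" for n
  proof (induction n)
    case (Suc n) then show ?case using s(3)[of n] by (simp add: r_def)
  qed simp
  moreover have "(\<lambda>n. r 0 * (1/2) ^ n) \<longlonglongrightarrow> 0"
    by (intro tendsto_mult_right_zero LIMSEQ_realpow_zero) auto
  ultimately have r0: "r \<longlonglongrightarrow> 0"
    using s(2) by (intro tendsto_sandwich[OF _ _ tendsto_const, of 0 r]) (auto simp: r_def less_imp_le)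
  have "N (\<lambda>y. g (k + d) y - g k y) + r (k + d) \<le> r k" for k d
  proof (induction d)
    case 0 then show ?case by (simp add: N_zero)
  next
    case (Suc d)
    have "N (\<lambda>y. g (k + Suc d) y - g k y) \<le>
        N (\<lambda>y. g (Suc (k + d)) y - g (k + d) y) + N (\<lambda>y. g (k + d) y - g k y)"
      unfolding add_Suc_right by (intro triangle_via) (auto simp: g_def s)
    with Suc s(4)[of "k + d"] show ?case by (simp add: g_def r_def)
  qed
  note step_sum = this
  have tail: "N (\<lambda>y. g m y - g k y) \<le> r k" if "k \<le> m" for k m
    using step_sum[of k "m - k"] s(2)[of m] that by (simp add: r_def)
  have "g k \<in> V" for k by (simp add: g_def s)
  then obtain f where f: "f \<in> V" "\<And>k. N (\<lambda>y. g k y - f y) \<le> r k"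
    using complete_nested[OF _ r0 tail] by blast
  obtain n :: nat where "p f \<le> real n"
    using real_arch_simple by blast
  from s(5)[OF f(1) this] f(2)[of "Suc n"] show False
    by (simp add: g_def r_def)
qed

text \<open>Zabreiko's lemma. By the Baire step and symmetry, \<open>{p \<le> c}\<close> is dense in a ball around \<open>0\<close>. An
  element of that ball is then approximated repeatedly, halving the error each time, which writes it as a
  series \<open>\<Sum>k. F k\<close> with \<open>p (F k) \<le> c / 2^k\<close>; countable subadditivity bounds \<open>p\<close> by \<open>2 c\<close> on the ball.\<close>

lemma countably_subadditive_bounded:
  fixes p :: "('a \<Rightarrow> complex) \<Rightarrow> real"
  assumes p_nonneg: "\<And>f. f \<in> V \<Longrightarrow> 0 \<le> p f"
    and p_triangle: "\<And>f g. f \<in> V \<Longrightarrow> g \<in> V \<Longrightarrow> p (\<lambda>y. f y + g y) \<le> p f + p g"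
    and p_scale: "\<And>f c. f \<in> V \<Longrightarrow> p (\<lambda>y. c * f y) = norm c * p f"
    and p_countable: "\<And>F f. (\<And>k::nat. F k \<in> V) \<Longrightarrow> f \<in> V \<Longrightarrow> summable (\<lambda>k. p (F k)) \<Longrightarrow>
        (\<lambda>m. N (\<lambda>y. (\<Sum>k<m. F k y) - f y)) \<longlonglongrightarrow> 0 \<Longrightarrow> p f \<le> (\<Sum>k. p (F k))"
  obtains D where "D \<ge> 0" "\<And>f. f \<in> V \<Longrightarrow> p f \<le> D * N f"
proof -
  obtain n :: nat and g r where g: "g \<in> V" and r: "r > 0"
    and dense: "\<And>f e. f \<in> V \<Longrightarrow> N (\<lambda>y. f y - g y) < r \<Longrightarrow> e > 0 \<Longrightarrow>
       \<exists>f'\<in>V. p f' \<le> real n \<and> N (\<lambda>y. f y - f' y) < e"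
    using countably_subadditive_dense_somewhere[of p] by (elim exE conjE) blast
  define c where "c = 2 * real n"
  have c: "c \<ge> 0" by (simp add: c_def)
  have p_diff: "p (\<lambda>y. f y - h y) \<le> p f + p h" if "f \<in> V" "h \<in> V" for f h
    using p_triangle[of f "\<lambda>y. (-1) * h y"] p_scale[of h "-1"] scale_in[of h "-1"] that by simp
  \<comment> \<open>the dense ball is moved to the origin by taking differences, at the cost of doubling the level\<close>
  have centred: "\<exists>f'\<in>V. p f' \<le> c \<and> N (\<lambda>y. f y - f' y) < e"
    if f: "f \<in> V" "N f < r" "e > 0" for f e
  proof -
    obtain a where a: "a \<in> V" "p a \<le> n" "N (\<lambda>y. (f y + g y) - a y) < e / 2"
      using dense[of "\<lambda>y. f y + g y" "e/2"] add_in[OF \<open>f \<in> V\<close> g] f by auto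
    obtain b where b: "b \<in> V" "p b \<le> n" "N (\<lambda>y. g y - b y) < e / 2"
      using dense[of g "e/2"] g f r by (auto simp: N_zero)
    have "N (\<lambda>y. ((f y + g y) - a y) - (g y - b y)) \<le> N (\<lambda>y. (f y + g y) - a y) + N (\<lambda>y. g y - b y)"
      by (intro triangle_diff diff_in add_in g a b \<open>f \<in> V\<close>)
    then show ?thesis
      using a b p_diff[OF a(1) b(1)]
      by (intro bexI[of _ "\<lambda>y. a y - b y"] diff_in) (auto simp: c_def algebra_simps)
  qed
  have scaled: "\<exists>f'\<in>V. p f' \<le> s * c \<and> N (\<lambda>y. f y - f' y) < e"
    if f: "f \<in> V" "s > 0" "N f < s * r" "e > 0" for f s e
  proof -
    have sc: "N (\<lambda>y. complex_of_real (1/s) * f y) < r"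
      using that by (subst scale) (auto simp: norm_divide field_simps)
    obtain h where h: "h \<in> V" "p h \<le> c" "N (\<lambda>y. complex_of_real (1/s) * f y - h y) < e / s"
      using centred[OF scale_in[OF \<open>f \<in> V\<close>] sc, of "e / s"] f by auto
    have "N (\<lambda>y. complex_of_real s * (complex_of_real (1/s) * f y - h y)) =
        s * N (\<lambda>y. complex_of_real (1/s) * f y - h y)"
      using scale[OF diff_in[OF scale_in[OF f(1)] h(1)], of "complex_of_real s" "complex_of_real (1/s)"] f
      by simp
    also have "(\<lambda>y. complex_of_real s * (complex_of_real (1/s) * f y - h y)) =
        (\<lambda>y. f y - complex_of_real s * h y)"
      using that by (auto simp: algebra_simps fun_eq_iff)
    finally show ?thesis
      using h that
      by (intro bexI[of _ "\<lambda>y. complex_of_real s * h y"] scale_in)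
        (auto simp: p_scale field_simps)
  qed
  have unit: "p f \<le> 2 * c" if f: "f \<in> V" "N f < r" for f
  proof -
    \<comment> \<open>\<open>R k\<close> is the error left after \<open>k\<close> approximations\<close>
    have "\<exists>R. \<forall>k. (R k \<in> V \<and> N (R k) < (1/2)^k * r \<and> (k = 0 \<longrightarrow> R k = f)) \<and>
        p (\<lambda>y. R k y - R (Suc k) y) \<le> (1/2)^k * c"
    proof (rule dependent_nat_choice)
      show "\<exists>x. x \<in> V \<and> N x < (1/2)^0 * r \<and> (0 = 0 \<longrightarrow> x = f)"
        using f by auto
    next
      fix x k assume x: "x \<in> V \<and> N x < (1/2)^k * r \<and> (k = 0 \<longrightarrow> x = f)"
      then obtain h where h: "h \<in> V" "p h \<le> (1/2)^k * c" "N (\<lambda>y. x y - h y) < (1/2)^Suc k * r"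
        using scaled[of x "(1/2)^k" "(1/2)^Suc k * r"] r by auto
      then show "\<exists>z. (z \<in> V \<and> N z < (1/2)^Suc k * r \<and> (Suc k = 0 \<longrightarrow> z = f)) \<and>
          p (\<lambda>y. x y - z y) \<le> (1/2)^k * c"
        using x by (intro exI[of _ "\<lambda>y. x y - h y"]) (auto intro: diff_in)
    qed
    then obtain R where R: "\<And>k. R k \<in> V" "\<And>k. N (R k) < (1/2)^k * r" "R 0 = f"
        "\<And>k. p (\<lambda>y. R k y - R (Suc k) y) \<le> (1/2)^k * c"
      by blast
    define F where "F = (\<lambda>k y. R k y - R (Suc k) y)"
    have F: "F k \<in> V" for k unfolding F_def by (intro diff_in R)
    have geo: "(\<lambda>k. (1/2)^k * c) sums (2 * c)"
      using sums_mult2[OF geometric_sums[of "1/2 :: real"], of c] by simp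
    have pos: "0 \<le> p (F k)" for k using p_nonneg[OF F] .
    have le: "p (F k) \<le> (1/2)^k * c" for k using R(4)[of k] by (simp add: F_def)
    have sm: "summable (\<lambda>k. p (F k))"
      using pos le by (intro summable_comparison_test'[OF sums_summable[OF geo], of 0]) auto
    have tel: "(\<Sum>k<m. F k y) = f y - R m y" for m y
      by (induction m) (auto simp: F_def R(3))
    have "(\<lambda>m. N (R m)) \<longlonglongrightarrow> 0"
    proof (rule tendsto_sandwich[OF _ _ tendsto_const])
      show "(\<lambda>m. (1/2)^m * r) \<longlonglongrightarrow> 0"
        by (intro tendsto_mult_left_zero LIMSEQ_realpow_zero) auto
    qed (use R nonneg in \<open>auto intro!: always_eventually less_imp_le\<close>)
    moreover have "N (\<lambda>y. (\<Sum>k<m. F k y) - f y) = N (R m)" for m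
      using scale[OF R(1), of "-1" m] by (simp add: tel)
    ultimately have "p f \<le> (\<Sum>k. p (F k))"
      by (intro p_countable F f sm) auto
    also have "\<dots> \<le> 2 * c"
      using suminf_le[OF le sm sums_summable[OF geo]] sums_unique[OF geo] by simp
    finally show ?thesis .
  qed
  have "p f \<le> (2 * c / r) * N f" if f: "f \<in> V" for f
  proof -
    have "p f \<le> (2 * c / r) * N f + e" if e: "e > 0" for e
    proof -
      define d where "d = e * r / (2 * c + 1)"
      have d: "d > 0" using e r c by (simp add: d_def)
      have Nf: "0 \<le> N f" using nonneg[OF f] .
      define t where "t = r / (N f + d)"
      have t: "t > 0" using r d Nf by (simp add: t_def)
      have "N (\<lambda>y. complex_of_real t * f y) < r"
      proof -
        have "N (\<lambda>y. complex_of_real t * f y) = t * N f"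
          using scale[OF f, of "complex_of_real t"] t by simp
        also have "\<dots> < r" using r d Nf by (simp add: t_def field_simps)
        finally show ?thesis .
      qed
      from unit[OF scale_in[OF f] this] have "t * p f \<le> 2 * c"
        using t f by (simp add: p_scale)
      then have "p f \<le> 2 * c / t" using t by (simp add: field_simps)
      also have "\<dots> = (2 * c / r) * N f + (2 * c / r) * d"
        using r by (simp add: t_def add_divide_distrib algebra_simps)
      also have "(2 * c / r) * d = e * (2 * c / (2 * c + 1))"
        using r by (simp add: d_def)
      also have "\<dots> \<le> e" using e c by (intro mult_left_le) auto
      finally show ?thesis by simp
    qed
    then show ?thesis by (rule field_le_epsilon)
  qed
  then show ?thesis using that[of "2 * c / r"] c r by simp
qed

end

lemma (in complete_seminorm) summable_sum_exists:
  assumes F: "\<And>k::nat. F k \<in> V" and summ: "summable (\<lambda>k. N (F k))"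
  obtains s where "s \<in> V" "(\<lambda>m. N (\<lambda>y. (\<Sum>k<m. F k y) - s y)) \<longlonglongrightarrow> 0" "N s \<le> (\<Sum>k. N (F k))"
proof -
  define S where "S = (\<lambda>m y. \<Sum>k<m. F k y)"
  have S: "S m \<in> V" for m unfolding S_def by (intro sum_in F) auto
  have tail: "N (\<lambda>y. S m y - S k y) \<le> (\<Sum>j. N (F (j + k)))" if "k \<le> m" for k m
  proof -
    have "S m y - S k y = (\<Sum>j\<in>{k..<m}. F j y)" for y
      unfolding S_def using that by (simp add: sum_diff_nat_ivl lessThan_atLeast0)
    then have "N (\<lambda>y. S m y - S k y) \<le> (\<Sum>j\<in>{k..<m}. N (F j))"
      using triangle_sum[of "{k..<m}" F] F by simp
    also have "(\<Sum>j\<in>{k..<m}. N (F j)) = (\<Sum>j<m-k. N (F (j + k)))"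
      using that by (intro sum.reindex_bij_witness[of _ "\<lambda>j. j + k" "\<lambda>j. j - k"]) auto
    also have "\<dots> \<le> (\<Sum>j. N (F (j + k)))"
      using summ by (intro sum_le_suminf summable_ignore_initial_segment) (auto intro: nonneg F)
    finally show ?thesis .
  qed
  have "(\<lambda>k. \<Sum>j. N (F (j + k))) \<longlonglongrightarrow> 0"
    using suminf_exist_split2[OF summ] .
  from complete_nested[OF S this tail] obtain s where s: "s \<in> V"
      "\<And>k. N (\<lambda>y. S k y - s y) \<le> (\<Sum>j. N (F (j + k)))" "(\<lambda>m. N (\<lambda>y. S m y - s y)) \<longlonglongrightarrow> 0"
    by blast
  have "N s \<le> (\<Sum>k. N (F k))"
    using s(2)[of 0] N_minus_commute[OF zero_in s(1)] by (simp add: S_def)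
  with s that show ?thesis unfolding S_def by blast
qed

lemma (in complete_seminorm) homogeneous_bounded:
  assumes T: "\<And>g. g \<in> V \<Longrightarrow> T g \<in> V" and hom: "\<And>c g. g \<in> V \<Longrightarrow> T (\<lambda>y. c * g y) = (\<lambda>y. c * T g y)"
    and d: "d > 0" and bnd: "\<And>g. g \<in> V \<Longrightarrow> N g < d \<Longrightarrow> N (T g) < 1"
    and g: "g \<in> V"
  shows "N (T g) \<le> (1 / d) * N g"
proof (rule field_le_epsilon)
  fix e :: real assume e: "e > 0"
  have Ng: "0 \<le> N g" by (rule nonneg[OF g])
  \<comment> \<open>the summand \<open>e * d\<close> keeps the scaling factor finite when \<open>N g = 0\<close>\<close>
  define s where "s = d / (N g + e * d)"
  have s: "s > 0" using d e Ng by (simp add: s_def add_nonneg_pos)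
  have "N (\<lambda>y. complex_of_real s * g y) = s * N g" using scale[OF g, of "complex_of_real s"] s by simp
  also have "\<dots> < d" using d e Ng by (simp add: s_def field_simps add_nonneg_pos)
  finally have "N (T (\<lambda>y. complex_of_real s * g y)) < 1" by (intro bnd scale_in g)
  then have "s * N (T g) < 1" using hom[OF g, of "complex_of_real s"] scale[OF T[OF g], of "complex_of_real s"] s by simp
  then have "N (T g) < 1 / s" using s by (simp add: field_simps)
  also have "1 / s = (1 / d) * N g + e" using d by (simp add: s_def add_divide_distrib)
  finally show "N (T g) \<le> (1 / d) * N g + e" by simp
qed

text \<open>The solution of \<open>T f = g\<close> is the limit of the iteration \<open>f \<mapsto> g + (f - T f)\<close>, a contraction with
  factor \<open>1/2\<close>. The assumption \<open>faithful\<close> makes the solution unique as a function and not only up to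
  functions of seminorm zero, so that the inverse is linear on the nose.\<close>

lemma (in complete_seminorm) neumann_invertible:
  assumes faithful: "\<And>f. f \<in> V \<Longrightarrow> N f = 0 \<Longrightarrow> f = (\<lambda>_. 0)"
    and T_in: "\<And>f. f \<in> V \<Longrightarrow> T f \<in> V"
    and T_add: "\<And>f g. f \<in> V \<Longrightarrow> g \<in> V \<Longrightarrow> T (\<lambda>y. f y + g y) = (\<lambda>y. T f y + T g y)"
    and T_scale: "\<And>f c. f \<in> V \<Longrightarrow> T (\<lambda>y. c * f y) = (\<lambda>y. c * T f y)"
    and T_near: "\<And>f. f \<in> V \<Longrightarrow> N (\<lambda>y. T f y - f y) \<le> N f / 2"
  shows "invertible_operator_on V N T"
proof -
  have eqI: "f = g" if "f \<in> V" "g \<in> V" "N (\<lambda>y. f y - g y) = 0" for f g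
    using faithful[OF diff_in[OF that(1,2)] that(3)] by (auto simp: fun_eq_iff)
  have T_diff: "T (\<lambda>y. f y - g y) = (\<lambda>y. T f y - T g y)" if "f \<in> V" "g \<in> V" for f g
    using T_add[OF that(1) scale_in[OF that(2), of "-1"]] T_scale[OF that(2), of "-1"] by simp
  have lower: "N f \<le> 2 * N (T f)" if "f \<in> V" for f
    using triangle_via[OF that T_in[OF that] zero_in] T_near[OF that]
      N_minus_commute[OF that T_in[OF that]] by simp
  have upper: "N (T f) \<le> 2 * N f" if "f \<in> V" for f
    using triangle[OF diff_in[OF T_in[OF that] that] that] T_near[OF that] nonneg[OF that] by simp
  have surj: "\<exists>f\<in>V. T f = g" if g: "g \<in> V" for g
  proof -
    define s where "s = rec_nat (\<lambda>_. 0) (\<lambda>_ f y. g y + (f y - T f y))"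
    have s_Suc: "s (Suc k) = (\<lambda>y. g y + (s k y - T (s k) y))" and s_0: "s 0 = (\<lambda>_. 0)" for k
      by (auto simp: s_def)
    have s: "s k \<in> V" for k
      by (induction k) (auto simp: s_0 s_Suc intro!: zero_in add_in diff_in T_in g)
    have contr: "N (\<lambda>y. s (Suc (Suc k)) y - s (Suc k) y) \<le> N (\<lambda>y. s (Suc k) y - s k y) / 2" for k
    proof -
      let ?d = "\<lambda>y. s (Suc k) y - s k y"
      have d: "?d \<in> V" by (intro diff_in s)
      have "s (Suc (Suc k)) y - s (Suc k) y = ?d y - T ?d y" for y
        unfolding T_diff[OF s s] s_Suc[of "Suc k"] by (subst (3) s_Suc) (simp add: algebra_simps)
      then have "N (\<lambda>y. s (Suc (Suc k)) y - s (Suc k) y) = N (\<lambda>y. ?d y - T ?d y)" by (simp only:)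
      also have "\<dots> \<le> N ?d / 2" using T_near[OF d] N_minus_commute[OF d T_in[OF d]] by simp
      finally show ?thesis .
    qed
    define c where "c = N (\<lambda>y. s (Suc 0) y - s 0 y)"
    have c: "c \<ge> 0" unfolding c_def by (intro nonneg diff_in s)
    have st: "N (\<lambda>y. s (Suc k) y - s k y) \<le> c * (1/2)^k" for k
    proof (induction k)
      case (Suc k) then show ?case using contr[of k] by simp
    qed (simp add: c_def)
    have far: "N (\<lambda>y. s (k + d) y - s k y) + 2 * c * (1/2)^(k + d) \<le> 2 * c * (1/2)^k" for k d
    proof (induction d)
      case 0 then show ?case by (simp add: N_zero)
    next
      case (Suc d)
      have "N (\<lambda>y. s (Suc (k + d)) y - s k y) \<le>
          N (\<lambda>y. s (Suc (k + d)) y - s (k + d) y) + N (\<lambda>y. s (k + d) y - s k y)"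
        by (intro triangle_via s)
      with Suc st[of "k + d"] show ?case by simp
    qed
    have tail: "N (\<lambda>y. s m y - s k y) \<le> 2 * c * (1/2)^k" if "k \<le> m" for k m
    proof -
      have "0 \<le> 2 * c * (1/2)^m" using c by simp
      then show ?thesis using far[of k "m - k"] that by simp
    qed
    have "(\<lambda>k. 2 * c * (1/2)^k) \<longlonglongrightarrow> 0"
      by (intro tendsto_mult_right_zero LIMSEQ_realpow_zero) auto
    then obtain f where f: "f \<in> V" and lim: "(\<lambda>k. N (\<lambda>y. s k y - f y)) \<longlonglongrightarrow> 0"
      by (rule complete_nested[OF s _ tail])
    have bnd: "N (\<lambda>y. T f y - g y) \<le> N (\<lambda>y. s (Suc k) y - f y) + 3 * N (\<lambda>y. s k y - f y)" for k
    proof -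
      let ?d = "\<lambda>y. s k y - f y"
      have d: "?d \<in> V" by (intro diff_in s f)
      have "T f y - g y = (?d y - T ?d y) - (s (Suc k) y - f y)" for y
        unfolding T_diff[OF s f] s_Suc by (simp add: algebra_simps)
      then have "N (\<lambda>y. T f y - g y) = N (\<lambda>y. (?d y - T ?d y) - (s (Suc k) y - f y))" by simp
      also have "\<dots> \<le> N (\<lambda>y. ?d y - T ?d y) + N (\<lambda>y. s (Suc k) y - f y)"
        by (intro triangle_diff diff_in d T_in s f)
      also have "N (\<lambda>y. ?d y - T ?d y) \<le> 3 * N ?d"
        using triangle_diff[OF d T_in[OF d]] upper[OF d] by simp
      finally show ?thesis by simp
    qed
    have "(\<lambda>k. N (\<lambda>y. s (Suc k) y - f y) + 3 * N (\<lambda>y. s k y - f y)) \<longlonglongrightarrow> 0"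
      using tendsto_add[OF LIMSEQ_Suc[OF lim] tendsto_mult_right_zero[OF lim]] by simp
    then have "N (\<lambda>y. T f y - g y) \<le> 0"
      by (rule tendsto_lowerbound) (simp_all add: bnd)
    then have "T f = g"
      using nonneg[OF diff_in[OF T_in[OF f] g]] by (intro eqI T_in f g) auto
    with f show ?thesis by blast
  qed
  define S where "S = (\<lambda>g. SOME f. f \<in> V \<and> T f = g)"
  have S: "S g \<in> V" "T (S g) = g" if "g \<in> V" for g
    using someI_ex[of "\<lambda>f. f \<in> V \<and> T f = g"] surj[OF that] unfolding S_def by blast+
  have inj: "f = g" if "f \<in> V" "g \<in> V" "T f = T g" for f g
  proof -
    have "N (\<lambda>y. f y - g y) \<le> 2 * N (T (\<lambda>y. f y - g y))"
      by (intro lower diff_in that)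
    also have "T (\<lambda>y. f y - g y) = (\<lambda>_. 0)"
      using that by (simp add: T_diff)
    finally have "N (\<lambda>y. f y - g y) = 0"
      using nonneg[OF diff_in[OF that(1,2)]] by (simp add: N_zero)
    then show ?thesis by (rule eqI[OF that(1,2)])
  qed
  have "bounded_operator_on V N S"
    unfolding bounded_operator_on_def
  proof (intro conjI ballI allI exI[of _ 2])
    fix f g assume "f \<in> V" "g \<in> V"
    then show "S (\<lambda>y. f y + g y) = (\<lambda>y. S f y + S g y)"
      by - (rule inj, auto simp: S add_in T_add)
  next
    fix f c assume "f \<in> V"
    then show "S (\<lambda>y. c * f y) = (\<lambda>y. c * S f y)"
      by - (rule inj, auto simp: S scale_in T_scale)
  next
    fix f assume "f \<in> V"
    then show "N (S f) \<le> 2 * N f" using lower[OF S(1)] S(2) by metis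
  qed (rule S)
  moreover have "bounded_operator_on V N T"
    unfolding bounded_operator_on_def using T_in T_add T_scale upper by blast
  moreover have "S (T f) = f" if "f \<in> V" for f
    by - (rule inj, simp_all add: S T_in that)
  ultimately show ?thesis
    unfolding invertible_operator_on_def using S by blast
qed

section \<open>A gliding hump\<close>

text \<open>A lemma of Schur and Phillips. Suppose that the full row sums tend to some \<open>L \<noteq> 0\<close>. Along a sparse sequence
  of rows, nearly all of the mass of a row lies in a block of columns, the blocks being disjoint and
  moving to the right. Let \<open>A\<close> be the union of every second block. The row sums over \<open>A\<close> are then close
  to \<open>L\<close> on the rows with even number and close to \<open>0\<close> on the others, and do not converge.\<close>

lemma phillips_schur:
  fixes c :: "nat \<Rightarrow> nat \<Rightarrow> complex"
  assumes summable: "\<And>n. summable (\<lambda>j. norm (c n j))"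
    and pointwise: "\<And>j. (\<lambda>n. c n j) \<longlonglongrightarrow> 0"
    and convergent: "\<And>A. convergent (\<lambda>n. \<Sum>j. indicator A j * c n j)"
  shows "(\<lambda>n. \<Sum>j. c n j) \<longlonglongrightarrow> 0"
proof -
  obtain L where L: "(\<lambda>n. \<Sum>j. c n j) \<longlonglongrightarrow> L"
    using convergent[of UNIV] by (auto simp: convergent_def)
  have "L = 0"
  proof (rule ccontr)
    assume "L \<noteq> 0"
    define h where "h = norm L / 10"
    have h: "h > 0" using \<open>L \<noteq> 0\<close> by (simp add: h_def)
    have big: "eventually (\<lambda>n. norm (\<Sum>j. c n j) > 9 * h) sequentially"
      using tendsto_norm[OF L] h by (intro order_tendstoD) (auto simp: h_def)
    \<comment> \<open>a later row with little mass before column \<open>m\<close> and, for a suitable \<open>m'\<close>, little mass from \<open>m'\<close> on\<close>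
    have step: "\<exists>n' m'. n < n' \<and> m < m' \<and> norm (\<Sum>j. c n' j) > 9 * h \<and>
        (\<Sum>j<m. norm (c n' j)) < h \<and> (\<Sum>j. norm (c n' (j + m'))) < h" for n m :: nat
    proof -
      have "(\<lambda>k. \<Sum>j<m. norm (c k j)) \<longlonglongrightarrow> 0"
        by (intro tendsto_null_sum tendsto_norm_zero pointwise)
      then have "eventually (\<lambda>k. (\<Sum>j<m. norm (c k j)) < h \<and> norm (\<Sum>j. c k j) > 9 * h \<and> n < k) sequentially"
        using h big by (intro eventually_conj eventually_gt_at_top) (auto intro: order_tendstoD)
      then obtain n' where n': "(\<Sum>j<m. norm (c n' j)) < h" "norm (\<Sum>j. c n' j) > 9 * h" "n < n'"
        by (auto simp: eventually_sequentially)
      obtain m0 where m0: "\<And>m'. m' \<ge> m0 \<Longrightarrow> norm (\<Sum>j. norm (c n' (j + m'))) < h"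
        using suminf_exist_split[OF h summable[of n']] by blast
      have "(\<Sum>j. norm (c n' (j + (m0 + Suc m)))) < h"
        using m0[of "m0 + Suc m"] abs_ge_self by (metis le_add1 order_le_less_trans real_norm_def)
      then show ?thesis using n' by (intro exI[of _ n'] exI[of _ "m0 + Suc m"]) auto
    qed
    have "\<exists>s. \<forall>k. True \<and> (fst (s k) < fst (s (Suc k)) \<and> snd (s k) < snd (s (Suc k)) \<and>
        norm (\<Sum>j. c (fst (s (Suc k))) j) > 9 * h \<and>
        (\<Sum>j<snd (s k). norm (c (fst (s (Suc k))) j)) < h \<and>
        (\<Sum>j. norm (c (fst (s (Suc k))) (j + snd (s (Suc k))))) < h)"
      by (rule dependent_nat_choice) (use step in auto)
    then obtain s where s: "\<And>k. fst (s k) < fst (s (Suc k))" "\<And>k. snd (s k) < snd (s (Suc k))"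
        "\<And>k. norm (\<Sum>j. c (fst (s (Suc k))) j) > 9 * h"
        "\<And>k. (\<Sum>j<snd (s k). norm (c (fst (s (Suc k))) j)) < h"
        "\<And>k. (\<Sum>j. norm (c (fst (s (Suc k))) (j + snd (s (Suc k))))) < h"
      by blast
    define n m where "n = (\<lambda>k. fst (s (Suc k)))" and "m = (\<lambda>k. snd (s k))"
    have sn: "strict_mono n" and sm: "strict_mono m"
      using s(1,2) by (auto simp: strict_mono_Suc_iff n_def m_def)
    define A where "A = (\<Union>k. {m (2*k)..<m (Suc (2*k))})"
    have out: "norm (\<Sum>j. indicator D j * c (n k) j) \<le> 2 * h"
      if D: "D \<inter> {m k..<m (Suc k)} = {}" for k and D :: "nat set"
    proof -
      have sN: "summable (\<lambda>j. norm (indicator D j * c (n k) j))"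
        by (rule summable_comparison_test'[OF summable[of "n k"], of 0])
          (auto simp: norm_mult indicator_def)
      have "norm (\<Sum>j. indicator D j * c (n k) j) \<le> (\<Sum>j. norm (indicator D j * c (n k) j))"
        by (rule summable_norm[OF sN])
      also have "\<dots> = (\<Sum>j. norm (indicator D (j + m (Suc k)) * c (n k) (j + m (Suc k))))
            + (\<Sum>j<m (Suc k). norm (indicator D j * c (n k) j))"
        by (rule suminf_split_initial_segment[OF sN])
      also have "(\<Sum>j. norm (indicator D (j + m (Suc k)) * c (n k) (j + m (Suc k))))
          \<le> (\<Sum>j. norm (c (n k) (j + m (Suc k))))"
        using summable_ignore_initial_segment[OF sN, of "m (Suc k)"]
          summable_ignore_initial_segment[OF summable[of "n k"], of "m (Suc k)"]
        by (intro suminf_le) (auto simp: norm_mult indicator_def)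
      also have "\<dots> \<le> h" using s(5)[of k] by (simp add: n_def m_def)
      also have "(\<Sum>j<m (Suc k). norm (indicator D j * c (n k) j)) \<le> (\<Sum>j<m k. norm (c (n k) j))"
      proof -
        have "(\<Sum>j<m (Suc k). norm (indicator D j * c (n k) j)) =
            (\<Sum>j<m k. norm (indicator D j * c (n k) j))"
        proof (rule sum.mono_neutral_right)
          show "{..<m k} \<subseteq> {..<m (Suc k)}" using strict_monoD[OF sm, of k "Suc k"] by auto
          show "\<forall>j\<in>{..<m (Suc k)} - {..<m k}. norm (indicator D j * c (n k) j) = 0"
          proof
            fix j assume "j \<in> {..<m (Suc k)} - {..<m k}"
            then have "j \<notin> D" using D by auto
            then show "norm (indicator D j * c (n k) j) = 0" by simp
          qed
        qed simp
        also have "\<dots> \<le> (\<Sum>j<m k. norm (c (n k) j))"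
          by (intro sum_mono) (auto simp: norm_mult indicator_def)
        finally show ?thesis .
      qed
      also have "\<dots> \<le> h" using s(4)[of k] by (simp add: n_def m_def)
      finally show ?thesis by simp
    qed
    have blocks: "j \<in> {m k..<m (Suc k)} \<Longrightarrow> j \<in> {m l..<m (Suc l)} \<Longrightarrow> k = l" for j k l
    proof (rule ccontr)
      assume a: "j \<in> {m k..<m (Suc k)}" "j \<in> {m l..<m (Suc l)}" "k \<noteq> l"
      then consider "Suc k \<le> l" | "Suc l \<le> k" by linarith
      then show False
        using strict_mono_less_eq[OF sm, of "Suc k" l] strict_mono_less_eq[OF sm, of "Suc l" k] a
        by cases auto
    qed
    obtain l where l: "(\<lambda>k. \<Sum>j. indicator A j * c k j) \<longlonglongrightarrow> l"
      using convergent[of A] by (auto simp: convergent_def)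
    have odd: "norm (\<Sum>j. indicator A j * c (n (Suc (2*k))) j) \<le> 2 * h" for k
    proof (rule out, safe)
      fix j assume j: "j \<in> A" "j \<in> {m (Suc (2*k))..<m (Suc (Suc (2*k)))}"
      then obtain i where "j \<in> {m (2*i)..<m (Suc (2*i))}" by (auto simp: A_def)
      from blocks[OF this j(2)] have False by presburger
      then show "j \<in> {}" ..
    qed
    have even: "norm (\<Sum>j. indicator A j * c (n (2*k)) j) \<ge> 7 * h" for k
    proof -
      let ?n = "n (2*k)"
      have sA: "summable (\<lambda>j. indicator B j * c ?n j)" for B :: "nat set"
        by (rule summable_comparison_test'[OF summable[of ?n], of 0])
          (auto simp: norm_mult indicator_def)
      have "(\<Sum>j. c ?n j) = (\<Sum>j. indicator A j * c ?n j + indicator (-A) j * c ?n j)"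
        by (intro suminf_cong) (auto simp: indicator_def)
      also have "\<dots> = (\<Sum>j. indicator A j * c ?n j) + (\<Sum>j. indicator (-A) j * c ?n j)"
        by (rule suminf_add[symmetric, OF sA sA])
      finally have "norm (\<Sum>j. c ?n j) \<le>
          norm (\<Sum>j. indicator A j * c ?n j) + norm (\<Sum>j. indicator (-A) j * c ?n j)"
        by (metis norm_triangle_ineq)
      moreover have "norm (\<Sum>j. indicator (-A) j * c ?n j) \<le> 2 * h"
        by (rule out) (auto simp: A_def)
      moreover have "norm (\<Sum>j. c ?n j) > 9 * h" using s(3)[of "2*k"] by (simp add: n_def)
      ultimately show ?thesis by simp
    qed
    have "strict_mono (\<lambda>k. n (2 * k))" "strict_mono (\<lambda>k. n (Suc (2 * k)))"
      using strict_monoD[OF sn] by (auto simp: strict_mono_def)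
    then have "(\<lambda>k. norm (\<Sum>j. indicator A j * c (n (2*k)) j)) \<longlonglongrightarrow> norm l"
      "(\<lambda>k. norm (\<Sum>j. indicator A j * c (n (Suc (2*k))) j)) \<longlonglongrightarrow> norm l"
      using LIMSEQ_subseq_LIMSEQ[OF l] by (auto simp: o_def intro!: tendsto_norm)
    then have "7 * h \<le> norm l" "norm l \<le> 2 * h"
      using even odd by (auto intro: tendsto_lowerbound tendsto_upperbound always_eventually)
    then show False using h by simp
  qed
  with L show ?thesis by simp
qed

text \<open>The integrals of \<open>v n\<close> over the sets \<open>P j\<close> form a matrix with absolutely summable rows, to which
  \<open>phillips_schur\<close> applies. Convergence of the integrals over all unions of
  the sets \<open>P j\<close> takes the place of a dominating function.\<close>

lemma nikodym_vanishing:
  fixes v :: "nat \<Rightarrow> 'a \<Rightarrow> complex"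
  assumes v: "\<And>n. integrable M (v n)"
    and P: "\<And>j::nat. P j \<in> sets M" "disjoint_family P" "(\<Union>j. P j) = space M"
    and piece: "\<And>j. (\<lambda>n. \<integral>x. indicator (P j) x * v n x \<partial>M) \<longlonglongrightarrow> 0"
    and convergent: "\<And>A. convergent (\<lambda>n. \<integral>x. indicator (\<Union>j\<in>A. P j) x * v n x \<partial>M)"
  shows "(\<lambda>n. \<integral>x. v n x \<partial>M) \<longlonglongrightarrow> 0"
proof -
  define c where "c = (\<lambda>n j. \<integral>x. indicator (P j) x * v n x \<partial>M)"
  have ind_int: "integrable M (\<lambda>x. indicator S x * v n x)" if "S \<in> sets M" for S n
    using integrable_mult_indicator[OF that v[of n]]
    by (rule Bochner_Integration.integrable_cong[THEN iffD1, rotated -1]) (auto simp: indicator_def)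
  have owner: "\<exists>i. \<forall>j. x \<in> P j \<longleftrightarrow> j = i" if "x \<in> space M" for x
    using P(2,3) that unfolding disjoint_family_on_def by blast
  have sums: "(\<lambda>j. indicator A j * c n j) sums (\<integral>x. indicator (\<Union>j\<in>A. P j) x * v n x \<partial>M)"
    and summ: "summable (\<lambda>j. norm (c n j))" for A n
  proof -
    let ?g = "\<lambda>j x. indicator A j * (indicator (P j) x * v n x)"
    have one: "(\<lambda>j. indicator (P j) x * norm (v n x)) sums norm (v n x)" if x: "x \<in> space M" for x
    proof -
      obtain i where i: "\<And>j. x \<in> P j \<longleftrightarrow> j = i" using owner[OF x] by blast
      have "(\<lambda>j. if j = i then norm (v n x) else 0) sums norm (v n x)" by (rule sums_single)
      moreover have "(if j = i then norm (v n x) else 0) = indicator (P j) x * norm (v n x)" for j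
        by (simp add: i indicator_def)
      ultimately show ?thesis by simp
    qed
    have part: "(\<Sum>j<m. \<integral>x. indicator (P j) x * norm (v n x) \<partial>M) \<le> (\<integral>x. norm (v n x) \<partial>M)" for m
    proof -
      have int: "integrable M (\<lambda>x. indicator (P j) x * norm (v n x))" for j
        using integrable_mult_indicator[OF P(1)[of j] integrable_norm[OF v[of n]]]
        by simp
      have "(\<Sum>j<m. \<integral>x. indicator (P j) x * norm (v n x) \<partial>M) =
          (\<integral>x. (\<Sum>j<m. indicator (P j) x * norm (v n x)) \<partial>M)"
        by (rule Bochner_Integration.integral_sum[symmetric]) (rule int)
      also have "\<dots> \<le> (\<integral>x. norm (v n x) \<partial>M)"
      proof (rule integral_mono)
        fix x assume "x \<in> space M"
        then show "(\<Sum>j<m. indicator (P j) x * norm (v n x)) \<le> norm (v n x)"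
          using sum_le_suminf[OF sums_summable[OF one], of x "{..<m}"] sums_unique[OF one, of x] by simp
      qed (intro Bochner_Integration.integrable_sum int integrable_norm v)+
      finally show ?thesis .
    qed
    have sI: "summable (\<lambda>j. \<integral>x. indicator (P j) x * norm (v n x) \<partial>M)"
      by (rule summableI_nonneg_bounded[where x="\<integral>x. norm (v n x) \<partial>M"])
        (auto intro: part integral_nonneg)
    have nb: "norm (c n j) \<le> (\<integral>x. indicator (P j) x * norm (v n x) \<partial>M)" for j
      unfolding c_def by (rule order_trans[OF integral_norm_bound])
        (auto simp: norm_mult indicator_def intro!: integral_mono_AE' eq_refl
          Bochner_Integration.integral_cong)
    show "summable (\<lambda>j. norm (c n j))"
      by (rule summable_comparison_test'[OF sI, of 0]) (use nb in auto)
    have "(\<lambda>j. \<integral>x. ?g j x \<partial>M) sums (\<integral>x. (\<Sum>j. ?g j x) \<partial>M)"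
    proof (rule sums_integral)
      show "integrable M (?g j)" for j
        using ind_int[OF P(1)] by (intro integrable_mult_right) auto
      show "AE x in M. summable (\<lambda>j. norm (?g j x))"
      proof (rule AE_I2)
        fix x assume "x \<in> space M"
        show "summable (\<lambda>j. norm (?g j x))"
          by (rule summable_comparison_test'[OF sums_summable[OF one[OF \<open>x \<in> space M\<close>]], of 0])
            (auto simp: norm_mult indicator_def)
      qed
      show "summable (\<lambda>j. \<integral>x. norm (?g j x) \<partial>M)"
      proof (rule summable_comparison_test'[OF sI, of 0])
        fix j
        show "norm (\<integral>x. norm (?g j x) \<partial>M) \<le> (\<integral>x. indicator (P j) x * norm (v n x) \<partial>M)"
          by (auto simp: norm_mult indicator_def intro!: integral_nonneg eq_refl
             Bochner_Integration.integral_cong)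
      qed
    qed
    moreover have "(\<integral>x. (\<Sum>j. ?g j x) \<partial>M) = (\<integral>x. indicator (\<Union>j\<in>A. P j) x * v n x \<partial>M)"
    proof (rule Bochner_Integration.integral_cong[OF refl])
      fix x assume "x \<in> space M"
      then obtain i where i: "\<And>j. x \<in> P j \<longleftrightarrow> j = i" using owner by blast
      have "(\<lambda>j. if j = i then indicator A i * v n x else 0) sums (indicator A i * v n x)"
        by (rule sums_single)
      moreover have "(if j = i then indicator A i * v n x else 0) = ?g j x" for j
        by (simp add: i indicator_def)
      ultimately have "(\<lambda>j. ?g j x) sums (indicator A i * v n x)" by simp
      then have "(\<Sum>j. ?g j x) = indicator A i * v n x" by (rule sums_unique[symmetric])
      also have "\<dots> = indicator (\<Union>j\<in>A. P j) x * v n x"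
        by (simp add: i indicator_def)
      finally show "(\<Sum>j. ?g j x) = indicator (\<Union>j\<in>A. P j) x * v n x" .
    qed
    ultimately show "(\<lambda>j. indicator A j * c n j) sums (\<integral>x. indicator (\<Union>j\<in>A. P j) x * v n x \<partial>M)"
      by (simp add: c_def)
  qed
  have "(\<lambda>n. \<Sum>j. c n j) \<longlonglongrightarrow> 0"
  proof (rule phillips_schur)
    show "convergent (\<lambda>n. \<Sum>j. indicator A j * c n j)" for A
      using convergent[of A] sums_unique[OF sums] by simp
    show "(\<lambda>n. c n j) \<longlonglongrightarrow> 0" for j unfolding c_def by (rule piece)
  qed (rule summ)
  moreover have "(\<Sum>j. c n j) = (\<integral>x. v n x \<partial>M)" for n
  proof -
    have "(\<Sum>j. c n j) = (\<integral>x. indicator (\<Union>j. P j) x * v n x \<partial>M)"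
      using sums_unique[OF sums[of UNIV n]] by simp
    also have "\<dots> = (\<integral>x. v n x \<partial>M)"
      using P(3) by (intro Bochner_Integration.integral_cong) auto
    finally show ?thesis .
  qed
  ultimately show ?thesis by simp
qed

section \<open>Solid Banach function spaces\<close>

locale solid_function_space = banach_function_space M B nrm
  for M :: "'g::topological_space measure" and B nrm +
  assumes solid: "solid M B"
    and compact_fmeasurable: "\<And>K. compact K \<Longrightarrow> K \<in> fmeasurable M"
    and covered_by_compacts: "\<exists>K::nat \<Rightarrow> 'g set. (\<forall>n. compact (K n)) \<and> space M \<subseteq> (\<Union>n. K n)"
begin

sublocale complete_seminorm B nrm
  by unfold_locales (rule B_zero B_add B_scale nrm_nonneg nrm_triangle nrm_scale B_complete; assumption)+

lemma measurable_B: "f \<in> B \<Longrightarrow> f \<in> borel_measurable M"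
  using B_measurable by blast

lemma solidD: "f \<in> borel_measurable M \<Longrightarrow> g \<in> B \<Longrightarrow> (AE y in M. norm (f y) \<le> norm (g y)) \<Longrightarrow> f \<in> B"
  using solid unfolding solid_def by blast

lemma AE_cong_B:
  assumes "f \<in> B" "g \<in> borel_measurable M" "AE y in M. f y = g y"
  shows "g \<in> B" "nrm g = nrm f"
proof -
  show g: "g \<in> B" by (rule solidD[OF assms(2,1)]) (use assms(3) in auto)
  have "nrm (\<lambda>y. f y - g y) = 0" "nrm (\<lambda>y. g y - f y) = 0"
    using assms(3) by (subst nrm_eq_0_iff[OF diff_in]; auto intro: g assms(1))+
  then show "nrm g = nrm f"
    using triangle[OF diff_in[OF \<open>f \<in> B\<close> g] g] triangle[OF diff_in[OF g \<open>f \<in> B\<close>] \<open>f \<in> B\<close>] by simp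
qed

lemma bounded_mult_in:
  assumes "h \<in> borel_measurable M" "\<And>y. norm (h y) \<le> c" "f \<in> B"
  shows "(\<lambda>y. h y * f y) \<in> B"
proof (rule solidD)
  show "(\<lambda>y. complex_of_real c * f y) \<in> B" by (rule scale_in[OF assms(3)])
  have "norm (h y * f y) \<le> norm (complex_of_real c * f y)" for y
    using assms(2)[of y] norm_ge_zero[of "h y"] unfolding norm_mult norm_of_real
    by (intro mult_right_mono) (auto intro: order_trans abs_ge_self)
  then show "AE y in M. norm (h y * f y) \<le> norm (complex_of_real c * f y)" by simp
qed (use assms measurable_B in measurable)

lemma level_set:
  fixes f :: "'g \<Rightarrow> complex"
  assumes "f \<in> borel_measurable M" "compact K"
  shows "{y\<in>K. (\<delta>::real) \<le> norm (f y)} \<in> fmeasurable M"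
proof -
  have "{y\<in>K. \<delta> \<le> norm (f y)} = K \<inter> {y\<in>space M. \<delta> \<le> norm (f y)}"
    using fmeasurableD[OF compact_fmeasurable[OF assms(2)]] sets.sets_into_space by blast
  moreover have "{y\<in>space M. \<delta> \<le> norm (f y)} \<in> sets M"
    using assms(1) by measurable
  ultimately show ?thesis
    using compact_fmeasurable[OF assms(2)] by (auto intro: fmeasurable_Int_fmeasurable)
qed

text \<open>Convergence in \<open>B\<close> is local convergence in measure, so any other local limit in measure agrees with
  the limit in \<open>B\<close>. This takes the place of closedness of the graph in the two applications of Zabreiko's
  lemma.\<close>

lemma local_limit_unique:
  assumes F: "\<And>k::nat. F k \<in> B" and s: "s \<in> B" and lim: "(\<lambda>k. nrm (\<lambda>y. F k y - s y)) \<longlonglongrightarrow> 0"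
    and h: "h \<in> borel_measurable M"
    and loc: "\<And>K \<delta>. compact K \<Longrightarrow> \<delta> > 0 \<Longrightarrow> (\<lambda>k. measure M {y\<in>K. \<delta> \<le> norm (F k y - h y)}) \<longlonglongrightarrow> 0"
  shows "AE y in M. s y = h y"
proof -
  have null: "AE y in M. y \<in> K \<longrightarrow> norm (s y - h y) < 2 * \<delta>" if K: "compact K" and \<delta>: "\<delta> > 0" for K \<delta>
  proof -
    let ?E = "{y\<in>K. 2 * \<delta> \<le> norm (s y - h y)}"
    have m: "{y\<in>K. d \<le> norm (F k y - s y)} \<in> fmeasurable M"
       "{y\<in>K. d \<le> norm (F k y - h y)} \<in> fmeasurable M" "?E \<in> fmeasurable M" for k d
      using h measurable_B[OF F] measurable_B[OF s] by (auto intro!: level_set K)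
    have "measure M ?E \<le> measure M {y\<in>K. \<delta> \<le> norm (F k y - s y)} + measure M {y\<in>K. \<delta> \<le> norm (F k y - h y)}" for k
    proof -
      have "?E \<subseteq> {y\<in>K. \<delta> \<le> norm (F k y - s y)} \<union> {y\<in>K. \<delta> \<le> norm (F k y - h y)}"
      proof
        fix y assume y: "y \<in> ?E"
        have "norm (s y - h y) \<le> norm (F k y - s y) + norm (F k y - h y)"
          by (metis norm_minus_commute norm_diff_triangle_le order_refl)
        then show "y \<in> {y\<in>K. \<delta> \<le> norm (F k y - s y)} \<union> {y\<in>K. \<delta> \<le> norm (F k y - h y)}"
          using y by auto
      qed
      then have "measure M ?E \<le> measure M ({y\<in>K. \<delta> \<le> norm (F k y - s y)} \<union> {y\<in>K. \<delta> \<le> norm (F k y - h y)})"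
        using m by (intro measure_mono_fmeasurable) (auto dest: fmeasurableD)
      also have "\<dots> \<le> measure M {y\<in>K. \<delta> \<le> norm (F k y - s y)} + measure M {y\<in>K. \<delta> \<le> norm (F k y - h y)}"
        using m by (intro measure_Un_le) (auto dest: fmeasurableD)
      finally show ?thesis .
    qed
    moreover have "(\<lambda>k. measure M {y\<in>K. \<delta> \<le> norm (F k y - s y)} + measure M {y\<in>K. \<delta> \<le> norm (F k y - h y)}) \<longlonglongrightarrow> 0"
      using tendsto_add[OF B_convergence_in_measure[OF F s lim K \<delta>] loc[OF K \<delta>]] by simp
    ultimately have "measure M ?E \<le> 0"
      by (intro tendsto_lowerbound[of _ 0 sequentially]) auto
    then have "measure M ?E = 0" using measure_nonneg[of M ?E] by linarith
    then have "?E \<in> null_sets M"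
      using m(3) by (auto simp: null_sets_def emeasure_eq_measure2 fmeasurableD)
    then show ?thesis by (rule AE_I') (auto simp: not_less)
  qed
  obtain K :: "nat \<Rightarrow> 'g set" where K: "\<And>n. compact (K n)" "space M \<subseteq> (\<Union>n. K n)"
    using covered_by_compacts by blast
  have "AE y in M. \<forall>n i::nat. y \<in> K n \<longrightarrow> norm (s y - h y) < 2 * inverse (real (Suc i))"
    unfolding AE_all_countable by (intro allI null K) auto
  then show ?thesis
    using AE_space
  proof eventually_elim
    case (elim y)
    then obtain n where "y \<in> K n" using K(2) by blast
    with elim have *: "norm (s y - h y) < 2 * inverse (real (Suc i))" for i by blast
    have "norm (s y - h y) \<le> 0"
    proof (rule field_le_epsilon)
      fix e :: real assume "e > 0"
      then obtain i where "inverse (real (Suc i)) < e / 2" using reals_Archimedean[of "e/2"] by auto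
      with *[of i] show "norm (s y - h y) \<le> 0 + e" by simp
    qed
    then show "s y = h y" by simp
  qed
qed

text \<open>On a set of finite measure, a function with finite values is bounded off a set of small measure.\<close>

lemma measure_level_tendsto_0:
  fixes g :: "'g \<Rightarrow> complex"
  assumes g: "g \<in> borel_measurable M" and K: "compact K" and \<delta>: "\<delta> > 0" and e: "e \<longlonglongrightarrow> (0::real)"
  shows "(\<lambda>m. measure M {y\<in>K. \<delta> \<le> e m * norm (g y)}) \<longlonglongrightarrow> 0"
proof (rule LIMSEQ_I)
  fix r :: real assume r: "r > 0"
  let ?S = "\<lambda>n::nat. {y\<in>K. real n \<le> norm (g y)}"
  have S: "?S n \<in> fmeasurable M" for n by (rule level_set[OF g K])
  have "(\<lambda>n. measure M (?S n)) \<longlonglongrightarrow> measure M (\<Inter>n. ?S n)"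
    using S by (intro Lim_measure_decseq) (auto simp: decseq_def fmeasurable_def less_top[symmetric])
  moreover have "(\<Inter>n. ?S n) = {}"
  proof (intro equals0I)
    fix y assume "y \<in> (\<Inter>n. ?S n)"
    then have "real n \<le> norm (g y)" for n by blast
    then show False using reals_Archimedean2[of "norm (g y)"] not_le by blast
  qed
  ultimately have "(\<lambda>n. measure M (?S n)) \<longlonglongrightarrow> 0" by simp
  from order_tendstoD(2)[OF this r] obtain n where n: "measure M (?S n) < r"
    by (auto simp: eventually_sequentially)
  have "\<delta> / (real n + 1) > 0" using \<delta> by simp
  with e obtain m0 where m0: "\<And>m. m \<ge> m0 \<Longrightarrow> \<bar>e m\<bar> < \<delta> / (real n + 1)"
    using LIMSEQ_D[of e 0] by auto
  have "norm (measure M {y\<in>K. \<delta> \<le> e m * norm (g y)} - 0) < r" if "m \<ge> m0" for m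
  proof -
    have "{y\<in>K. \<delta> \<le> e m * norm (g y)} \<subseteq> ?S n"
    proof safe
      fix y assume "y \<in> K" and y: "\<delta> \<le> e m * norm (g y)"
      have "e m * norm (g y) \<le> \<delta> / (real n + 1) * norm (g y)"
        using m0[OF that] by (intro mult_right_mono) auto
      with y have "\<delta> \<le> \<delta> * norm (g y) / (real n + 1)" by simp
      then have "\<delta> * (real n + 1) \<le> \<delta> * norm (g y)" by (subst (asm) pos_le_divide_eq) auto
      then have "real n + 1 \<le> norm (g y)" using \<delta> by (simp only: mult_le_cancel_left_pos)
      then show "real n \<le> norm (g y)" by simp
    qed
    moreover have "{y\<in>K. \<delta> \<le> e m * norm (g y)} \<in> sets M"
    proof -
      have "{y\<in>K. \<delta> \<le> e m * norm (g y)} = K \<inter> {y\<in>space M. \<delta> \<le> e m * norm (g y)}"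
        using fmeasurableD[OF compact_fmeasurable[OF K]] sets.sets_into_space by blast
      moreover have "{y\<in>space M. \<delta> \<le> e m * norm (g y)} \<in> sets M"
        using g by measurable
      ultimately show ?thesis using compact_fmeasurable[OF K] by (auto dest: fmeasurableD)
    qed
    ultimately have "measure M {y\<in>K. \<delta> \<le> e m * norm (g y)} \<le> measure M (?S n)"
      by (intro measure_mono_fmeasurable S)
    with n show ?thesis by simp
  qed
  then show "\<exists>no. \<forall>m\<ge>no. norm (measure M {y\<in>K. \<delta> \<le> e m * norm (g y)} - 0) < r" by blast
qed

end

definition bounded_measurable :: "'a measure \<Rightarrow> ('a \<Rightarrow> complex) set" where
  "bounded_measurable M = {h \<in> borel_measurable M. bounded (range h)}"

definition sup_norm :: "('a \<Rightarrow> complex) \<Rightarrow> real" where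
  "sup_norm h = (SUP y. norm (h y))"

lemma norm_le_sup_norm: "h \<in> bounded_measurable M \<Longrightarrow> norm (h y) \<le> sup_norm h"
  unfolding bounded_measurable_def sup_norm_def bounded_iff
  by (auto intro!: cSUP_upper bdd_aboveI)

lemma sup_norm_le: "(\<And>y. norm (h y) \<le> c) \<Longrightarrow> sup_norm h \<le> c"
  unfolding sup_norm_def by (rule cSUP_least) auto

lemma bounded_measurableI: "h \<in> borel_measurable M \<Longrightarrow> (\<And>y. norm (h y) \<le> c) \<Longrightarrow> h \<in> bounded_measurable M"
  unfolding bounded_measurable_def bounded_iff by blast

lemma bounded_measurable_borel: "h \<in> bounded_measurable M \<Longrightarrow> h \<in> borel_measurable M"
  by (simp add: bounded_measurable_def)

lemma complete_seminorm_bounded_measurable: "complete_seminorm (bounded_measurable M) sup_norm"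
proof
  show "(\<lambda>_. 0) \<in> bounded_measurable M" by (rule bounded_measurableI[of _ _ 0]) auto
next
  fix f g :: "'a \<Rightarrow> complex" assume f: "f \<in> bounded_measurable M" and g: "g \<in> bounded_measurable M"
  have le: "norm (f y + g y) \<le> sup_norm f + sup_norm g" for y
    using norm_triangle_ineq[of "f y" "g y"] norm_le_sup_norm[OF f, of y] norm_le_sup_norm[OF g, of y]
    by linarith
  show "(\<lambda>y. f y + g y) \<in> bounded_measurable M"
    using bounded_measurable_borel[OF f] bounded_measurable_borel[OF g]
    by (intro bounded_measurableI[OF _ le]) auto
  show "sup_norm (\<lambda>y. f y + g y) \<le> sup_norm f + sup_norm g"
    by (rule sup_norm_le[OF le])
next
  fix f :: "'a \<Rightarrow> complex" and c assume f: "f \<in> bounded_measurable M"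
  have le: "norm (c * h y) \<le> norm c * sup_norm h" if "h \<in> bounded_measurable M" for c h and y :: 'a
    using norm_le_sup_norm[OF that, of y] by (simp add: norm_mult mult_left_mono)
  have cf: "(\<lambda>y. c * f y) \<in> bounded_measurable M" for c
    using bounded_measurable_borel[OF f] by (intro bounded_measurableI[OF _ le[OF f]]) auto
  then show "(\<lambda>y. c * f y) \<in> bounded_measurable M" .
  show "sup_norm (\<lambda>y. c * f y) = norm c * sup_norm f"
  proof (cases "c = 0")
    case True then show ?thesis by (simp add: sup_norm_def)
  next
    case False
    have "sup_norm f \<le> norm (1/c) * sup_norm (\<lambda>y. c * f y)"
      using le[OF cf[of c], of "1/c"] False by (intro sup_norm_le) simp
    then have "norm c * sup_norm f \<le> sup_norm (\<lambda>y. c * f y)"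
      using False by (simp add: norm_divide field_simps)
    then show ?thesis using sup_norm_le[OF le[OF f, of c]] by (intro antisym)
  qed
next
  fix f :: "'a \<Rightarrow> complex" assume f: "f \<in> bounded_measurable M"
  show "0 \<le> sup_norm f"
    by (rule order_trans[OF norm_ge_zero norm_le_sup_norm[OF f]])
next
  fix F :: "nat \<Rightarrow> 'a \<Rightarrow> complex"
  assume F: "\<And>k. F k \<in> bounded_measurable M"
    and cauchy: "\<And>e. e > 0 \<Longrightarrow> \<exists>m. \<forall>j\<ge>m. \<forall>k\<ge>m. sup_norm (\<lambda>y. F j y - F k y) < e"
  have diff: "(\<lambda>y. F j y - F k y) \<in> bounded_measurable M" for j k
  proof (rule bounded_measurableI)
    show "(\<lambda>y. F j y - F k y) \<in> borel_measurable M"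
      using bounded_measurable_borel[OF F] by auto
    show "norm (F j y - F k y) \<le> sup_norm (F j) + sup_norm (F k)" for y
      using norm_triangle_ineq4[of "F j y" "F k y"] norm_le_sup_norm[OF F, of j y]
        norm_le_sup_norm[OF F, of k y] by linarith
  qed
  have "\<exists>l. (\<lambda>k. F k y) \<longlonglongrightarrow> l" for y
  proof -
    have "Cauchy (\<lambda>k. F k y)"
    proof (rule CauchyI)
      fix e :: real assume "e > 0"
      then obtain m where "\<forall>j\<ge>m. \<forall>k\<ge>m. sup_norm (\<lambda>y. F j y - F k y) < e" using cauchy by blast
      then show "\<exists>m. \<forall>j\<ge>m. \<forall>k\<ge>m. norm (F j y - F k y) < e"
        using norm_le_sup_norm[OF diff] order_le_less_trans by blast
    qed
    then show ?thesis using Cauchy_convergent convergent_def by blast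
  qed
  then obtain f where f: "\<And>y. (\<lambda>k. F k y) \<longlonglongrightarrow> f y" by metis
  have near: "\<exists>m. \<forall>j\<ge>m. \<forall>y. norm (F j y - f y) \<le> e" if e: "e > 0" for e
  proof -
    obtain m where m: "\<forall>j\<ge>m. \<forall>k\<ge>m. sup_norm (\<lambda>y. F j y - F k y) < e" using cauchy[OF e] by blast
    have "norm (F j y - f y) \<le> e" if "j \<ge> m" for j y
    proof (rule tendsto_upperbound)
      show "(\<lambda>k. norm (F j y - F k y)) \<longlonglongrightarrow> norm (F j y - f y)" by (intro tendsto_intros f)
      show "eventually (\<lambda>k. norm (F j y - F k y) \<le> e) sequentially"
        unfolding eventually_sequentially
      proof (intro exI allI impI)
        fix k assume "m \<le> k"
        then show "norm (F j y - F k y) \<le> e"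
          using m that norm_le_sup_norm[OF diff[of j k], of y] by (meson less_imp_le order_trans)
      qed
    qed simp
    then show ?thesis by blast
  qed
  show "\<exists>f\<in>bounded_measurable M. (\<lambda>k. sup_norm (\<lambda>y. F k y - f y)) \<longlonglongrightarrow> 0"
  proof (intro bexI)
    obtain m where m: "\<And>y. norm (F m y - f y) \<le> 1" using near[of 1] by auto
    show fb: "f \<in> bounded_measurable M"
    proof (rule bounded_measurableI)
      show "f \<in> borel_measurable M"
        using bounded_measurable_borel[OF F] f by (rule borel_measurable_LIMSEQ_metric)
      show "norm (f y) \<le> sup_norm (F m) + 1" for y
        using m[of y] norm_le_sup_norm[OF F[of m], of y] norm_triangle_ineq4[of "F m y" "F m y - f y"] by simp
    qed
    show "(\<lambda>k. sup_norm (\<lambda>y. F k y - f y)) \<longlonglongrightarrow> 0"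
    proof (rule LIMSEQ_I)
      fix e :: real assume e: "e > 0"
      obtain m where m: "\<And>j y. j \<ge> m \<Longrightarrow> norm (F j y - f y) \<le> e / 2" using near[of "e/2"] e by auto
      have "norm (sup_norm (\<lambda>y. F j y - f y) - 0) < e" if "j \<ge> m" for j
      proof -
        have "sup_norm (\<lambda>y. F j y - f y) \<le> e / 2" by (intro sup_norm_le m that)
        moreover have "(\<lambda>y. F j y - f y) \<in> bounded_measurable M"
          using bounded_measurable_borel[OF F] bounded_measurable_borel[OF fb]
          by (intro bounded_measurableI[OF _ m[OF that]]) auto
        then have "0 \<le> sup_norm (\<lambda>y. F j y - f y)"
          by (rule order_trans[OF norm_ge_zero norm_le_sup_norm])
        ultimately show ?thesis using e by simp
      qed
      then show "\<exists>no. \<forall>j\<ge>no. norm (sup_norm (\<lambda>y. F j y - f y) - 0) < e" by blast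
    qed
  qed
qed

context solid_function_space
begin

text \<open>For fixed \<open>g\<close>, the map \<open>h \<mapsto> h g\<close> from bounded functions to \<open>B\<close> has a closed graph, and is hence
  bounded: this is Zabreiko's lemma for the seminorm \<open>h \<mapsto> \<parallel>h g\<parallel>\<close> on the space of bounded functions.\<close>

lemma multiplier_bound_fixed:
  assumes g: "g \<in> B"
  obtains D where "\<And>h. h \<in> borel_measurable M \<Longrightarrow> (\<And>y. norm (h y) \<le> 1) \<Longrightarrow> nrm (\<lambda>y. h y * g y) \<le> D"
proof -
  interpret Linf: complete_seminorm "bounded_measurable M" sup_norm
    by (rule complete_seminorm_bounded_measurable)
  have hg: "(\<lambda>y. h y * g y) \<in> B" if "h \<in> bounded_measurable M" for h
    by (rule bounded_mult_in[OF bounded_measurable_borel[OF that] norm_le_sup_norm[OF that] g])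
  obtain D where D: "D \<ge> 0" "\<And>h. h \<in> bounded_measurable M \<Longrightarrow> nrm (\<lambda>y. h y * g y) \<le> D * sup_norm h"
  proof (rule Linf.countably_subadditive_bounded)
    show "0 \<le> nrm (\<lambda>y. h y * g y)" if "h \<in> bounded_measurable M" for h
      by (rule nonneg[OF hg[OF that]])
    show "nrm (\<lambda>y. (h y + k y) * g y) \<le> nrm (\<lambda>y. h y * g y) + nrm (\<lambda>y. k y * g y)"
      if "h \<in> bounded_measurable M" "k \<in> bounded_measurable M" for h k
      using triangle[OF hg[OF that(1)] hg[OF that(2)]] by (simp add: distrib_right)
    show "nrm (\<lambda>y. c * h y * g y) = norm c * nrm (\<lambda>y. h y * g y)" if "h \<in> bounded_measurable M" for h c
      using scale[OF hg[OF that], of c] by (simp add: mult.assoc)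
    fix F :: "nat \<Rightarrow> 'g \<Rightarrow> complex" and f
    assume F: "\<And>k. F k \<in> bounded_measurable M" and f: "f \<in> bounded_measurable M"
      and summ: "summable (\<lambda>k. nrm (\<lambda>y. F k y * g y))"
      and lim: "(\<lambda>m. sup_norm (\<lambda>y. (\<Sum>k<m. F k y) - f y)) \<longlonglongrightarrow> 0"
    obtain s where s: "s \<in> B" "(\<lambda>m. nrm (\<lambda>y. (\<Sum>k<m. F k y * g y) - s y)) \<longlonglongrightarrow> 0"
        "nrm s \<le> (\<Sum>k. nrm (\<lambda>y. F k y * g y))"
      by (rule summable_sum_exists[OF hg[OF F] summ]) blast
    have "AE y in M. s y = f y * g y"
    proof (rule local_limit_unique[OF _ s(1,2)])
      show "(\<lambda>y. \<Sum>k<m. F k y * g y) \<in> B" for m by (intro sum_in hg F) auto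
      show "(\<lambda>y. f y * g y) \<in> borel_measurable M" by (intro measurable_B hg f)
      fix K :: "'g set" and \<delta> :: real assume K: "compact K" and \<delta>: "\<delta> > 0"
      let ?e = "\<lambda>m. sup_norm (\<lambda>y. (\<Sum>k<m. F k y) - f y)"
      show "(\<lambda>m. measure M {y\<in>K. \<delta> \<le> norm ((\<Sum>k<m. F k y * g y) - f y * g y)}) \<longlonglongrightarrow> 0"
      proof (rule tendsto_sandwich[OF _ _ tendsto_const measure_level_tendsto_0[OF measurable_B[OF g] K \<delta> lim]])
        have "measure M {y\<in>K. \<delta> \<le> norm ((\<Sum>k<m. F k y * g y) - f y * g y)}
            \<le> measure M {y\<in>K. \<delta> \<le> ?e m * norm (g y)}" for m
        proof (rule measure_mono_fmeasurable)
          have d: "(\<lambda>y. (\<Sum>k<m. F k y) - f y) \<in> bounded_measurable M"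
            by (intro Linf.diff_in Linf.sum_in F f) auto
          have "norm ((\<Sum>k<m. F k y * g y) - f y * g y) \<le> ?e m * norm (g y)" for y
          proof -
            have "(\<Sum>k<m. F k y * g y) - f y * g y = ((\<Sum>k<m. F k y) - f y) * g y"
              by (simp add: sum_distrib_right left_diff_distrib)
            then show ?thesis
              using norm_le_sup_norm[OF d, of y] by (simp add: norm_mult mult_right_mono)
          qed
          then show "{y\<in>K. \<delta> \<le> norm ((\<Sum>k<m. F k y * g y) - f y * g y)} \<subseteq> {y\<in>K. \<delta> \<le> ?e m * norm (g y)}"
            by (auto intro: order_trans)
          show "{y\<in>K. \<delta> \<le> norm ((\<Sum>k<m. F k y * g y) - f y * g y)} \<in> sets M"
            by (intro fmeasurableD level_set K measurable_B diff_in sum_in hg F f) auto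
          have "norm (complex_of_real (?e m) * g y) = ?e m * norm (g y)" for y
            using Linf.nonneg[OF d] by (simp add: norm_mult)
          then show "{y\<in>K. \<delta> \<le> ?e m * norm (g y)} \<in> fmeasurable M"
            using level_set[OF measurable_B[OF scale_in[OF g, of "complex_of_real (?e m)"]] K, of \<delta>] by simp
        qed
        then show "\<forall>\<^sub>F m in sequentially. measure M {y\<in>K. \<delta> \<le> norm ((\<Sum>k<m. F k y * g y) - f y * g y)}
            \<le> measure M {y\<in>K. \<delta> \<le> ?e m * norm (g y)}" by simp
      qed simp
    qed
    then have "nrm (\<lambda>y. f y * g y) = nrm s"
      by (intro AE_cong_B(2) s measurable_B hg f)
    with s(3) show "nrm (\<lambda>y. f y * g y) \<le> (\<Sum>k. nrm (\<lambda>y. F k y * g y))" by simp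
  qed blast
  show ?thesis
  proof (rule that)
    fix h :: "'g \<Rightarrow> complex" assume h: "h \<in> borel_measurable M" "\<And>y. norm (h y) \<le> 1"
    have "nrm (\<lambda>y. h y * g y) \<le> D * sup_norm h"
      by (intro D bounded_measurableI[OF h])
    also have "\<dots> \<le> D" using D(1) sup_norm_le[of h 1] h(2) by (intro mult_left_le) auto
    finally show "nrm (\<lambda>y. h y * g y) \<le> D" .
  qed
qed

text \<open>By \<open>multiplier_bound_fixed\<close>, \<open>p g = sup {\<parallel>h g\<parallel> | |h| \<le> 1}\<close> is finite for every \<open>g\<close>. A second use of
  Zabreiko's lemma, now for \<open>p\<close> on \<open>B\<close>, makes it a bounded seminorm.\<close>

lemma multiplier_bound:
  obtains D where "D \<ge> 0" "\<And>h g. h \<in> borel_measurable M \<Longrightarrow> (\<And>y. norm (h y) \<le> 1) \<Longrightarrow> g \<in> B \<Longrightarrow>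
      nrm (\<lambda>y. h y * g y) \<le> D * nrm g"
proof -
  define H where "H = {h :: 'g \<Rightarrow> complex. h \<in> borel_measurable M \<and> (\<forall>y. norm (h y) \<le> 1)}"
  define p where "p = (\<lambda>g. SUP h\<in>H. nrm (\<lambda>y. h y * g y))"
  have hg: "(\<lambda>y. h y * g y) \<in> B" if "h \<in> H" "g \<in> B" for h g
    using that by (intro bounded_mult_in[of h 1]) (auto simp: H_def)
  have one: "(\<lambda>_. 1) \<in> H" by (simp add: H_def)
  have bdd: "bdd_above ((\<lambda>h. nrm (\<lambda>y. h y * g y)) ` H)" if g: "g \<in> B" for g
  proof -
    obtain D where D: "\<And>h. h \<in> borel_measurable M \<Longrightarrow> (\<And>y. norm (h y) \<le> 1) \<Longrightarrow> nrm (\<lambda>y. h y * g y) \<le> D"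
      by (rule multiplier_bound_fixed[OF g]) blast
    then show ?thesis by (intro bdd_aboveI2[where M=D]) (auto simp: H_def)
  qed
  have le_p: "nrm (\<lambda>y. h y * g y) \<le> p g" if "h \<in> H" "g \<in> B" for h g
    unfolding p_def by (rule cSUP_upper[OF that(1) bdd[OF that(2)]])
  have p_le: "p g \<le> c" if "\<And>h. h \<in> H \<Longrightarrow> nrm (\<lambda>y. h y * g y) \<le> c" for g c
    unfolding p_def using that one by (intro cSUP_least) auto
  have p_scale_le: "p (\<lambda>y. c * g y) \<le> norm c * p g" if "g \<in> B" for c g
  proof (rule p_le)
    fix h assume h: "h \<in> H"
    have "nrm (\<lambda>y. c * (h y * g y)) \<le> norm c * p g"
      unfolding scale[OF hg[OF h that]] by (intro mult_left_mono le_p h that) auto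
    then show "nrm (\<lambda>y. h y * (c * g y)) \<le> norm c * p g" by (simp add: mult.left_commute)
  qed
  have p_nonneg: "0 \<le> p g" if "g \<in> B" for g
    using le_p[OF one that] nonneg[OF that] by simp
  obtain D where D: "D \<ge> 0" "\<And>g. g \<in> B \<Longrightarrow> p g \<le> D * nrm g"
  proof (rule countably_subadditive_bounded)
    show "0 \<le> p g" if "g \<in> B" for g by (rule p_nonneg[OF that])
    show "p (\<lambda>y. f y + g y) \<le> p f + p g" if f: "f \<in> B" and g: "g \<in> B" for f g
    proof (rule p_le)
      fix h assume h: "h \<in> H"
      have "nrm (\<lambda>y. h y * f y + h y * g y) \<le> p f + p g"
        using triangle[OF hg[OF h f] hg[OF h g]] le_p[OF h f] le_p[OF h g] by linarith
      then show "nrm (\<lambda>y. h y * (f y + g y)) \<le> p f + p g" by (simp add: distrib_left)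
    qed
    show "p (\<lambda>y. c * g y) = norm c * p g" if g: "g \<in> B" for c g
    proof (cases "c = 0")
      case True then show ?thesis
        using p_scale_le[OF g, of 0] p_nonneg[OF zero_in] by simp
    next
      case False
      have "p g \<le> norm (1/c) * p (\<lambda>y. c * g y)"
        using p_scale_le[OF scale_in[OF g, of c], of "1/c"] False by simp
      then have "norm c * p g \<le> p (\<lambda>y. c * g y)" using False by (simp add: norm_divide field_simps)
      then show ?thesis using p_scale_le[OF g, of c] by linarith
    qed
    fix F :: "nat \<Rightarrow> 'g \<Rightarrow> complex" and f
    assume F: "\<And>k. F k \<in> B" and f: "f \<in> B" and summ: "summable (\<lambda>k. p (F k))"
      and lim: "(\<lambda>m. nrm (\<lambda>y. (\<Sum>k<m. F k y) - f y)) \<longlonglongrightarrow> 0"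
    show "p f \<le> (\<Sum>k. p (F k))"
    proof (rule p_le)
      fix h assume h: "h \<in> H"
      have sn: "summable (\<lambda>k. nrm (\<lambda>y. h y * F k y))"
        by (rule summable_comparison_test'[OF summ, of 0])
          (use nonneg[OF hg[OF h F]] le_p[OF h F] in auto)
      obtain s where s: "s \<in> B" "(\<lambda>m. nrm (\<lambda>y. (\<Sum>k<m. h y * F k y) - s y)) \<longlonglongrightarrow> 0"
          "nrm s \<le> (\<Sum>k. nrm (\<lambda>y. h y * F k y))"
        by (rule summable_sum_exists[OF hg[OF h F] sn]) blast
      have "AE y in M. s y = h y * f y"
      proof (rule local_limit_unique[OF _ s(1,2)])
        show "(\<lambda>y. \<Sum>k<m. h y * F k y) \<in> B" for m by (intro sum_in hg F h) auto
        show "(\<lambda>y. h y * f y) \<in> borel_measurable M" by (intro measurable_B hg f h)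
        fix K :: "'g set" and \<delta> :: real assume K: "compact K" and \<delta>: "\<delta> > 0"
        have SF: "(\<lambda>y. \<Sum>k<m. F k y) \<in> B" for m by (intro sum_in F) auto
        show "(\<lambda>m. measure M {y\<in>K. \<delta> \<le> norm ((\<Sum>k<m. h y * F k y) - h y * f y)}) \<longlonglongrightarrow> 0"
        proof (rule tendsto_sandwich[OF _ _ tendsto_const B_convergence_in_measure[OF SF f lim K \<delta>]])
          have "measure M {y\<in>K. \<delta> \<le> norm ((\<Sum>k<m. h y * F k y) - h y * f y)}
              \<le> measure M {y\<in>K. \<delta> \<le> norm ((\<Sum>k<m. F k y) - f y)}" for m
          proof (rule measure_mono_fmeasurable)
            have "norm ((\<Sum>k<m. h y * F k y) - h y * f y) \<le> norm ((\<Sum>k<m. F k y) - f y)" for y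
            proof -
              have "(\<Sum>k<m. h y * F k y) - h y * f y = h y * ((\<Sum>k<m. F k y) - f y)"
                by (simp add: sum_distrib_left right_diff_distrib)
              then show ?thesis
                using h by (simp add: norm_mult H_def mult_left_le_one_le)
            qed
            then show "{y\<in>K. \<delta> \<le> norm ((\<Sum>k<m. h y * F k y) - h y * f y)}
                \<subseteq> {y\<in>K. \<delta> \<le> norm ((\<Sum>k<m. F k y) - f y)}"
              by (auto intro: order_trans)
            show "{y\<in>K. \<delta> \<le> norm ((\<Sum>k<m. h y * F k y) - h y * f y)} \<in> sets M"
              by (intro fmeasurableD level_set K measurable_B diff_in sum_in hg F f h) auto
            show "{y\<in>K. \<delta> \<le> norm ((\<Sum>k<m. F k y) - f y)} \<in> fmeasurable M"
              by (intro level_set K measurable_B diff_in SF f)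
          qed
          then show "\<forall>\<^sub>F m in sequentially. measure M {y\<in>K. \<delta> \<le> norm ((\<Sum>k<m. h y * F k y) - h y * f y)}
              \<le> measure M {y\<in>K. \<delta> \<le> norm ((\<Sum>k<m. F k y) - f y)}" by simp
        qed simp
      qed
      then have "nrm (\<lambda>y. h y * f y) = nrm s"
        by (intro AE_cong_B(2) s measurable_B hg f h)
      also have "\<dots> \<le> (\<Sum>k. nrm (\<lambda>y. h y * F k y))" by (rule s(3))
      also have "\<dots> \<le> (\<Sum>k. p (F k))"
        by (rule suminf_le[OF le_p[OF h F] sn summ])
      finally show "nrm (\<lambda>y. h y * f y) \<le> (\<Sum>k. p (F k))" .
    qed
  qed blast
  show ?thesis
  proof (rule that[OF D(1)])
    fix h g :: "'g \<Rightarrow> complex" assume "h \<in> borel_measurable M" "\<And>y. norm (h y) \<le> 1" "g \<in> B"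
    then show "nrm (\<lambda>y. h y * g y) \<le> D * nrm g"
      using le_p[of h g] D(2)[of g] by (auto simp: H_def intro: order_trans)
  qed
qed

text \<open>The quantitative form of solidity: if \<open>|f| \<le> |g|\<close> then \<open>f = h g\<close> with \<open>|h| \<le> 1\<close>.\<close>

lemma ideal_bound:
  obtains D where "D \<ge> 0" "\<And>f g. f \<in> borel_measurable M \<Longrightarrow> g \<in> B \<Longrightarrow>
      (AE y in M. norm (f y) \<le> norm (g y)) \<Longrightarrow> nrm f \<le> D * nrm g"
proof -
  obtain D where D: "D \<ge> 0" "\<And>h g. h \<in> borel_measurable M \<Longrightarrow> (\<And>y. norm (h y) \<le> 1) \<Longrightarrow> g \<in> B \<Longrightarrow>
      nrm (\<lambda>y. h y * g y) \<le> D * nrm g"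
    by (rule multiplier_bound) blast
  show ?thesis
  proof (rule that[OF D(1)])
    fix f g :: "'g \<Rightarrow> complex"
    assume f: "f \<in> borel_measurable M" and g: "g \<in> B" and le: "AE y in M. norm (f y) \<le> norm (g y)"
    define h where "h = (\<lambda>y. if norm (f y) \<le> norm (g y) then f y / g y else 0)"
    have h: "h \<in> borel_measurable M" unfolding h_def using f measurable_B[OF g] by measurable
    have h1: "norm (h y) \<le> 1" for y
      by (auto simp: h_def norm_divide divide_le_eq_1)
    have "AE y in M. h y * g y = f y" using le by eventually_elim (auto simp: h_def)
    then have "nrm f = nrm (\<lambda>y. h y * g y)"
      by (intro AE_cong_B(2) bounded_mult_in[OF h h1 g] f)
    also have "\<dots> \<le> D * nrm g" by (rule D(2)[OF h h1 g])
    finally show "nrm f \<le> D * nrm g" .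
  qed
qed

end

section \<open>Haar measure on a sigma-compact group\<close>

locale haar_group = group G
  for G :: "'g::{t2_space, second_countable_topology} monoid" (structure) +
  fixes \<mu> :: "'g measure"
  assumes carrier_UNIV [simp]: "carrier G = UNIV"
    and continuous_mult: "continuous_on UNIV (\<lambda>(x, y). x \<otimes> y)"
    and continuous_inv: "continuous_on UNIV (\<lambda>x. inv x)"
    and haar: "left_haar_measure G \<mu>"
    and sigma_compact: "\<exists>K::nat \<Rightarrow> 'g set. (\<forall>n. compact (K n)) \<and> (\<Union>n. K n) = UNIV"
begin

lemma sets_mu [simp, measurable_cong]: "sets \<mu> = sets borel"
  using haar by (simp add: left_haar_measure_def)

lemma space_mu [simp]: "space \<mu> = UNIV"
  using sets_eq_imp_space_eq[OF sets_mu] by simp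

lemma emeasure_UNIV_neq_0: "emeasure \<mu> UNIV \<noteq> 0"
  using haar by (simp add: left_haar_measure_def)

lemma compact_sets [intro]: "compact (K :: 'g set) \<Longrightarrow> K \<in> sets borel"
  by (intro borel_closed compact_imp_closed)

lemma emeasure_compact_finite: "compact K \<Longrightarrow> emeasure \<mu> K < \<infinity>"
  using haar by (simp add: left_haar_measure_def)

lemma distr_mult: "distr \<mu> \<mu> (\<lambda>y. x \<otimes> y) = \<mu>"
  using haar by (simp add: left_haar_measure_def)

lemma mult_measurable [measurable (raw)]:
  assumes "f \<in> N \<rightarrow>\<^sub>M borel" "g \<in> N \<rightarrow>\<^sub>M borel"
  shows "(\<lambda>x. f x \<otimes> g x) \<in> N \<rightarrow>\<^sub>M borel"
proof -
  have "(\<lambda>(x, y). x \<otimes> y) \<in> borel_measurable (borel \<Otimes>\<^sub>M borel)"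
    unfolding borel_prod by (rule borel_measurable_continuous_onI[OF continuous_mult])
  from measurable_compose[OF measurable_Pair[OF assms] this] show ?thesis by simp
qed

lemma left_mult_borel [measurable]: "(\<otimes>) x \<in> borel \<rightarrow>\<^sub>M borel"
  by (rule mult_measurable[of "\<lambda>_. x" borel "\<lambda>y. y"]) simp_all

lemma inv_measurable [measurable (raw)]:
  assumes "f \<in> N \<rightarrow>\<^sub>M borel"
  shows "(\<lambda>x. inv (f x)) \<in> N \<rightarrow>\<^sub>M borel"
  by (rule measurable_compose[OF assms borel_measurable_continuous_onI[OF continuous_inv]])

lemma exhaustion:
  obtains K :: "nat \<Rightarrow> 'g set" where "\<And>n. compact (K n)" "incseq K" "(\<Union>n. K n) = UNIV"
proof -
  obtain L :: "nat \<Rightarrow> 'g set" where L: "\<And>n. compact (L n)" "(\<Union>n. L n) = UNIV"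
    using sigma_compact by blast
  show ?thesis
  proof (rule that[of "\<lambda>n. \<Union>i\<le>n. L i"])
    show "compact (\<Union>i\<le>n. L i)" for n using L by (intro compact_UN) auto
    show "incseq (\<lambda>n. \<Union>i\<le>n. L i)" by (fastforce simp: incseq_def)
    show "(\<Union>n. \<Union>i\<le>n. L i) = UNIV" using L(2) by blast
  qed
qed

lemma sigma_finite: "sigma_finite_measure \<mu>"
proof
  obtain K :: "nat \<Rightarrow> 'g set" where K: "\<And>n. compact (K n)" "incseq K" "(\<Union>n. K n) = UNIV"
    by (rule exhaustion) blast
  then show "\<exists>A. countable A \<and> A \<subseteq> sets \<mu> \<and> \<Union> A = space \<mu> \<and> (\<forall>a\<in>A. emeasure \<mu> a \<noteq> \<infinity>)"
    using emeasure_compact_finite by (intro exI[of _ "range K"]) (auto simp: less_top)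
qed

sublocale sigma_finite_measure \<mu> by (rule sigma_finite)

sublocale pair_sigma_finite \<mu> \<mu> ..

lemma emeasure_left_translate:
  assumes "A \<in> sets borel" shows "emeasure \<mu> {y. x \<otimes> y \<in> A} = emeasure \<mu> A"
proof -
  have "emeasure \<mu> A = emeasure (distr \<mu> \<mu> (\<lambda>y. x \<otimes> y)) A" by (simp add: distr_mult)
  also have "\<dots> = emeasure \<mu> ((\<lambda>y. x \<otimes> y) -` A \<inter> space \<mu>)"
    using assms by (intro emeasure_distr) (simp_all cong: measurable_cong_sets)
  finally show ?thesis by (simp add: vimage_def)
qed

lemma nn_integral_left_translate:
  assumes "f \<in> borel_measurable borel"
  shows "(\<integral>\<^sup>+y. f (x \<otimes> y) \<partial>\<mu>) = (\<integral>\<^sup>+y. f y \<partial>\<mu>)"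
proof -
  have "(\<integral>\<^sup>+y. f y \<partial>\<mu>) = (\<integral>\<^sup>+y. f y \<partial>(distr \<mu> \<mu> (\<lambda>y. x \<otimes> y)))" by (simp add: distr_mult)
  also have "\<dots> = (\<integral>\<^sup>+y. f (x \<otimes> y) \<partial>\<mu>)"
    using assms by (intro nn_integral_distr) (simp_all cong: measurable_cong_sets)
  finally show ?thesis by simp
qed

lemma AE_exists: "AE y in \<mu>. P y \<Longrightarrow> \<exists>y. P y"
proof (rule ccontr)
  assume "AE y in \<mu>. P y" "\<nexists>y. P y"
  then have "AE y in \<mu>. y \<notin> space \<mu>" by simp
  then have "space \<mu> \<in> null_sets \<mu>" by (subst AE_iff_null_sets) auto
  then show False using emeasure_UNIV_neq_0 by (auto simp: null_sets_def)
qed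

text \<open>A left Haar measure is in general not invariant under inversion, but its null sets are. The double
  integral of \<open>(w, x) \<mapsto> indicator N (w\<^sup>-\<^sup>1 x)\<close> vanishes by left invariance in \<open>x\<close>; hence
  \<open>{w. w\<^sup>-\<^sup>1 x0 \<in> N}\<close> is null for some \<open>x0\<close>, and the set for any \<open>y\<close> in place of \<open>x0\<close> is a left
  translate of it.\<close>

lemma null_inv_mult:
  assumes N: "N \<in> null_sets \<mu>"
  shows "{x. inv x \<otimes> y \<in> N} \<in> null_sets \<mu>"
proof -
  have Nb [measurable]: "N \<in> sets borel" using N by (auto simp: null_sets_def)
  have N0: "emeasure \<mu> N = 0" using N by auto
  have "(\<integral>\<^sup>+x. (\<integral>\<^sup>+w. indicator N (inv w \<otimes> x) \<partial>\<mu>) \<partial>\<mu>) = (\<integral>\<^sup>+w. (\<integral>\<^sup>+x. indicator N (inv w \<otimes> x) \<partial>\<mu>) \<partial>\<mu>)"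
    by (rule Fubini') measurable
  also have "\<dots> = (\<integral>\<^sup>+w. (\<integral>\<^sup>+x. indicator N x \<partial>\<mu>) \<partial>\<mu>)"
    by (intro nn_integral_cong nn_integral_left_translate) measurable
  also have "\<dots> = 0" using N0 by simp
  finally have "AE x in \<mu>. (\<integral>\<^sup>+w. indicator N (inv w \<otimes> x) \<partial>\<mu>) = 0"
    by (subst (asm) nn_integral_0_iff_AE) auto
  then obtain x0 where x0: "(\<integral>\<^sup>+w. indicator N (inv w \<otimes> x0) \<partial>\<mu>) = 0"
    using AE_exists by blast
  have "(\<integral>\<^sup>+w. indicator N (inv w \<otimes> y) \<partial>\<mu>) =
      (\<integral>\<^sup>+w. indicator N (inv (y \<otimes> inv x0 \<otimes> w) \<otimes> y) \<partial>\<mu>)"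
    by (rule nn_integral_left_translate[symmetric]) measurable
  also have "(\<lambda>w. inv (y \<otimes> inv x0 \<otimes> w) \<otimes> y) = (\<lambda>w. inv w \<otimes> x0)"
    by (simp add: inv_mult_group m_assoc)
  finally have "(\<integral>\<^sup>+w. indicator N (inv w \<otimes> y) \<partial>\<mu>) = 0" using x0 by simp
  moreover have "(\<integral>\<^sup>+w. indicator N (inv w \<otimes> y) \<partial>\<mu>) = (\<integral>\<^sup>+w. indicator {x. inv x \<otimes> y \<in> N} w \<partial>\<mu>)"
    by (intro nn_integral_cong) (simp add: indicator_def)
  moreover have m: "{x. inv x \<otimes> y \<in> N} \<in> sets \<mu>"
  proof -
    have "{x\<in>space borel. inv x \<otimes> y \<in> N} \<in> sets borel" by measurable
    then show ?thesis by simp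
  qed
  ultimately show ?thesis by (simp add: null_sets_def)
qed

abbreviation M :: "'g measure" where "M \<equiv> completion \<mu>"

lemma AE_inv_mult:
  assumes "AE x in M. P x" shows "AE x in M. P (inv x \<otimes> y)"
proof -
  from assms have "AE x in \<mu>. P x" by (simp add: AE_completion_iff)
  then obtain N where N: "{x \<in> space \<mu>. \<not> P x} \<subseteq> N" "N \<in> null_sets \<mu>"
    by (elim AE_E) (auto simp: null_sets_def)
  have "AE x in \<mu>. P (inv x \<otimes> y)"
    by (rule AE_I'[OF null_inv_mult[OF N(2)]]) (use N(1) in auto)
  then show ?thesis by (simp add: AE_completion_iff)
qed

lemma left_translate_measure_preserving:
  shows left_mult_measurable: "(\<lambda>y. x \<otimes> y) \<in> M \<rightarrow>\<^sub>M M"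
    and distr_left_mult: "distr M M (\<lambda>y. x \<otimes> y) = M"
proof -
  have m: "(\<lambda>y. x \<otimes> y) \<in> \<mu> \<rightarrow>\<^sub>M \<mu>" by measurable
  have d: "distr M \<mu> (\<lambda>y. x \<otimes> y) = \<mu>" using distr_completion[OF m] by (simp add: distr_mult)
  show "(\<lambda>y. x \<otimes> y) \<in> M \<rightarrow>\<^sub>M M"
    by (rule completion.measurable_completion2[OF measurable_completion[OF m]]) (simp add: d)
  show "distr M M (\<lambda>y. x \<otimes> y) = M"
    using completion.completion_distr_eq[OF measurable_completion[OF m]] by (simp add: d)
qed

lemma integrable_left_translate:
  fixes q :: "'g \<Rightarrow> complex"
  assumes "integrable M q"
  shows "integrable M (\<lambda>y. q (x \<otimes> y))" and "(\<integral>y. q (x \<otimes> y) \<partial>M) = (\<integral>y. q y \<partial>M)"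
proof -
  show "integrable M (\<lambda>y. q (x \<otimes> y))"
    using integrable_distr[OF left_mult_measurable, of x q] assms by (simp add: distr_left_mult)
  show "(\<integral>y. q (x \<otimes> y) \<partial>M) = (\<integral>y. q y \<partial>M)"
    using integral_distr[OF left_mult_measurable borel_measurable_integrable[OF assms], of x]
    by (simp add: distr_left_mult)
qed

lemma borel_representative:
  fixes f :: "'g \<Rightarrow> complex"
  assumes "f \<in> borel_measurable M"
  obtains g where "g \<in> borel_measurable borel" "AE x in M. f x = g x"
proof -
  have "(\<lambda>x. Re (f x)) \<in> borel_measurable M" "(\<lambda>x. Im (f x)) \<in> borel_measurable M"
    using assms by measurable
  from this[THEN completion_ex_borel_measurable_real]
  obtain a b where ab: "a \<in> borel_measurable \<mu>" "AE x in \<mu>. Re (f x) = a x"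
    "b \<in> borel_measurable \<mu>" "AE x in \<mu>. Im (f x) = b x" by blast
  show ?thesis
  proof (rule that[of "\<lambda>x. Complex (a x) (b x)"])
    have "(\<lambda>x. Complex (a x) (b x)) = (\<lambda>x. complex_of_real (a x) + \<i> * complex_of_real (b x))"
      by (simp add: fun_eq_iff Complex_eq)
    moreover have "(\<lambda>x. complex_of_real (a x) + \<i> * complex_of_real (b x)) \<in> borel_measurable \<mu>"
      using ab(1,3) by measurable
    ultimately show "(\<lambda>x. Complex (a x) (b x)) \<in> borel_measurable borel"
      by (simp cong: measurable_cong_sets)
    have "AE x in \<mu>. f x = Complex (a x) (b x)"
      using ab(2,4) by eventually_elim (simp add: complex_eq_iff)
    then show "AE x in M. f x = Complex (a x) (b x)" by (rule AE_completion)
  qed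
qed

end

text \<open>The substitution \<open>x = y z\<close> turns the value of \<open>f * \<phi>\<close> at \<open>y\<close> into the functional
  \<open>g \<mapsto> \<integral> g z \<phi> (z\<^sup>-\<^sup>1)\<close> at a translate of \<open>f\<close>.\<close>

lemma (in haar_group) conv_via_functional:
  fixes f \<phi> :: "'g \<Rightarrow> complex"
  assumes "integrable M (\<lambda>z. left_translate G (inv y) f z * \<phi> (inv z))"
  shows "integrable M (\<lambda>x. f x * \<phi> (inv x \<otimes> y))"
    and "conv G M f \<phi> y = (\<integral>z. left_translate G (inv y) f z * \<phi> (inv z) \<partial>M)"
proof -
  let ?q = "\<lambda>z. left_translate G (inv y) f z * \<phi> (inv z)"
  have eq: "?q (inv y \<otimes> x) = f x * \<phi> (inv x \<otimes> y)" for x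
    by (simp add: left_translate_def inv_mult_group m_assoc[symmetric])
  show "integrable M (\<lambda>x. f x * \<phi> (inv x \<otimes> y))"
    using integrable_left_translate(1)[OF assms, of "inv y"] unfolding eq .
  show "conv G M f \<phi> y = (\<integral>z. ?q z \<partial>M)"
    using integrable_left_translate(2)[OF assms, of "inv y"] unfolding eq conv_def .
qed

context haar_group
begin

lemma mem_l_coset_iff: "y \<in> x <# U \<longleftrightarrow> inv x \<otimes> y \<in> U"
proof
  assume "y \<in> x <# U"
  then obtain u where "u \<in> U" "y = x \<otimes> u" by (auto simp: l_coset_def)
  then show "inv x \<otimes> y \<in> U" by (simp add: m_assoc[symmetric])
next
  assume "inv x \<otimes> y \<in> U"
  then show "y \<in> x <# U"
    unfolding l_coset_def by (auto intro!: bexI[of _ "inv x \<otimes> y"] simp: m_assoc[symmetric])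
qed

lemma compact_mult_image:
  assumes "compact S" "compact T"
  shows "compact ((\<lambda>(a, b). a \<otimes> b) ` (S \<times> T))"
  using assms by (intro compact_continuous_image compact_Times continuous_on_subset[OF continuous_mult]) auto

lemma compact_inv_image: "compact S \<Longrightarrow> compact ((\<lambda>a. inv a) ` S)"
  by (intro compact_continuous_image continuous_on_subset[OF continuous_inv]) auto

lemma l_coset_image: "x <# U = (\<lambda>(a, b). a \<otimes> b) ` ({x} \<times> U)"
  by (auto simp: l_coset_def)

lemma compact_l_coset: "compact U \<Longrightarrow> compact (x <# U)"
  unfolding l_coset_image by (intro compact_mult_image) auto

lemma emeasure_l_coset:
  assumes "U \<in> sets borel" shows "emeasure \<mu> (x <# U) = emeasure \<mu> U"
proof -
  have "x <# U = {y. inv x \<otimes> y \<in> U}" by (auto simp: mem_l_coset_iff)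
  then show ?thesis using emeasure_left_translate[OF assms, of "inv x"] by simp
qed

text \<open>Countably many translates of \<open>U\<close> cover \<open>G\<close>, so \<open>U\<close> has positive measure. All translates \<open>x i U\<close>
  that meet \<open>K\<close> lie in the compact set \<open>T = K U\<^sup>-\<^sup>1 U\<close>, and every point is in at most \<open>N\<close> of them.
  Integration over \<open>T\<close> therefore bounds the number of such translates by \<open>N \<mu>(T) / \<mu>(U)\<close>.
  Positive measure does the work that is usually done by the interior of \<open>U\<close>.\<close>

lemma relatively_separated_locally_finite:
  assumes sep: "relatively_separated G U I x" and U: "compact U" and K: "compact K"
  shows "finite {i\<in>I. (x i <# U) \<inter> K \<noteq> {}}"
proof (rule ccontr)
  let ?S = "{i\<in>I. (x i <# U) \<inter> K \<noteq> {}}"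
  assume inf: "infinite ?S"
  obtain N :: nat where cover: "UNIV = (\<Union>i\<in>I. x i <# U)"
    and N: "\<And>i. i \<in> I \<Longrightarrow> finite {j\<in>I. (x i <# U) \<inter> (x j <# U) \<noteq> {}} \<and>
        card {j\<in>I. (x i <# U) \<inter> (x j <# U) \<noteq> {}} \<le> N"
    using sep unfolding relatively_separated_def by blast
  have coset_sets [measurable]: "x i <# U \<in> sets borel" for i
    using compact_l_coset[OF U] by blast
  have U_sets: "U \<in> sets borel" using U by blast
  have pos: "measure \<mu> U > 0"
  proof -
    have "emeasure \<mu> U \<noteq> 0"
    proof
      assume "emeasure \<mu> U = 0"
      then have "x i <# U \<in> null_sets \<mu>" for i
        by (simp add: null_sets_def emeasure_l_coset[OF U_sets])
      then have "(\<Union>i\<in>I. x i <# U) \<in> null_sets \<mu>" by (intro null_sets_UN') auto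
      then show False using emeasure_UNIV_neq_0 cover by (auto simp: null_sets_def)
    qed
    then show ?thesis
      using emeasure_compact_finite[OF U] by (simp add: measure_def enn2real_positive_iff zero_less_iff_neq_zero)
  qed
  define T where "T = (\<lambda>(a, b). a \<otimes> b) ` (((\<lambda>(a, b). a \<otimes> b) ` (K \<times> ((\<lambda>a. inv a) ` U))) \<times> U)"
  have T: "compact T"
    unfolding T_def by (intro compact_mult_image compact_inv_image K U)
  have T_sets [measurable]: "T \<in> sets borel" using T by blast
  have sub: "x i <# U \<subseteq> T" if "i \<in> ?S" for i
  proof
    fix y assume y: "y \<in> x i <# U"
    from that obtain k where k: "k \<in> K" "inv (x i) \<otimes> k \<in> U" by (auto simp: mem_l_coset_iff)
    have "y = (k \<otimes> inv (inv (x i) \<otimes> k)) \<otimes> (inv (x i) \<otimes> y)"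
      by (simp add: inv_mult_group m_assoc) (simp add: m_assoc[symmetric])
    then show "y \<in> T" using k y unfolding T_def mem_l_coset_iff
      by (intro image_eqI[of _ _ "(k \<otimes> inv (inv (x i) \<otimes> k), inv (x i) \<otimes> y)"]) auto
  qed
  obtain m :: nat where m: "real m * measure \<mu> U > real N * measure \<mu> T"
    using reals_Archimedean3[OF pos] by blast
  obtain J where J: "J \<subseteq> ?S" "finite J" "card J = m"
    using infinite_arbitrarily_large[OF inf] by blast
  have count: "(\<Sum>j\<in>J. indicator (x j <# U) y :: ennreal) \<le> of_nat N * indicator T y" for y
  proof (cases "\<exists>i\<in>J. y \<in> x i <# U")
    case True
    then obtain i where i: "i \<in> J" "y \<in> x i <# U" by blast
    have "{j\<in>J. y \<in> x j <# U} \<subseteq> {j\<in>I. (x i <# U) \<inter> (x j <# U) \<noteq> {}}"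
      using J(1) i by blast
    moreover have "i \<in> I" using J(1) i(1) by blast
    ultimately have "card {j\<in>J. y \<in> x j <# U} \<le> N"
      using N[of i] card_mono order_trans by blast
    then have "(of_nat (card {j\<in>J. y \<in> x j <# U}) :: ennreal) \<le> of_nat N"
      by (rule of_nat_mono)
    moreover have "(\<Sum>j\<in>J. indicator (x j <# U) y :: ennreal) = of_nat (card {j\<in>J. y \<in> x j <# U})"
      using J(2) by (simp add: indicator_def of_bool_def flip: sum.inter_filter)
    moreover have "y \<in> T" using sub[of i] i J(1) by blast
    ultimately show ?thesis by simp
  next
    case False
    then have "(\<Sum>j\<in>J. indicator (x j <# U) y :: ennreal) = 0"
      by (intro sum.neutral) auto
    then show ?thesis by simp
  qed
  have "of_nat m * emeasure \<mu> U = (\<Sum>j\<in>J. emeasure \<mu> (x j <# U))"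
    using J by (simp add: emeasure_l_coset[OF U_sets])
  also have "\<dots> = (\<Sum>j\<in>J. \<integral>\<^sup>+y. indicator (x j <# U) y \<partial>\<mu>)"
    by (intro sum.cong refl) (simp add: nn_integral_indicator)
  also have "\<dots> = (\<integral>\<^sup>+y. (\<Sum>j\<in>J. indicator (x j <# U) y) \<partial>\<mu>)"
    by (rule nn_integral_sum[symmetric]) measurable
  also have "\<dots> \<le> (\<integral>\<^sup>+y. of_nat N * indicator T y \<partial>\<mu>)"
    by (intro nn_integral_mono count)
  also have "\<dots> = of_nat N * emeasure \<mu> T"
    by (subst nn_integral_cmult_indicator) auto
  finally have "ennreal (real m * measure \<mu> U) \<le> ennreal (real N * measure \<mu> T)"
    using emeasure_compact_finite[OF U] emeasure_compact_finite[OF T]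
    by (simp add: emeasure_eq_ennreal_measure ennreal_mult ennreal_of_nat_eq_real_of_nat less_top)
  then have "real m * measure \<mu> U \<le> real N * measure \<mu> T" by simp
  with m show False by simp
qed

end

section \<open>Idempotence of convolution with the kernel\<close>

locale convolution_kernel = haar_group G \<mu> + solid_function_space "completion \<mu>" B nrm
  for G :: "'g::{t2_space, second_countable_topology} monoid" (structure)
    and \<mu> :: "'g measure" and B nrm +
  fixes \<phi> :: "'g \<Rightarrow> complex"
  assumes kernel_in: "\<phi> \<in> B"
    and kernel_integrable: "\<And>f y. f \<in> B \<Longrightarrow> integrable M (\<lambda>x. f x * \<phi> (inv x \<otimes> y))"
    and conv_in: "\<And>f. f \<in> B \<Longrightarrow> conv G M f \<phi> \<in> B"
    and kernel_idempotent: "AE y in M. conv G M \<phi> \<phi> y = \<phi> y"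
begin

text \<open>Fubini's theorem is available for Borel functions and \<open>\<mu>\<close>, whereas \<open>B\<close> consists of functions that are
  measurable for the completion. The values of \<open>f * \<phi>\<close>, at every point, may be computed from Borel
  representatives.\<close>

lemma conv_borel_representative:
  assumes f: "f \<in> B" and f0: "f0 \<in> borel_measurable borel" "AE x in M. f x = f0 x"
    and \<phi>0: "\<phi>0 \<in> borel_measurable borel" "AE x in M. \<phi> x = \<phi>0 x"
  shows "integrable \<mu> (\<lambda>x. f0 x * \<phi>0 (inv x \<otimes> y))"
    and "conv G M f \<phi> y = (\<integral>x. f0 x * \<phi>0 (inv x \<otimes> y) \<partial>\<mu>)"
proof -
  note [measurable] = f0(1) \<phi>0(1)
  have m: "(\<lambda>x. f0 x * \<phi>0 (inv x \<otimes> y)) \<in> borel_measurable \<mu>" by measurable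
  have ae: "AE x in M. f x * \<phi> (inv x \<otimes> y) = f0 x * \<phi>0 (inv x \<otimes> y)"
    using f0(2) AE_inv_mult[OF \<phi>0(2), of y] by eventually_elim simp
  note i = kernel_integrable[OF f, of y]
  have "integrable M (\<lambda>x. f0 x * \<phi>0 (inv x \<otimes> y))"
    using integrable_cong_AE_imp[OF i measurable_completion[OF m]] ae by (auto simp: eq_commute)
  then show "integrable \<mu> (\<lambda>x. f0 x * \<phi>0 (inv x \<otimes> y))"
    by (simp add: integrable_completion[OF m])
  have "conv G M f \<phi> y = (\<integral>x. f0 x * \<phi>0 (inv x \<otimes> y) \<partial>M)"
    unfolding conv_def
    by (intro integral_cong_AE ae borel_measurable_integrable[OF i] measurable_completion[OF m])
  then show "conv G M f \<phi> y = (\<integral>x. f0 x * \<phi>0 (inv x \<otimes> y) \<partial>\<mu>)"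
    by (simp add: integral_completion[OF m])
qed

text \<open>With Borel representatives in place of \<open>f\<close> and \<open>\<phi>\<close>, write \<open>k z = \<phi> (z\<^sup>-\<^sup>1 y)\<close>. Truncating the outer
  integral of \<open>((f * \<phi>) * \<phi>) y\<close> to a set \<open>Q n\<close> of finite measure on which \<open>(|f| * |\<phi>|) |k|\<close> is bounded makes Fubini's theorem applicable, and gives \<open>\<integral> w n\<close> with
  \<open>w n = f \<kappa> n\<close> and \<open>\<kappa> n x = \<integral> z \<in> Q n. \<phi> (x\<^sup>-\<^sup>1 z) k z\<close>. The same holds for the restriction of
  \<open>f\<close> to any Borel set \<open>S\<close> (\<open>cut S\<close>), and there the truncated integrals converge as \<open>n\<close> grows, because
  \<open>cut S * \<phi>\<close> is in \<open>B\<close>. On the other hand \<open>\<kappa> n x\<close> tends to \<open>(\<phi> * \<phi>) (x\<^sup>-\<^sup>1 y)\<close>, which is \<open>k x\<close> for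
  almost every \<open>x\<close>, and on a set of finite measure where \<open>|f x| (|\<phi>| * |\<phi>|) (x\<^sup>-\<^sup>1 y)\<close> is bounded the convergence of
  \<open>f \<kappa> n\<close> to \<open>f k\<close> is dominated. Countably many such sets \<open>P j\<close> make up \<open>G\<close>, and \<open>nikodym_vanishing\<close>
  for \<open>v n = w n - f k\<close> gives \<open>\<integral> w n \<longlonglongrightarrow> \<integral> f k = (f * \<phi>) y\<close>.\<close>

lemma conv_idempotent_at:
  assumes f: "f \<in> B"
  shows "conv G M (conv G M f \<phi>) \<phi> y = conv G M f \<phi> y"
proof -
  obtain f0 where f0 [measurable]: "f0 \<in> borel_measurable borel" and f_f0: "AE x in M. f x = f0 x"
    by (rule borel_representative[OF measurable_B[OF f]]) blast
  obtain \<phi>0 where \<phi>0 [measurable]: "\<phi>0 \<in> borel_measurable borel" and \<phi>_\<phi>0: "AE x in M. \<phi> x = \<phi>0 x"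
    by (rule borel_representative[OF measurable_B[OF kernel_in]]) blast
  obtain K :: "nat \<Rightarrow> 'g set" where K: "\<And>n. compact (K n)" "incseq K" "(\<Union>n. K n) = UNIV"
    by (rule exhaustion) blast
  have K_sets [measurable]: "K n \<in> sets borel" for n using K(1) by blast
  define k where "k = (\<lambda>z. \<phi>0 (inv z \<otimes> y))"
  have k [measurable]: "k \<in> borel_measurable borel" unfolding k_def by measurable
  \<comment> \<open>\<open>H\<close> and \<open>W\<close> are \<open>|f| * |\<phi>|\<close> and \<open>|\<phi>| * |\<phi>|\<close>: finite everywhere, though possibly not integrable\<close>
  define H where "H = (\<lambda>z. \<integral>\<^sup>+x. ennreal (norm (f0 x * \<phi>0 (inv x \<otimes> z))) \<partial>\<mu>)"
  define W where "W = (\<lambda>w. \<integral>\<^sup>+x. ennreal (norm (\<phi>0 x * \<phi>0 (inv x \<otimes> w))) \<partial>\<mu>)"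
  have H [measurable]: "H \<in> borel_measurable borel" unfolding H_def by measurable
  have W [measurable]: "W \<in> borel_measurable borel" unfolding W_def by measurable
  have H_fin: "H z < \<infinity>" for z
    using conv_borel_representative(1)[OF f f0 f_f0 \<phi>0 \<phi>_\<phi>0, of z]
    by (simp add: H_def integrable_iff_bounded)
  have W_fin: "W w < \<infinity>" for w
    using conv_borel_representative(1)[OF kernel_in \<phi>0 \<phi>_\<phi>0 \<phi>0 \<phi>_\<phi>0, of w]
    by (simp add: W_def integrable_iff_bounded)
  have cover: "(\<Union>n. K n \<inter> {x. F x \<le> of_nat n}) = UNIV" if "\<And>x. F x < \<infinity>" for F :: "'g \<Rightarrow> ennreal"
  proof (intro equalityI subsetI UNIV_I)
    fix x
    obtain a where a: "x \<in> K a" using K(3) by blast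
    obtain b where b: "F x < of_nat b"
      using \<open>F x < \<infinity>\<close> ennreal_Ex_less_of_nat by (auto simp: top.not_eq_extremum)
    have "x \<in> K (max a b)" using a K(2) by (meson incseqD max.cobounded1 subsetD)
    moreover have "F x \<le> of_nat (max a b)"
      using b by (meson less_imp_le max.cobounded2 of_nat_mono order_trans)
    ultimately show "x \<in> (\<Union>n. K n \<inter> {x. F x \<le> of_nat n})" by blast
  qed
  define Q where "Q = (\<lambda>n. K n \<inter> {z. H z * ennreal (norm (k z)) \<le> of_nat n})"
  define R where "R = (\<lambda>n. K n \<inter> {x. ennreal (norm (f0 x)) * W (inv x \<otimes> y) \<le> of_nat n})"
  define P where "P = disjointed R"
  have level: "{x. F x \<le> c} \<in> sets borel" if "F \<in> borel_measurable borel" for F :: "'g \<Rightarrow> ennreal" and c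
    using that by measurable
  have Q [measurable]: "Q n \<in> sets borel" for n
    unfolding Q_def by (intro sets.Int K_sets level) measurable
  have R: "R n \<in> sets borel" for n
    unfolding R_def by (intro sets.Int K_sets level) measurable
  have P [measurable]: "P n \<in> sets borel" for n
    using sets.range_disjointed_sets[of R borel] R unfolding P_def by blast
  have Q_cover: "(\<Union>n. Q n) = UNIV"
    unfolding Q_def by (rule cover) (use H_fin in \<open>simp add: ennreal_mult_less_top\<close>)
  have Q_inc: "Q m \<subseteq> Q n" if "m \<le> n" for m n
    using K(2) that unfolding Q_def incseq_def
    by (auto intro: order_trans of_nat_mono)
  have P_cover: "(\<Union>n. P n) = UNIV"
    unfolding P_def UN_disjointed_eq R_def
    by (rule cover) (use W_fin in \<open>simp add: ennreal_mult_less_top\<close>)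
  have P_disj: "disjoint_family P" unfolding P_def by (rule disjoint_family_disjointed)

  define T where "T = (\<lambda>n x z. indicator (Q n) z * (f0 x * \<phi>0 (inv x \<otimes> z) * k z))"
  have T_meas [measurable]: "(\<lambda>p. T n (fst p) (snd p)) \<in> borel_measurable (\<mu> \<Otimes>\<^sub>M \<mu>)" for n
    unfolding T_def by measurable
  have T_int: "integrable (\<mu> \<Otimes>\<^sub>M \<mu>) (\<lambda>p. T n (fst p) (snd p))" for n
  proof (rule integrableI_bounded)
    have "(\<integral>\<^sup>+p. ennreal (norm (T n (fst p) (snd p))) \<partial>(\<mu> \<Otimes>\<^sub>M \<mu>)) =
        (\<integral>\<^sup>+z. (\<integral>\<^sup>+x. ennreal (norm (T n x z)) \<partial>\<mu>) \<partial>\<mu>)"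
      by (subst nn_integral_snd[symmetric]) (auto simp: case_prod_beta)
    also have "\<dots> \<le> (\<integral>\<^sup>+z. of_nat n * indicator (K n) z \<partial>\<mu>)"
    proof (rule nn_integral_mono)
      fix z
      have "(\<integral>\<^sup>+x. ennreal (norm (T n x z)) \<partial>\<mu>) =
          (\<integral>\<^sup>+x. (indicator (Q n) z * ennreal (norm (k z))) * ennreal (norm (f0 x * \<phi>0 (inv x \<otimes> z))) \<partial>\<mu>)"
        by (intro nn_integral_cong)
          (auto simp: T_def norm_mult ennreal_mult'' mult_ac split: split_indicator)
      also have "\<dots> = indicator (Q n) z * ennreal (norm (k z)) * H z"
        unfolding H_def by (rule nn_integral_cmult) measurable
      also have "\<dots> \<le> of_nat n * indicator (K n) z"
        by (auto simp: Q_def mult_ac split: split_indicator)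
      finally show "(\<integral>\<^sup>+x. ennreal (norm (T n x z)) \<partial>\<mu>) \<le> of_nat n * indicator (K n) z" .
    qed
    also have "\<dots> = of_nat n * emeasure \<mu> (K n)"
      by (subst nn_integral_cmult_indicator) auto
    also have "\<dots> < \<infinity>"
      using emeasure_compact_finite[OF K(1)] by (simp add: ennreal_mult_less_top ennreal_of_nat_eq_real_of_nat)
    finally show "(\<integral>\<^sup>+p. ennreal (norm (T n (fst p) (snd p))) \<partial>(\<mu> \<Otimes>\<^sub>M \<mu>)) < \<infinity>" .
  qed measurable
  define \<kappa> where "\<kappa> = (\<lambda>n x. \<integral>z. indicator (Q n) z * (\<phi>0 (inv x \<otimes> z) * k z) \<partial>\<mu>)"
  define w where "w = (\<lambda>n x. f0 x * \<kappa> n x)"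
  have w_T: "(\<integral>z. T n x z \<partial>\<mu>) = w n x" for n x
  proof -
    have "(\<integral>z. T n x z \<partial>\<mu>) = (\<integral>z. f0 x * (indicator (Q n) z * (\<phi>0 (inv x \<otimes> z) * k z)) \<partial>\<mu>)"
      by (simp add: T_def mult_ac)
    then show ?thesis by (simp add: w_def \<kappa>_def)
  qed
  have w_int: "integrable \<mu> (w n)" for n
    using integrable_fst'[OF T_int[of n]] by (simp add: w_T)
  define cut where "cut = (\<lambda>S x. indicator S x * f x)"
  have cut_in: "cut S \<in> B" if "S \<in> sets borel" for S
    unfolding cut_def
  proof (rule bounded_mult_in[where c=1, OF _ _ f])
    show "(indicator S :: 'g \<Rightarrow> complex) \<in> borel_measurable M"
      using that by (intro borel_measurable_indicator sets_completionI_sets) simp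
  qed (simp add: indicator_def)
  have cut_f0: "AE x in M. cut S x = indicator S x * f0 x" for S
    using f_f0 by eventually_elim (simp add: cut_def)
  have conv_cut: "integrable \<mu> (\<lambda>x. indicator S x * f0 x * \<phi>0 (inv x \<otimes> z))"
      "conv G M (cut S) \<phi> z = (\<integral>x. indicator S x * f0 x * \<phi>0 (inv x \<otimes> z) \<partial>\<mu>)"
    if S [measurable]: "S \<in> sets borel" for S z
    by (rule conv_borel_representative[OF cut_in[OF S] _ cut_f0 \<phi>0 \<phi>_\<phi>0]; measurable)+
  have conv_cut_borel [measurable]: "conv G M (cut S) \<phi> \<in> borel_measurable borel"
    if S [measurable]: "S \<in> sets borel" for S
  proof -
    have "(\<lambda>z. \<integral>x. indicator S x * f0 x * \<phi>0 (inv x \<otimes> z) \<partial>\<mu>) \<in> borel_measurable borel" by measurable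
    moreover have "conv G M (cut S) \<phi> = (\<lambda>z. \<integral>x. indicator S x * f0 x * \<phi>0 (inv x \<otimes> z) \<partial>\<mu>)"
      by (rule ext) (rule conv_cut(2)[OF S])
    ultimately show ?thesis by (simp only:)
  qed
  have fubini: "(\<integral>x. indicator S x * w n x \<partial>\<mu>) =
      (\<integral>z. indicator (Q n) z * (conv G M (cut S) \<phi> z * k z) \<partial>\<mu>)"
    if S [measurable]: "S \<in> sets borel" for S n
  proof -
    have int: "integrable (\<mu> \<Otimes>\<^sub>M \<mu>) (\<lambda>(x, z). indicator S x * T n x z)"
    proof (rule Bochner_Integration.integrable_bound[OF T_int[of n]])
      show "(\<lambda>(x, z). indicator S x * T n x z) \<in> borel_measurable (\<mu> \<Otimes>\<^sub>M \<mu>)"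
        unfolding T_def by measurable
    qed (auto simp: norm_mult indicator_def)
    have "(\<integral>x. indicator S x * w n x \<partial>\<mu>) = (\<integral>x. (\<integral>z. indicator S x * T n x z \<partial>\<mu>) \<partial>\<mu>)"
      by (simp add: w_T)
    also have "\<dots> = (\<integral>z. (\<integral>x. indicator S x * T n x z \<partial>\<mu>) \<partial>\<mu>)"
      by (rule Fubini_integral[OF int, symmetric])
    also have "\<dots> = (\<integral>z. indicator (Q n) z * (conv G M (cut S) \<phi> z * k z) \<partial>\<mu>)"
    proof (rule Bochner_Integration.integral_cong[OF refl])
      fix z
      have "(\<integral>x. indicator S x * T n x z \<partial>\<mu>) =
          (\<integral>x. (indicator (Q n) z * k z) * (indicator S x * f0 x * \<phi>0 (inv x \<otimes> z)) \<partial>\<mu>)"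
        by (simp add: T_def mult_ac)
      also have "\<dots> = (indicator (Q n) z * k z) * (\<integral>x. indicator S x * f0 x * \<phi>0 (inv x \<otimes> z) \<partial>\<mu>)"
        by (rule integral_mult_right_zero)
      finally show "(\<integral>x. indicator S x * T n x z \<partial>\<mu>) = indicator (Q n) z * (conv G M (cut S) \<phi> z * k z)"
        by (simp add: conv_cut(2)[OF S])
    qed
    finally show ?thesis .
  qed
  have k_conv: "integrable \<mu> (\<lambda>z. conv G M (cut S) \<phi> z * k z)"
      "conv G M (conv G M (cut S) \<phi>) \<phi> y = (\<integral>z. conv G M (cut S) \<phi> z * k z \<partial>\<mu>)"
    if S: "S \<in> sets borel" for S
    unfolding k_def
    by (rule conv_borel_representative[OF conv_in[OF cut_in[OF S]] conv_cut_borel[OF S] _ \<phi>0 \<phi>_\<phi>0]; simp)+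
  have Q_ev: "eventually (\<lambda>n. z \<in> Q n) sequentially" for z
  proof -
    obtain m where "z \<in> Q m" using Q_cover by blast
    then show ?thesis using Q_inc unfolding eventually_sequentially by blast
  qed
  have Q_lim: "(\<lambda>n. \<integral>z. indicator (Q n) z * g z \<partial>\<mu>) \<longlonglongrightarrow> (\<integral>z. g z \<partial>\<mu>)"
    if g: "integrable \<mu> g" for g :: "'g \<Rightarrow> complex"
  proof (rule integral_dominated_convergence)
    show "integrable \<mu> (\<lambda>z. norm (g z))" using g by simp
    show "AE z in \<mu>. (\<lambda>n. indicator (Q n) z * g z) \<longlonglongrightarrow> g z"
    proof (intro AE_I2 tendsto_eventually)
      fix z
      show "eventually (\<lambda>n. indicator (Q n) z * g z = g z) sequentially"
        using Q_ev[of z] by eventually_elim simp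
    qed
    show "(\<lambda>z. indicator (Q n) z * g z) \<in> borel_measurable \<mu>" for n
      using borel_measurable_integrable[OF g] by measurable
  qed (use g in \<open>auto simp: norm_mult indicator_def\<close>)
  define v where "v = (\<lambda>n x. w n x - f0 x * k x)"
  have fk_int: "integrable \<mu> (\<lambda>x. f0 x * k x)"
    unfolding k_def by (rule conv_borel_representative(1)[OF f f0 f_f0 \<phi>0 \<phi>_\<phi>0])
  have v_cut: "(\<integral>x. indicator S x * v n x \<partial>\<mu>) =
      (\<integral>z. indicator (Q n) z * (conv G M (cut S) \<phi> z * k z) \<partial>\<mu>) - conv G M (cut S) \<phi> y"
    if S [measurable]: "S \<in> sets borel" for S n
  proof -
    have iw: "integrable \<mu> (\<lambda>x. indicator S x * w n x)"
      by (rule Bochner_Integration.integrable_bound[OF w_int[of n]])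
        (use borel_measurable_integrable[OF w_int[of n]] in \<open>auto simp: norm_mult indicator_def\<close>)
    have "(\<integral>x. indicator S x * v n x \<partial>\<mu>) =
        (\<integral>x. indicator S x * w n x - indicator S x * f0 x * \<phi>0 (inv x \<otimes> y) \<partial>\<mu>)"
      by (simp add: v_def k_def algebra_simps)
    also have "\<dots> = (\<integral>x. indicator S x * w n x \<partial>\<mu>) - (\<integral>x. indicator S x * f0 x * \<phi>0 (inv x \<otimes> y) \<partial>\<mu>)"
      by (rule Bochner_Integration.integral_diff[OF iw conv_cut(1)[OF S]])
    finally show ?thesis by (simp add: fubini[OF S] conv_cut(2)[OF S])
  qed
  have v_lim: "(\<lambda>n. \<integral>x. indicator S x * v n x \<partial>\<mu>) \<longlonglongrightarrow>
      conv G M (conv G M (cut S) \<phi>) \<phi> y - conv G M (cut S) \<phi> y" if S: "S \<in> sets borel" for S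
    unfolding v_cut[OF S] k_conv(2)[OF S] by (intro tendsto_intros Q_lim k_conv(1)[OF S])
  have \<kappa>_int: "integrable \<mu> (\<lambda>z. \<phi>0 (inv x \<otimes> z) * k z)"
    and \<kappa>_val: "(\<integral>z. \<phi>0 (inv x \<otimes> z) * k z \<partial>\<mu>) = conv G M \<phi> \<phi> (inv x \<otimes> y)"
    and \<kappa>_norm: "(\<integral>\<^sup>+z. ennreal (norm (\<phi>0 (inv x \<otimes> z) * k z)) \<partial>\<mu>) = W (inv x \<otimes> y)" for x
  proof -
    let ?q = "\<lambda>z. \<phi>0 z * \<phi>0 (inv z \<otimes> (inv x \<otimes> y))"
    have q: "?q \<in> borel_measurable \<mu>" by measurable
    have eq: "?q (inv x \<otimes> z) = \<phi>0 (inv x \<otimes> z) * k z" for z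
      by (simp add: k_def inv_mult_group m_assoc[symmetric]) (simp add: m_assoc)
    have m: "(\<lambda>z. \<phi>0 (inv x \<otimes> z) * k z) \<in> borel_measurable \<mu>" by measurable
    note rep = conv_borel_representative[OF kernel_in \<phi>0 \<phi>_\<phi>0 \<phi>0 \<phi>_\<phi>0, of "inv x \<otimes> y"]
    have qM: "integrable M ?q" using rep(1) by (simp add: integrable_completion[OF q])
    show "integrable \<mu> (\<lambda>z. \<phi>0 (inv x \<otimes> z) * k z)"
      using integrable_left_translate(1)[OF qM, of "inv x"] unfolding eq
      by (simp add: integrable_completion[OF m])
    show "(\<integral>z. \<phi>0 (inv x \<otimes> z) * k z \<partial>\<mu>) = conv G M \<phi> \<phi> (inv x \<otimes> y)"
      using integrable_left_translate(2)[OF qM, of "inv x"] unfolding eq rep(2)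
      by (simp add: integral_completion[OF m] integral_completion[OF q])
    have "W (inv x \<otimes> y) = (\<integral>\<^sup>+z. ennreal (norm (?q (inv x \<otimes> z))) \<partial>\<mu>)"
      unfolding W_def by (rule nn_integral_left_translate[symmetric]) measurable
    then show "(\<integral>\<^sup>+z. ennreal (norm (\<phi>0 (inv x \<otimes> z) * k z)) \<partial>\<mu>) = W (inv x \<otimes> y)"
      unfolding eq by simp
  qed
  have piece: "(\<lambda>n. \<integral>x. indicator (P j) x * v n x \<partial>\<mu>) \<longlonglongrightarrow> 0" for j
  proof -
    have vb: "v n \<in> borel_measurable \<mu>" for n
      unfolding v_def using borel_measurable_integrable[OF w_int[of n]] borel_measurable_integrable[OF fk_int]
      by measurable
    have "(\<lambda>n. \<integral>x. indicator (P j) x * v n x \<partial>\<mu>) \<longlonglongrightarrow> (\<integral>x. 0 \<partial>\<mu>)"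
    proof (rule integral_dominated_convergence)
      show "(\<lambda>x. indicator (P j) x * v n x) \<in> borel_measurable \<mu>" for n
        using vb by measurable
      have "integrable \<mu> (\<lambda>x. real j * indicat_real (K j) x)"
        using emeasure_compact_finite[OF K(1)[of j]] by (intro integrable_mult_right) auto
      then show "integrable \<mu> (\<lambda>x. real j * indicat_real (K j) x + norm (f0 x * k x))"
        using fk_int by auto
      have "AE x in M. \<phi> (inv x \<otimes> y) = \<phi>0 (inv x \<otimes> y)" by (rule AE_inv_mult[OF \<phi>_\<phi>0])
      with AE_inv_mult[OF kernel_idempotent, of y]
      have "AE x in M. conv G M \<phi> \<phi> (inv x \<otimes> y) = k x"
        by eventually_elim (simp add: k_def)
      then have "AE x in \<mu>. conv G M \<phi> \<phi> (inv x \<otimes> y) = k x" by (simp add: AE_completion_iff)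
      then show "AE x in \<mu>. (\<lambda>n. indicator (P j) x * v n x) \<longlonglongrightarrow> 0"
      proof eventually_elim
        case (elim x)
        have "(\<lambda>n. \<kappa> n x) \<longlonglongrightarrow> k x"
          using Q_lim[OF \<kappa>_int[of x]] unfolding \<kappa>_val elim \<kappa>_def .
        then have "(\<lambda>n. indicator (P j) x * (f0 x * \<kappa> n x - f0 x * k x)) \<longlonglongrightarrow>
            indicator (P j) x * (f0 x * k x - f0 x * k x)"
          by (intro tendsto_intros)
        then show ?case by (simp add: v_def w_def)
      qed
      have "norm (indicator (P j) x * v n x) \<le> real j * indicat_real (K j) x + norm (f0 x * k x)" for x n
      proof (cases "x \<in> P j")
        case True
        then have xR: "x \<in> R j" using disjointed_subset[of R j] by (auto simp: P_def)
        have "ennreal (norm (\<kappa> n x)) \<le> (\<integral>\<^sup>+z. ennreal (norm (indicator (Q n) z * (\<phi>0 (inv x \<otimes> z) * k z))) \<partial>\<mu>)"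
          unfolding \<kappa>_def
        proof (rule integral_norm_bound_ennreal)
          show "integrable \<mu> (\<lambda>z. indicator (Q n) z * (\<phi>0 (inv x \<otimes> z) * k z))"
            by (rule Bochner_Integration.integrable_bound[OF \<kappa>_int[of x]])
              (auto simp: norm_mult indicator_def)
        qed
        also have "\<dots> \<le> W (inv x \<otimes> y)"
          unfolding \<kappa>_norm[symmetric] by (intro nn_integral_mono) (auto simp: indicator_def)
        finally have "ennreal (norm (f0 x)) * ennreal (norm (\<kappa> n x)) \<le> ennreal (norm (f0 x)) * W (inv x \<otimes> y)"
          by (intro mult_left_mono) auto
        also have "\<dots> \<le> of_nat j" using xR by (simp add: R_def)
        finally have "norm (w n x) \<le> real j"
          by (simp add: w_def norm_mult ennreal_mult[symmetric] ennreal_of_nat_eq_real_of_nat)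
        moreover have "x \<in> K j" using xR by (simp add: R_def)
        ultimately show ?thesis
          using True norm_triangle_ineq4[of "w n x" "f0 x * k x"] by (simp add: v_def)
      qed (auto simp: indicator_def)
      then show "AE x in \<mu>. norm (indicator (P j) x * v n x) \<le> real j * indicat_real (K j) x + norm (f0 x * k x)" for n
        by simp
    qed simp
    then show ?thesis by simp
  qed
  have "(\<lambda>n. \<integral>x. v n x \<partial>\<mu>) \<longlonglongrightarrow> 0"
  proof (rule nikodym_vanishing[where P=P])
    show "integrable \<mu> (v n)" for n
      unfolding v_def by (intro Bochner_Integration.integrable_diff w_int fk_int)
    show "convergent (\<lambda>n. \<integral>x. indicator (\<Union>j\<in>A. P j) x * v n x \<partial>\<mu>)" for A
      using v_lim[of "\<Union>j\<in>A. P j"] by (auto simp: convergent_def)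
  qed (use P P_disj P_cover piece in auto)
  moreover have "(\<lambda>n. \<integral>x. v n x \<partial>\<mu>) \<longlonglongrightarrow> conv G M (conv G M f \<phi>) \<phi> y - conv G M f \<phi> y"
    using v_lim[of UNIV] by (simp add: cut_def)
  ultimately show ?thesis
    using LIMSEQ_unique by fastforce
qed

lemma conv_idempotent: "f \<in> B \<Longrightarrow> conv G M (conv G M f \<phi>) \<phi> = conv G M f \<phi>"
  using conv_idempotent_at by blast

end

section \<open>The reproducing space\<close>

locale reproducing_kernel = convolution_kernel +
  assumes conv_bounded: "\<exists>L. \<forall>f\<in>B. nrm (conv G M f \<phi>) \<le> L * nrm f"
    and locally_bounded: "\<And>f K. f \<in> reproducing_space G M B \<phi> \<Longrightarrow> compact K \<Longrightarrow> \<exists>c. \<forall>y\<in>K. norm (f y) \<le> c"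
begin

abbreviation B\<phi> where "B\<phi> \<equiv> reproducing_space G M B \<phi>"

lemma B\<phi>_in: "f \<in> B\<phi> \<Longrightarrow> f \<in> B" and B\<phi>_conv: "f \<in> B\<phi> \<Longrightarrow> conv G M f \<phi> = f"
  by (auto simp: reproducing_space_def)

lemma conv_add: "f \<in> B \<Longrightarrow> g \<in> B \<Longrightarrow> conv G M (\<lambda>y. f y + g y) \<phi> = (\<lambda>y. conv G M f \<phi> y + conv G M g \<phi> y)"
  unfolding conv_def
  by (simp add: distrib_right Bochner_Integration.integral_add[OF kernel_integrable kernel_integrable])

lemma conv_scale: "conv G M (\<lambda>y. c * f y) \<phi> = (\<lambda>y. c * conv G M f \<phi> y)"
  unfolding conv_def by (simp add: mult.assoc)

lemma conv_diff:
  assumes "f \<in> B" "g \<in> B"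
  shows "conv G M (\<lambda>y. f y - g y) \<phi> = (\<lambda>y. conv G M f \<phi> y - conv G M g \<phi> y)"
  using conv_add[OF assms(1) scale_in[OF assms(2)], of "-1"] conv_scale[of "-1" g] by simp

lemma conv_sum: "finite J \<Longrightarrow> (\<And>j. j \<in> J \<Longrightarrow> F j \<in> B) \<Longrightarrow>
    conv G M (\<lambda>y. \<Sum>j\<in>J. F j y) \<phi> = (\<lambda>y. \<Sum>j\<in>J. conv G M (F j) \<phi> y)"
proof (induction rule: finite_induct)
  case empty then show ?case by (simp add: conv_def)
next
  case (insert a J)
  have "conv G M (\<lambda>y. F a y + (\<Sum>j\<in>J. F j y)) \<phi> =
      (\<lambda>y. conv G M (F a) \<phi> y + conv G M (\<lambda>y. \<Sum>j\<in>J. F j y) \<phi> y)"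
    using insert by (intro conv_add sum_in) auto
  with insert show ?case by simp
qed

lemma conv_in_B\<phi>: "f \<in> B \<Longrightarrow> conv G M f \<phi> \<in> B\<phi>"
  by (simp add: reproducing_space_def conv_in conv_idempotent)

text \<open>Elements of the reproducing space are determined at every point by their class, as \<open>f = f * \<phi>\<close> holds
  at every point.\<close>

lemma B\<phi>_faithful:
  assumes "f \<in> B\<phi>" "nrm f = 0" shows "f = (\<lambda>_. 0)"
proof
  fix y
  have "AE x in M. f x = 0" using assms nrm_eq_0_iff[OF B\<phi>_in] by blast
  then have "AE x in M. f x * \<phi> (inv x \<otimes> y) = 0" by eventually_elim simp
  then have "conv G M f \<phi> y = 0" unfolding conv_def by (rule integral_eq_zero_AE)
  then show "f y = 0" by (simp add: B\<phi>_conv[OF assms(1)])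
qed

text \<open>The limit \<open>f\<close> in \<open>B\<close> of a Cauchy sequence in the reproducing space need not satisfy \<open>f = f * \<phi>\<close> at
  every point; the limit to choose is \<open>f * \<phi>\<close>, which lies in the reproducing space by idempotence.\<close>

lemma complete_seminorm_B\<phi>: "complete_seminorm B\<phi> nrm"
proof
  show "(\<lambda>_. 0) \<in> B\<phi>" by (auto simp: reproducing_space_def zero_in conv_def)
  show "(\<lambda>y. f y + g y) \<in> B\<phi>" if "f \<in> B\<phi>" "g \<in> B\<phi>" for f g
    using conv_in_B\<phi>[OF add_in[OF B\<phi>_in B\<phi>_in, OF that]] conv_add[OF B\<phi>_in B\<phi>_in, OF that] that
    by (simp add: B\<phi>_conv)
  show "(\<lambda>y. c * f y) \<in> B\<phi>" if "f \<in> B\<phi>" for c f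
    using conv_in_B\<phi>[OF scale_in[OF B\<phi>_in, OF that], of c] that by (simp add: conv_scale B\<phi>_conv)
  show "0 \<le> nrm f" if "f \<in> B\<phi>" for f by (rule nonneg[OF B\<phi>_in[OF that]])
  show "nrm (\<lambda>y. f y + g y) \<le> nrm f + nrm g" if "f \<in> B\<phi>" "g \<in> B\<phi>" for f g
    by (rule triangle[OF B\<phi>_in B\<phi>_in, OF that])
  show "nrm (\<lambda>y. c * f y) = norm c * nrm f" if "f \<in> B\<phi>" for c f
    by (rule scale[OF B\<phi>_in[OF that]])
next
  fix F :: "nat \<Rightarrow> 'a \<Rightarrow> complex"
  assume F: "\<And>k. F k \<in> B\<phi>"
    and cauchy: "\<And>e. e > 0 \<Longrightarrow> \<exists>m. \<forall>j\<ge>m. \<forall>k\<ge>m. nrm (\<lambda>y. F j y - F k y) < e"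
  obtain f where f: "f \<in> B" "(\<lambda>k. nrm (\<lambda>y. F k y - f y)) \<longlonglongrightarrow> 0"
    using complete[OF B\<phi>_in[OF F] cauchy] by blast
  obtain L where L: "\<And>g. g \<in> B \<Longrightarrow> nrm (conv G M g \<phi>) \<le> L * nrm g" using conv_bounded by blast
  have d: "(\<lambda>y. F k y - f y) \<in> B" for k by (intro diff_in B\<phi>_in[OF F] f)
  have eq: "conv G M (\<lambda>y. F k y - f y) \<phi> = (\<lambda>y. F k y - conv G M f \<phi> y)" for k
    unfolding conv_diff[OF B\<phi>_in[OF F] f(1)] B\<phi>_conv[OF F] ..
  have "(\<lambda>k. nrm (\<lambda>y. F k y - conv G M f \<phi> y)) \<longlonglongrightarrow> 0"
  proof (rule tendsto_sandwich[OF _ _ tendsto_const tendsto_mult_right_zero[OF f(2)]])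
    show "\<forall>\<^sub>F k in sequentially. 0 \<le> nrm (\<lambda>y. F k y - conv G M f \<phi> y)"
      using nonneg[OF conv_in[OF d]] by (simp add: eq)
    show "\<forall>\<^sub>F k in sequentially. nrm (\<lambda>y. F k y - conv G M f \<phi> y) \<le> L * nrm (\<lambda>y. F k y - f y)"
      using L[OF d] by (simp add: eq)
  qed
  with conv_in_B\<phi>[OF f(1)] show "\<exists>f\<in>B\<phi>. (\<lambda>k. nrm (\<lambda>y. F k y - f y)) \<longlonglongrightarrow> 0" by blast
qed

text \<open>Local boundedness of \<open>f\<close> is needed for the real supremum \<open>right_osc\<close> to be an upper bound.\<close>

lemma right_osc_upper:
  assumes f: "f \<in> B\<phi>" and U: "compact U" and y: "y \<in> x <# U"
  shows "norm (f x - f y) \<le> right_osc G U f y"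
proof -
  let ?u = "inv x \<otimes> y"
  have u: "?u \<in> U" using y by (simp add: mem_l_coset_iff)
  have x: "x = y \<otimes> inv ?u" by (simp add: inv_mult_group m_assoc[symmetric])
  have "compact ((\<lambda>(a, b). a \<otimes> b) ` ({y} \<times> ((\<lambda>a. inv a) ` U)))"
    by (intro compact_mult_image compact_inv_image U) auto
  from locally_bounded[OF f this] obtain c where c: "\<And>u. u \<in> U \<Longrightarrow> norm (f (y \<otimes> inv u)) \<le> c" by force
  have "norm (f (y \<otimes> inv ?u) - f y) \<le> right_osc G U f y"
    unfolding right_osc_def
  proof (rule cSUP_upper[OF u])
    show "bdd_above ((\<lambda>u. norm (f (y \<otimes> inv u) - f y)) ` U)"
    proof (rule bdd_aboveI2)
      fix u assume "u \<in> U"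
      then show "norm (f (y \<otimes> inv u) - f y) \<le> c + norm (f y)"
        using c[of u] norm_triangle_ineq4[of "f (y \<otimes> inv u)" "f y"] by linarith
    qed
  qed
  then show ?thesis using x by metis
qed

end

locale sampling = reproducing_kernel +
  fixes U I x \<psi>
  assumes U: "compact U"
    and bupu: "bupu G M U I x \<psi>"
    and osc_in: "\<And>f. f \<in> B\<phi> \<Longrightarrow> (\<lambda>y. complex_of_real (right_osc G U f y)) \<in> B"
begin

text \<open>A partition of unity indexed by \<open>I\<close> is extended by \<open>0\<close> to all natural numbers (\<open>weight\<close>), so that
  series over \<open>nat\<close> and their integrals can be used.\<close>

definition weight :: "nat \<Rightarrow> 'a \<Rightarrow> real" where "weight i y = (if i \<in> I then \<psi> i y else 0)"

lemma weight_nonneg: "0 \<le> weight i y"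
  using bupu by (auto simp: weight_def bupu_def)

lemma weight_support: "weight i y \<noteq> 0 \<Longrightarrow> i \<in> I \<and> y \<in> x i <# U"
  using bupu closure_subset[of "{y. \<psi> i y \<noteq> 0}"] by (auto simp: weight_def bupu_def split: if_splits)

lemma weight_measurable: "weight i \<in> borel_measurable M"
  using bupu by (cases "i \<in> I") (auto simp: weight_def[abs_def] bupu_def)

lemma weight_sums: "(\<lambda>i. weight i y) sums 1"
proof -
  have "((\<lambda>i. \<psi> i y) has_sum 1) I" using bupu by (simp add: bupu_def)
  then have "((\<lambda>i. weight i y) has_sum 1) UNIV"
    by (rule has_sum_cong_neutral[THEN iffD1, rotated -1]) (auto simp: weight_def)
  then show ?thesis by (rule has_sum_imp_sums)
qed

definition piece :: "('a \<Rightarrow> complex) \<Rightarrow> nat \<Rightarrow> 'a \<Rightarrow> complex" where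
  "piece f i y = f (x i) * complex_of_real (weight i y)"

definition interpolant :: "('a \<Rightarrow> complex) \<Rightarrow> 'a \<Rightarrow> complex" where
  "interpolant f y = (\<Sum>i. piece f i y)"

definition majorant :: "('a \<Rightarrow> complex) \<Rightarrow> 'a \<Rightarrow> real" where
  "majorant f y = norm (f y) + right_osc G U f y"

lemma right_osc_nonneg: "f \<in> B\<phi> \<Longrightarrow> 0 \<le> right_osc G U f y"
proof -
  assume f: "f \<in> B\<phi>"
  obtain i where "y \<in> x i <# U" using bupu unfolding bupu_def relatively_separated_def by blast
  from order_trans[OF norm_ge_zero right_osc_upper[OF f U this]] show ?thesis .
qed

lemma majorant_nonneg: "f \<in> B\<phi> \<Longrightarrow> 0 \<le> majorant f y"
  using right_osc_nonneg by (simp add: majorant_def)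

lemma majorant_in:
  assumes f: "f \<in> B\<phi>" shows "(\<lambda>y. complex_of_real (majorant f y)) \<in> B"
proof -
  have "(\<lambda>y. complex_of_real (norm (f y))) \<in> B"
    using measurable_B[OF B\<phi>_in[OF f]] by (intro solidD[OF _ B\<phi>_in[OF f]]) auto
  from add_in[OF this osc_in[OF f]] show ?thesis by (simp add: majorant_def)
qed

lemma weighted_difference: "f \<in> B\<phi> \<Longrightarrow> norm (f (x i) - f y) * weight i y \<le> right_osc G U f y * weight i y"
  using right_osc_upper[OF _ U, of f y "x i"] weight_support[of i y] weight_nonneg[of i y]
  by (cases "weight i y = 0") (auto intro: mult_right_mono)

text \<open>On the support of the \<open>i\<close>-th weight, \<open>f (x i)\<close> differs from \<open>f y\<close> by at most the oscillation at \<open>y\<close>.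
  The resulting majorant \<open>|f| + M\<^sub>r f\<close> is in \<open>B\<close> and dominates all partial sums of the quasi-interpolant,
  which is what makes convolution with \<open>\<phi>\<close> and summation commute.\<close>

lemma norm_piece_le:
  assumes f: "f \<in> B\<phi>" shows "norm (piece f i y) \<le> weight i y * majorant f y"
proof -
  have "norm (f (x i)) * weight i y \<le> (norm (f y) + norm (f (x i) - f y)) * weight i y"
    by (intro mult_right_mono weight_nonneg norm_triangle_sub)
  also have "\<dots> \<le> weight i y * majorant f y"
    using weighted_difference[OF f, of i y] by (simp add: majorant_def algebra_simps)
  finally show ?thesis using weight_nonneg[of i y] by (simp add: piece_def norm_mult)
qed

lemma summable_norm_piece:
  assumes f: "f \<in> B\<phi>" shows "summable (\<lambda>i. norm (piece f i y))"
  by (rule summable_comparison_test'[OF summable_mult2[OF sums_summable[OF weight_sums[of y]], of "majorant f y"], of 0])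
    (simp add: norm_piece_le[OF f])

lemma sum_norm_piece_le:
  assumes f: "f \<in> B\<phi>" and J: "finite J"
  shows "(\<Sum>i\<in>J. norm (piece f i y)) \<le> majorant f y"
proof -
  have "(\<Sum>i\<in>J. norm (piece f i y)) \<le> (\<Sum>i\<in>J. weight i y) * majorant f y"
    unfolding sum_distrib_right by (intro sum_mono norm_piece_le f)
  also have "(\<Sum>i\<in>J. weight i y) \<le> 1"
    using sum_le_suminf[OF sums_summable[OF weight_sums[of y]] J] sums_unique[OF weight_sums[of y]]
    by (simp add: weight_nonneg)
  finally show ?thesis using majorant_nonneg[OF f, of y] by (simp add: mult_right_mono)
qed

lemma piece_measurable: "piece f i \<in> borel_measurable M"
  unfolding piece_def[abs_def] using weight_measurable[of i] by measurable

lemma piece_in: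
  assumes f: "f \<in> B\<phi>" shows "piece f i \<in> B"
proof (rule solidD[OF piece_measurable majorant_in[OF f]])
  show "AE y in M. norm (piece f i y) \<le> norm (complex_of_real (majorant f y))"
    using sum_norm_piece_le[OF f, of "{i}"] majorant_nonneg[OF f] by simp
qed

lemma interpolant_measurable: "interpolant f \<in> borel_measurable M"
  unfolding interpolant_def[abs_def] by (intro borel_measurable_suminf piece_measurable)

lemma interpolant_near:
  assumes f: "f \<in> B\<phi>" shows "norm (interpolant f y - f y) \<le> right_osc G U f y"
proof -
  have w: "(\<lambda>i. complex_of_real (weight i y)) sums 1"
    using sums_of_real[OF weight_sums[of y], where 'a=complex] by simp
  have "(\<lambda>i. piece f i y) sums interpolant f y"
    unfolding interpolant_def by (rule summable_sums[OF summable_norm_cancel[OF summable_norm_piece[OF f]]])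
  from sums_diff[OF this sums_mult[OF w, of "f y"]]
  have s: "(\<lambda>i. (f (x i) - f y) * complex_of_real (weight i y)) sums (interpolant f y - f y)"
    by (simp add: piece_def left_diff_distrib)
  have b: "norm ((f (x i) - f y) * complex_of_real (weight i y)) \<le> right_osc G U f y * weight i y" for i
    using weighted_difference[OF f, of i y] weight_nonneg[of i y] by (simp add: norm_mult)
  have "norm (\<Sum>i. (f (x i) - f y) * complex_of_real (weight i y)) \<le> (\<Sum>i. right_osc G U f y * weight i y)"
    by (rule norm_suminf_le[OF b summable_mult[OF sums_summable[OF weight_sums]]])
  also have "\<dots> = right_osc G U f y"
    using sums_unique[OF sums_mult[OF weight_sums[of y], of "right_osc G U f y"]] by simp
  finally show ?thesis using sums_unique[OF s] by simp
qed

lemma interpolant_diff_in: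
  assumes f: "f \<in> B\<phi>" shows "(\<lambda>y. interpolant f y - f y) \<in> B"
proof (rule solidD[OF _ osc_in[OF f]])
  show "(\<lambda>y. interpolant f y - f y) \<in> borel_measurable M"
    using interpolant_measurable[of f] measurable_B[OF B\<phi>_in[OF f]] by measurable
  show "AE y in M. norm (interpolant f y - f y) \<le> norm (complex_of_real (right_osc G U f y))"
    using interpolant_near[OF f] right_osc_nonneg[OF f] by simp
qed

lemma interpolant_in: "f \<in> B\<phi> \<Longrightarrow> interpolant f \<in> B"
  using add_in[OF interpolant_diff_in B\<phi>_in, of f f] by simp

lemma sampling_term_eq:
  assumes "i \<in> I" shows "sampling_term G M \<phi> x \<psi> f i = conv G M (piece f i) \<phi>"
  using conv_scale[of "f (x i)" "\<lambda>y. complex_of_real (\<psi> i y)"] assms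
  by (simp add: sampling_term_def piece_def[abs_def] weight_def)

lemma conv_piece_sums:
  assumes f: "f \<in> B\<phi>"
  shows "summable (\<lambda>i. norm (conv G M (piece f i) \<phi> y))"
    and "(\<lambda>i. conv G M (piece f i) \<phi> y) sums conv G M (interpolant f) \<phi> y"
proof -
  let ?q = "\<lambda>i z. piece f i z * \<phi> (inv z \<otimes> y)"
  have q: "integrable M (?q i)" for i by (rule kernel_integrable[OF piece_in[OF f]])
  have maj: "integrable M (\<lambda>z. majorant f z * norm (\<phi> (inv z \<otimes> y)))"
    using integrable_norm[OF kernel_integrable[OF majorant_in[OF f], of y]] majorant_nonneg[OF f]
    by (simp add: norm_mult)
  have part: "(\<Sum>i<m. \<integral>z. norm (?q i z) \<partial>M) \<le> (\<integral>z. majorant f z * norm (\<phi> (inv z \<otimes> y)) \<partial>M)" for m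
  proof -
    have "(\<Sum>i<m. \<integral>z. norm (?q i z) \<partial>M) = (\<integral>z. (\<Sum>i<m. norm (?q i z)) \<partial>M)"
      by (rule Bochner_Integration.integral_sum[symmetric]) (rule integrable_norm[OF q])
    also have "\<dots> \<le> (\<integral>z. majorant f z * norm (\<phi> (inv z \<otimes> y)) \<partial>M)"
    proof (rule integral_mono[OF _ maj])
      show "integrable M (\<lambda>z. \<Sum>i<m. norm (?q i z))"
        by (intro Bochner_Integration.integrable_sum integrable_norm q)
      show "(\<Sum>i<m. norm (?q i z)) \<le> majorant f z * norm (\<phi> (inv z \<otimes> y))" for z
        using sum_norm_piece_le[OF f, of "{..<m}" z]
        by (simp add: norm_mult sum_distrib_right[symmetric] mult_right_mono)
    qed
    finally show ?thesis .
  qed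
  have sI: "summable (\<lambda>i. \<integral>z. norm (?q i z) \<partial>M)"
    by (rule summableI_nonneg_bounded[where x="\<integral>z. majorant f z * norm (\<phi> (inv z \<otimes> y)) \<partial>M"])
      (auto intro: part integral_nonneg)
  show "summable (\<lambda>i. norm (conv G M (piece f i) \<phi> y))"
    unfolding conv_def
    by (rule summable_comparison_test'[OF sI, of 0]) (simp add: integral_norm_bound)
  have "(\<lambda>i. \<integral>z. ?q i z \<partial>M) sums (\<integral>z. (\<Sum>i. ?q i z) \<partial>M)"
  proof (rule sums_integral[OF q _ sI])
    show "AE z in M. summable (\<lambda>i. norm (?q i z))"
      using summable_mult2[OF summable_norm_piece[OF f]] by (simp add: norm_mult)
  qed
  moreover have "(\<Sum>i. ?q i z) = interpolant f z * \<phi> (inv z \<otimes> y)" for z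
    unfolding interpolant_def
    by (rule suminf_mult2[symmetric, OF summable_norm_cancel[OF summable_norm_piece[OF f]]])
  ultimately show "(\<lambda>i. conv G M (piece f i) \<phi> y) sums conv G M (interpolant f) \<phi> y"
    by (simp add: conv_def)
qed

lemma sampling_term_has_sum:
  assumes f: "f \<in> B\<phi>"
  shows "((\<lambda>i. sampling_term G M \<phi> x \<psi> f i y) has_sum conv G M (interpolant f) \<phi> y) I"
proof -
  have "((\<lambda>i. conv G M (piece f i) \<phi> y) has_sum conv G M (interpolant f) \<phi> y) UNIV"
    by (rule norm_summable_imp_has_sum[OF conv_piece_sums[OF f]])
  then show ?thesis
    by (rule has_sum_cong_neutral[THEN iffD1, rotated -1])
      (auto simp: sampling_term_eq piece_def[abs_def] weight_def conv_def)
qed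

lemma sampling_operator_eq: "f \<in> B\<phi> \<Longrightarrow> sampling_operator G M \<phi> I x \<psi> f = conv G M (interpolant f) \<phi>"
  unfolding sampling_operator_def using infsumI[OF sampling_term_has_sum] by blast

lemma interpolant_minus_partial_le:
  assumes f: "f \<in> B\<phi>" and J: "finite J"
  shows "norm (interpolant f y - (\<Sum>i\<in>J. piece f i y)) \<le> majorant f y"
proof -
  have s: "(\<lambda>i. piece f i y) sums interpolant f y"
    unfolding interpolant_def by (rule summable_sums[OF summable_norm_cancel[OF summable_norm_piece[OF f]]])
  have "(\<lambda>n. \<Sum>i\<in>{..<n} - J. piece f i y) \<longlonglongrightarrow> interpolant f y - (\<Sum>i\<in>J. piece f i y)"
  proof (rule Lim_transform_eventually)
    show "(\<lambda>n. (\<Sum>i<n. piece f i y) - (\<Sum>i\<in>J. piece f i y)) \<longlonglongrightarrow> interpolant f y - (\<Sum>i\<in>J. piece f i y)"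
      using s unfolding sums_def by (intro tendsto_intros)
    obtain m where m: "J \<subseteq> {..<m}" using finite_nat_bounded[OF J] by blast
    show "eventually (\<lambda>n. (\<Sum>i<n. piece f i y) - (\<Sum>i\<in>J. piece f i y) = (\<Sum>i\<in>{..<n} - J. piece f i y)) sequentially"
      unfolding eventually_sequentially
    proof (intro exI allI impI)
      fix n assume "m \<le> n"
      then have "J \<subseteq> {..<n}" using m by (auto intro: order_less_le_trans)
      then show "(\<Sum>i<n. piece f i y) - (\<Sum>i\<in>J. piece f i y) = (\<Sum>i\<in>{..<n} - J. piece f i y)"
        by (subst sum_diff) auto
    qed
  qed
  moreover have "norm (\<Sum>i\<in>{..<n} - J. piece f i y) \<le> majorant f y" for n
    by (rule order_trans[OF norm_sum sum_norm_piece_le[OF f]]) auto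
  ultimately show ?thesis
    by (intro tendsto_upperbound[OF tendsto_norm]) (auto intro: always_eventually)
qed

text \<open>The remainder \<open>F - F\<^sub>J\<close> is bounded by the majorant everywhere and vanishes on \<open>supp g\<close> as soon as \<open>J\<close>
  contains \<open>J0\<close>; off \<open>supp g\<close> the majorant equals its difference from \<open>g\<close>. Hence \<open>F - F\<^sub>J\<close> is
  dominated by the difference of the majorant and \<open>g\<close>, which has small norm.\<close>

lemma sampling_norm_convergence:
  assumes f: "f \<in> B\<phi>" and dense: "Cc_dense B nrm"
  shows "norm_has_sum B nrm (sampling_term G M \<phi> x \<psi> f) (sampling_operator G M \<phi> I x \<psi> f) I"
proof -
  obtain L where L: "\<And>g. g \<in> B \<Longrightarrow> nrm (conv G M g \<phi>) \<le> L * nrm g" using conv_bounded by blast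
  obtain D where D: "D \<ge> 0" "\<And>f g. f \<in> borel_measurable M \<Longrightarrow> g \<in> B \<Longrightarrow>
      (AE y in M. norm (f y) \<le> norm (g y)) \<Longrightarrow> nrm f \<le> D * nrm g"
    by (rule ideal_bound) blast
  have sep: "relatively_separated G U I x" using bupu by (simp add: bupu_def)
  have op_in: "sampling_operator G M \<phi> I x \<psi> f \<in> B"
    unfolding sampling_operator_eq[OF f] by (intro conv_in interpolant_in f)
  have term_in: "sampling_term G M \<phi> x \<psi> f i \<in> B" if "i \<in> I" for i
    unfolding sampling_term_eq[OF that] by (intro conv_in piece_in f)
  have "((\<lambda>J. nrm (\<lambda>y. (\<Sum>i\<in>J. sampling_term G M \<phi> x \<psi> f i y) - sampling_operator G M \<phi> I x \<psi> f y))
      \<longlongrightarrow> 0) (finite_subsets_at_top I)"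
  proof (rule tendstoI)
    fix e :: real assume e: "e > 0"
    define d where "d = e / (\<bar>L\<bar> * D + 1)"
    have LD: "0 \<le> \<bar>L\<bar> * D" using D(1) by simp
    then have d: "d > 0" using e by (simp add: d_def)
    have "\<exists>g\<in>Cc. nrm (\<lambda>y. complex_of_real (majorant f y) - g y) < d"
      using dense[unfolded Cc_dense_def, THEN conjunct2, rule_format, OF majorant_in[OF f] d] .
    then obtain g where g: "g \<in> Cc" "nrm (\<lambda>y. complex_of_real (majorant f y) - g y) < d" ..
    have gB: "g \<in> B" using dense g(1) unfolding Cc_dense_def by blast
    define K where "K = closure {y. g y \<noteq> 0}"
    have K: "compact K" using g(1) by (simp add: Cc_def K_def)
    define J0 where "J0 = {i\<in>I. (x i <# U) \<inter> K \<noteq> {}}"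
    have J0: "finite J0" "J0 \<subseteq> I"
      unfolding J0_def using relatively_separated_locally_finite[OF sep U K] by auto
    have close: "nrm (\<lambda>y. (\<Sum>i\<in>J. sampling_term G M \<phi> x \<psi> f i y) - sampling_operator G M \<phi> I x \<psi> f y) < e"
      if J: "finite J" "J0 \<subseteq> J" "J \<subseteq> I" for J
    proof -
      let ?F = "\<lambda>y. (\<Sum>i\<in>J. piece f i y) - interpolant f y"
      have PB: "(\<lambda>y. \<Sum>i\<in>J. piece f i y) \<in> B" by (intro sum_in piece_in f J)
      have FB: "?F \<in> B" by (intro diff_in PB interpolant_in f)
      have "(\<lambda>y. (\<Sum>i\<in>J. sampling_term G M \<phi> x \<psi> f i y) - sampling_operator G M \<phi> I x \<psi> f y) = conv G M ?F \<phi>"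
        unfolding conv_diff[OF PB interpolant_in[OF f]] sampling_operator_eq[OF f] conv_sum[OF J(1) piece_in[OF f]]
        using J(3) by (intro ext arg_cong2[where f="(-)"] sum.cong refl) (auto simp: sampling_term_eq)
      then have "nrm (\<lambda>y. (\<Sum>i\<in>J. sampling_term G M \<phi> x \<psi> f i y) - sampling_operator G M \<phi> I x \<psi> f y) \<le> L * nrm ?F"
        using L[OF FB] by simp
      also have "\<dots> \<le> \<bar>L\<bar> * nrm ?F" using nonneg[OF FB] by (intro mult_right_mono) auto
      also have "nrm ?F \<le> D * nrm (\<lambda>y. complex_of_real (majorant f y) - g y)"
      proof (rule D(2)[OF measurable_B[OF FB] diff_in[OF majorant_in[OF f] gB]])
        have "norm (?F y) \<le> norm (complex_of_real (majorant f y) - g y)" for y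
        proof (cases "y \<in> K")
          case True
          have "piece f i y = 0" if "i \<notin> J" for i
            using weight_support[of i y] True that J(2) by (auto simp: piece_def J0_def)
          then have "interpolant f y = (\<Sum>i\<in>J. piece f i y)"
            unfolding interpolant_def by (intro suminf_finite J)
          then show ?thesis by simp
        next
          case False
          then have "g y = 0" using closure_subset[of "{y. g y \<noteq> 0}"] by (auto simp: K_def)
          then show ?thesis
            using interpolant_minus_partial_le[OF f J(1), of y] majorant_nonneg[OF f, of y]
            by (simp add: norm_minus_commute)
        qed
        then show "AE y in M. norm (?F y) \<le> norm (complex_of_real (majorant f y) - g y)" by simp
      qed
      also have "\<bar>L\<bar> * (D * nrm (\<lambda>y. complex_of_real (majorant f y) - g y)) \<le> (\<bar>L\<bar> * D) * d"
        using g(2) LD by (simp only: mult.assoc[symmetric]) (intro mult_left_mono, auto)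
      also have "\<dots> < (\<bar>L\<bar> * D + 1) * d" using d by simp
      also have "\<dots> = e" using LD by (simp add: d_def)
      finally show ?thesis by (simp add: mult_left_mono)
    qed
    then show "eventually (\<lambda>J. dist (nrm (\<lambda>y. (\<Sum>i\<in>J. sampling_term G M \<phi> x \<psi> f i y) -
        sampling_operator G M \<phi> I x \<psi> f y)) 0 < e) (finite_subsets_at_top I)"
      unfolding eventually_finite_subsets_at_top
    proof (intro exI conjI allI impI)
      fix J assume "finite J \<and> J0 \<subseteq> J \<and> J \<subseteq> I"
      then have J: "finite J" "J0 \<subseteq> J" "J \<subseteq> I" by auto
      have "0 \<le> nrm (\<lambda>y. (\<Sum>i\<in>J. sampling_term G M \<phi> x \<psi> f i y) - sampling_operator G M \<phi> I x \<psi> f y)"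
        using J(3) by (intro nonneg diff_in sum_in J term_in op_in) auto
      with close[OF J] show "dist (nrm (\<lambda>y. (\<Sum>i\<in>J. sampling_term G M \<phi> x \<psi> f i y) -
          sampling_operator G M \<phi> I x \<psi> f y)) 0 < e"
        by simp
    qed (use J0 in auto)
  qed
  with op_in term_in show ?thesis unfolding norm_has_sum_def by blast
qed

end

text \<open>The threshold \<open>\<delta>\<close> depends only on a bound \<open>L\<close> for convolution with \<open>\<phi>\<close> and on the constant \<open>D\<close> of
  \<open>ideal_bound\<close>; it is chosen so that \<open>L D \<delta> \<le> 1/2\<close>.\<close>

theorem (in reproducing_kernel) sampling_operator_invertible:
  obtains \<delta> where "\<delta> > 0"
    "\<And>c U I x \<psi>. c < \<delta> \<Longrightarrow> compact U \<Longrightarrow> bupu G M U I x \<psi> \<Longrightarrow>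
      (\<And>f. f \<in> B\<phi> \<Longrightarrow> (\<lambda>y. complex_of_real (right_osc G U f y)) \<in> B \<and>
         nrm (\<lambda>y. complex_of_real (right_osc G U f y)) \<le> c * nrm f) \<Longrightarrow>
      invertible_operator_on B\<phi> nrm (sampling_operator G M \<phi> I x \<psi>)"
proof -
  obtain L where L: "\<And>g. g \<in> B \<Longrightarrow> nrm (conv G M g \<phi>) \<le> L * nrm g" using conv_bounded by blast
  obtain D where D: "D \<ge> 0" "\<And>f g. f \<in> borel_measurable M \<Longrightarrow> g \<in> B \<Longrightarrow>
      (AE y in M. norm (f y) \<le> norm (g y)) \<Longrightarrow> nrm f \<le> D * nrm g"
    by (rule ideal_bound) blast
  define \<delta> where "\<delta> = 1 / (2 * (\<bar>L\<bar> * D + 1))"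
  have LD: "0 \<le> \<bar>L\<bar> * D" using D(1) by simp
  show ?thesis
  proof (rule that)
    show "\<delta> > 0" using LD by (simp add: \<delta>_def)
    fix c :: real and U I x \<psi>
    assume c: "c < \<delta>" and U: "compact U" and bupu: "bupu G M U I x \<psi>"
      and osc: "\<And>f. f \<in> B\<phi> \<Longrightarrow> (\<lambda>y. complex_of_real (right_osc G U f y)) \<in> B \<and>
         nrm (\<lambda>y. complex_of_real (right_osc G U f y)) \<le> c * nrm f"
    interpret sampling G \<mu> B nrm \<phi> U I x \<psi>
      by unfold_locales (use U bupu osc in auto)
    interpret R: complete_seminorm B\<phi> nrm by (rule complete_seminorm_B\<phi>)
    let ?T = "sampling_operator G M \<phi> I x \<psi>"
    show "invertible_operator_on B\<phi> nrm ?T"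
    proof (rule R.neumann_invertible)
      show "f = (\<lambda>_. 0)" if "f \<in> B\<phi>" "nrm f = 0" for f by (rule B\<phi>_faithful[OF that])
      show "?T f \<in> B\<phi>" if "f \<in> B\<phi>" for f
        unfolding sampling_operator_eq[OF that] by (intro conv_in_B\<phi> interpolant_in that)
      show "?T (\<lambda>y. f y + g y) = (\<lambda>y. ?T f y + ?T g y)" if f: "f \<in> B\<phi>" and g: "g \<in> B\<phi>" for f g
      proof
        fix y
        have "((\<lambda>i. sampling_term G M \<phi> x \<psi> f i y + sampling_term G M \<phi> x \<psi> g i y) has_sum
            ?T f y + ?T g y) I"
          unfolding sampling_operator_eq[OF f] sampling_operator_eq[OF g]
          by (intro has_sum_add sampling_term_has_sum f g)
        then show "?T (\<lambda>y. f y + g y) y = ?T f y + ?T g y"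
          unfolding sampling_operator_def[of _ _ _ _ _ _ "\<lambda>y. f y + g y"]
          by (intro infsumI) (simp add: sampling_term_def distrib_right)
      qed
      show "?T (\<lambda>y. a * f y) = (\<lambda>y. a * ?T f y)" if f: "f \<in> B\<phi>" for f a
      proof
        fix y
        have "((\<lambda>i. a * sampling_term G M \<phi> x \<psi> f i y) has_sum a * ?T f y) I"
          unfolding sampling_operator_eq[OF f]
          by (intro has_sum_cmult_right sampling_term_has_sum f)
        then show "?T (\<lambda>y. a * f y) y = a * ?T f y"
          unfolding sampling_operator_def[of _ _ _ _ _ _ "\<lambda>y. a * f y"]
          by (intro infsumI) (simp add: sampling_term_def mult.assoc)
      qed
      show "nrm (\<lambda>y. ?T f y - f y) \<le> nrm f / 2" if f: "f \<in> B\<phi>" for f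
      proof -
        let ?d = "\<lambda>y. interpolant f y - f y"
        have d: "?d \<in> B" by (rule interpolant_diff_in[OF f])
        have "(\<lambda>y. ?T f y - f y) = conv G M ?d \<phi>"
          unfolding conv_diff[OF interpolant_in[OF f] B\<phi>_in[OF f]] sampling_operator_eq[OF f] B\<phi>_conv[OF f] ..
        then have "nrm (\<lambda>y. ?T f y - f y) \<le> L * nrm ?d" using L[OF d] by simp
        also have "\<dots> \<le> \<bar>L\<bar> * nrm ?d" using nonneg[OF d] by (intro mult_right_mono) auto
        also have "nrm ?d \<le> D * nrm (\<lambda>y. complex_of_real (right_osc G U f y))"
          using interpolant_near[OF f] right_osc_nonneg[OF f]
          by (intro D(2) measurable_B[OF d] osc_in[OF f]) auto
        also have "nrm (\<lambda>y. complex_of_real (right_osc G U f y)) \<le> \<delta> * nrm f"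
          using osc[OF f] c nonneg[OF B\<phi>_in[OF f]] by (meson less_imp_le mult_right_mono order_trans)
        finally have "nrm (\<lambda>y. ?T f y - f y) \<le> (\<bar>L\<bar> * D * \<delta>) * nrm f"
          using D(1) by (simp add: mult_left_mono mult.assoc)
        also have "\<bar>L\<bar> * D * \<delta> \<le> 1 / 2" using LD by (simp add: \<delta>_def field_simps)
        finally show ?thesis using nonneg[OF B\<phi>_in[OF f]] by (simp add: mult_right_mono)
      qed
    qed
  qed
qed

section \<open>Sampling on a Lie group\<close>

text \<open>The box is a product of compact pieces of one-parameter subgroups. The parameters \<open>t k\<close> can be varied
  independently because no index occurs twice.\<close>

lemma compact_exp_box:
  fixes G :: "'g::topological_space monoid"
  assumes mult: "continuous_on UNIV (\<lambda>(x, y). x \<otimes>\<^bsub>G\<^esub> y)"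
    and curve: "\<And>k. k \<in> {1..n} \<Longrightarrow> continuous_on UNIV (\<lambda>t. E (vf_scale t (X k)))"
  shows "compact (exp_box G E X n \<epsilon>)"
proof -
  define S where "S = (\<lambda>ks. {foldr (\<lambda>k a. E (vf_scale (t k) (X k)) \<otimes>\<^bsub>G\<^esub> a) ks \<one>\<^bsub>G\<^esub> | t :: nat \<Rightarrow> real.
        \<forall>k\<in>set ks. -\<epsilon> \<le> t k \<and> t k \<le> \<epsilon>})"
  have "compact (S ks)" if "distinct ks" "set ks \<subseteq> {1..n}" for ks
    using that
  proof (induction ks)
    case Nil
    then show ?case by (simp add: S_def)
  next
    case (Cons k ks)
    let ?C = "(\<lambda>s. E (vf_scale s (X k))) ` {-\<epsilon>..\<epsilon>}"
    have "S (k # ks) = (\<lambda>(x, y). x \<otimes>\<^bsub>G\<^esub> y) ` (?C \<times> S ks)"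
    proof (intro equalityI subsetI)
      fix z assume "z \<in> S (k # ks)"
      then obtain t where t: "\<forall>j\<in>set (k # ks). -\<epsilon> \<le> t j \<and> t j \<le> \<epsilon>"
          "z = E (vf_scale (t k) (X k)) \<otimes>\<^bsub>G\<^esub> foldr (\<lambda>k a. E (vf_scale (t k) (X k)) \<otimes>\<^bsub>G\<^esub> a) ks \<one>\<^bsub>G\<^esub>"
        unfolding S_def by auto
      show "z \<in> (\<lambda>(x, y). x \<otimes>\<^bsub>G\<^esub> y) ` (?C \<times> S ks)"
      proof (rule image_eqI)
        show "(E (vf_scale (t k) (X k)), foldr (\<lambda>k a. E (vf_scale (t k) (X k)) \<otimes>\<^bsub>G\<^esub> a) ks \<one>\<^bsub>G\<^esub>) \<in> ?C \<times> S ks"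
          using t(1) unfolding S_def by auto
      qed (simp add: t(2))
    next
      fix z assume "z \<in> (\<lambda>(x, y). x \<otimes>\<^bsub>G\<^esub> y) ` (?C \<times> S ks)"
      then obtain s t where st: "-\<epsilon> \<le> s" "s \<le> \<epsilon>" "\<forall>k\<in>set ks. -\<epsilon> \<le> t k \<and> t k \<le> \<epsilon>"
          "z = E (vf_scale s (X k)) \<otimes>\<^bsub>G\<^esub> foldr (\<lambda>k a. E (vf_scale (t k) (X k)) \<otimes>\<^bsub>G\<^esub> a) ks \<one>\<^bsub>G\<^esub>"
        unfolding S_def by auto
      have "foldr (\<lambda>j a. E (vf_scale ((t(k := s)) j) (X j)) \<otimes>\<^bsub>G\<^esub> a) ks \<one>\<^bsub>G\<^esub> =
          foldr (\<lambda>k a. E (vf_scale (t k) (X k)) \<otimes>\<^bsub>G\<^esub> a) ks \<one>\<^bsub>G\<^esub>" if "k \<notin> set ks" for k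
        using that by (intro foldr_cong) auto
      then show "z \<in> S (k # ks)"
        unfolding S_def using Cons.prems st by (intro CollectI exI[of _ "t(k := s)"]) auto
    qed
    moreover have "compact (?C \<times> S ks)"
      using Cons by (intro compact_Times compact_continuous_image continuous_on_subset[OF curve]) auto
    ultimately show ?case
      by (auto intro: compact_continuous_image continuous_on_subset[OF mult])
  qed
  from this[of "[1..<Suc n]"] show ?thesis
    by (simp add: S_def exp_box_def atLeastLessThanSuc_atLeastAtMost del: upt_Suc)
qed

theorem theorem3p10:
  fixes G :: "'g::{t2_space, second_countable_topology} monoid"
    and A :: "('g, 'e::real_normed_vector) chart set"
    and n :: nat
    and E :: "'g vfield \<Rightarrow> 'g"
    and X :: "nat \<Rightarrow> 'g vfield"
    and \<mu> :: "'g measure"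
    and M :: "'g measure"
    and B :: "('g \<Rightarrow> complex) set"
    and nrm :: "('g \<Rightarrow> complex) \<Rightarrow> real"
    and \<phi> :: "'g \<Rightarrow> complex"
    and C :: "real \<Rightarrow> real"
  assumes G: "lie_group G A n"
    and E: "exponential_map G A E"
    and X: "lie_algebra_basis G A n X"
    and haar: "left_haar_measure G \<mu>"
    and M: "M = completion \<mu>"
    and B: "banach_function_space M B nrm"
    and B_solid: "solid M B"
    and B_invariant: "translation_invariant G B nrm"
    and \<phi>_in_B: "\<phi> \<in> B"
    and \<phi>_nonzero: "\<not> (AE y in M. \<phi> y = 0)"
    and \<phi>_functional: "\<exists>K. \<forall>f\<in>B. integrable M (\<lambda>y. f y * \<phi> (inv\<^bsub>G\<^esub> y)) \<and>
           norm (\<integral>y. f y * \<phi> (inv\<^bsub>G\<^esub> y) \<partial>M) \<le> K * nrm f"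
    and \<phi>_idempotent: "AE y in M. conv G M \<phi> \<phi> y = \<phi> y"
    and C_tendsto: "(C \<longlongrightarrow> 0) (at_right 0)"
    and osc: "\<And>\<epsilon> f. \<epsilon> > 0 \<Longrightarrow> f \<in> reproducing_space G M B \<phi> \<Longrightarrow>
           (\<lambda>y. complex_of_real (right_osc G (exp_box G E X n \<epsilon>) f y)) \<in> B \<and>
           nrm (\<lambda>y. complex_of_real (right_osc G (exp_box G E X n \<epsilon>) f y)) \<le> C \<epsilon> * nrm f"
    and conv_continuous: "convolution_continuous G M B nrm \<phi>"
  shows "\<exists>\<epsilon>>0. \<forall>I x \<psi>. bupu G M (exp_box G E X n \<epsilon>) I x \<psi> \<longrightarrow>
           invertible_operator_on (reproducing_space G M B \<phi>) nrm (sampling_operator G M \<phi> I x \<psi>) \<and>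
           (\<forall>f\<in>reproducing_space G M B \<phi>.
              (\<forall>y. (\<lambda>i. sampling_term G M \<phi> x \<psi> f i y) summable_on I) \<and>
              (Cc_dense B nrm \<longrightarrow>
                 norm_has_sum B nrm (sampling_term G M \<phi> x \<psi> f) (sampling_operator G M \<phi> I x \<psi> f) I))"
proof (cases "\<exists>\<epsilon>>0. \<exists>I x \<psi>. bupu G M (exp_box G E X n \<epsilon>) I x \<psi>")
  case False
  then show ?thesis by (intro exI[of _ 1]) auto
next
  case True
  then obtain \<epsilon>0 I0 x0 \<psi>0 where bupu0: "bupu G M (exp_box G E X n \<epsilon>0) I0 x0 \<psi>0" by blast
  interpret L: lie_group G A n by (rule G)
  have mult: "continuous_on UNIV (\<lambda>(x, y). x \<otimes>\<^bsub>G\<^esub> y)"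
    using L.smooth_mult unfolding smooth_map_def by blast
  have box: "compact (exp_box G E X n \<epsilon>)" for \<epsilon>
  proof (rule compact_exp_box[OF mult])
    fix k assume "k \<in> {1..n}"
    then have "X k \<in> lie_algebra G A" using X by (simp add: lie_algebra_basis_def)
    then show "continuous_on UNIV (\<lambda>t. E (vf_scale t (X k)))"
      using E unfolding exponential_map_def smooth_map_def by blast
  qed
  have coset: "compact (a <#\<^bsub>G\<^esub> exp_box G E X n \<epsilon>)" for a \<epsilon>
  proof -
    have "a <#\<^bsub>G\<^esub> exp_box G E X n \<epsilon> = (\<lambda>(x, y). x \<otimes>\<^bsub>G\<^esub> y) ` ({a} \<times> exp_box G E X n \<epsilon>)"
      by (auto simp: l_coset_def)
    then show ?thesis
      by (auto intro!: compact_continuous_image compact_Times box continuous_on_subset[OF mult])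
  qed
  \<comment> \<open>the partition at scale \<open>\<epsilon>0\<close> serves only to cover \<open>G\<close> by countably many compact sets; the scale \<open>\<epsilon>\<close> is chosen later\<close>
  interpret haar_group G \<mu>
  proof
    show "carrier G = UNIV" by (rule L.carrier_UNIV)
    show "continuous_on UNIV (\<lambda>(x, y). x \<otimes>\<^bsub>G\<^esub> y)" by (rule mult)
    show "continuous_on UNIV (\<lambda>x. inv\<^bsub>G\<^esub> x)" using L.smooth_inv unfolding smooth_map_def by blast
    show "left_haar_measure G \<mu>" by (rule haar)
    define K where "K = (\<lambda>i. if i \<in> I0 then x0 i <#\<^bsub>G\<^esub> exp_box G E X n \<epsilon>0 else {})"
    have "UNIV = (\<Union>i\<in>I0. x0 i <#\<^bsub>G\<^esub> exp_box G E X n \<epsilon>0)"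
      using bupu0 unfolding bupu_def relatively_separated_def by blast
    then have "(\<Union>i. K i) = UNIV" by (auto simp: K_def)
    moreover have "compact (K i)" for i by (simp add: K_def coset)
    ultimately show "\<exists>K::nat \<Rightarrow> 'g set. (\<forall>n. compact (K n)) \<and> (\<Union>n. K n) = UNIV" by blast
  qed
  interpret banach_function_space "completion \<mu>" B nrm using B unfolding M .
  interpret solid_function_space "completion \<mu>" B nrm
  proof
    show "solid (completion \<mu>) B" using B_solid unfolding M .
    show "K \<in> fmeasurable (completion \<mu>)" if "compact K" for K
      using that emeasure_compact_finite[OF that] compact_sets[OF that] by (auto simp: fmeasurable_def)
    show "\<exists>K::nat \<Rightarrow> 'g set. (\<forall>n. compact (K n)) \<and> space (completion \<mu>) \<subseteq> (\<Union>n. K n)"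
      using sigma_compact by auto
  qed
  obtain k where \<phi>_int: "\<And>f. f \<in> B \<Longrightarrow> integrable (completion \<mu>) (\<lambda>y. f y * \<phi> (inv\<^bsub>G\<^esub> y))"
    and \<phi>_bound: "\<And>f. f \<in> B \<Longrightarrow> norm (\<integral>y. f y * \<phi> (inv\<^bsub>G\<^esub> y) \<partial>completion \<mu>) \<le> k * nrm f"
    using \<phi>_functional unfolding M by blast
  have translate: "left_translate G y f \<in> B" if "f \<in> B" for f y
    using B_invariant that unfolding translation_invariant_def by blast
  interpret convolution_kernel G \<mu> B nrm \<phi>
  proof
    show "\<phi> \<in> B" by (rule \<phi>_in_B)
    show "integrable (completion \<mu>) (\<lambda>x. f x * \<phi> (inv\<^bsub>G\<^esub> x \<otimes>\<^bsub>G\<^esub> y))" if "f \<in> B" for f y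
      by (rule conv_via_functional(1)[OF \<phi>_int[OF translate[OF that]]])
    show "conv G (completion \<mu>) f \<phi> \<in> B" if "f \<in> B" for f
      using conv_continuous that unfolding convolution_continuous_def M by blast
    show "AE y in completion \<mu>. conv G (completion \<mu>) \<phi> \<phi> y = \<phi> y"
      using \<phi>_idempotent unfolding M .
  qed
  interpret reproducing_kernel G \<mu> B nrm \<phi>
  proof
    have zero: "conv G (completion \<mu>) (\<lambda>_. 0) \<phi> = (\<lambda>_. 0)" by (simp add: conv_def)
    obtain d where d: "d > 0" "\<And>g. g \<in> B \<Longrightarrow> nrm (\<lambda>y. g y - 0) < d \<Longrightarrow>
        nrm (\<lambda>y. conv G (completion \<mu>) g \<phi> y - conv G (completion \<mu>) (\<lambda>_. 0) \<phi> y) < 1"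
      using conv_continuous[unfolded convolution_continuous_def M, THEN conjunct2, rule_format,
          OF zero_in zero_less_one] by blast
    have "nrm (conv G (completion \<mu>) f \<phi>) \<le> (1 / d) * nrm f" if "f \<in> B" for f
    proof (rule homogeneous_bounded[where T="\<lambda>f. conv G (completion \<mu>) f \<phi>", OF _ _ d(1) _ that])
      show "conv G (completion \<mu>) (\<lambda>y. c * g y) \<phi> = (\<lambda>y. c * conv G (completion \<mu>) g \<phi> y)" for c g
        by (simp add: conv_def mult.assoc)
      show "nrm (conv G (completion \<mu>) g \<phi>) < 1" if "g \<in> B" "nrm g < d" for g
        using d(2)[of g] that by (simp add: zero)
    qed (rule conv_in)
    then show "\<exists>L. \<forall>f\<in>B. nrm (conv G (completion \<mu>) f \<phi>) \<le> L * nrm f" by blast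
    fix f :: "'g \<Rightarrow> complex" and K :: "'g set"
    assume f: "f \<in> reproducing_space G (completion \<mu>) B \<phi>" and K: "compact K"
    then have fB: "f \<in> B" and f_conv: "f = conv G (completion \<mu>) f \<phi>"
      by (auto simp: reproducing_space_def)
    obtain c where c: "\<And>y. y \<in> (\<lambda>y. inv\<^bsub>G\<^esub> y) ` K \<Longrightarrow> nrm (left_translate G y f) \<le> c * nrm f"
      using B_invariant compact_inv_image[OF K] fB unfolding translation_invariant_def by meson
    have "norm (f y) \<le> \<bar>k\<bar> * (c * nrm f)" if "y \<in> K" for y
    proof -
      let ?g = "left_translate G (inv\<^bsub>G\<^esub> y) f"
      have "f y = conv G (completion \<mu>) f \<phi> y" using f_conv by (rule fun_cong)
      also have "\<dots> = (\<integral>z. ?g z * \<phi> (inv\<^bsub>G\<^esub> z) \<partial>completion \<mu>)"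
        by (rule conv_via_functional(2)[OF \<phi>_int[OF translate[OF fB]]])
      finally have "norm (f y) \<le> k * nrm ?g" using \<phi>_bound[OF translate[OF fB]] by simp
      also have "\<dots> \<le> \<bar>k\<bar> * nrm ?g" using nonneg[OF translate[OF fB]] by (intro mult_right_mono) auto
      also have "\<dots> \<le> \<bar>k\<bar> * (c * nrm f)" using c that by (intro mult_left_mono) auto
      finally show ?thesis .
    qed
    then show "\<exists>c. \<forall>y\<in>K. norm (f y) \<le> c" by blast
  qed
  obtain \<delta> where \<delta>: "\<delta> > 0" and invertible:
    "\<And>c U I x \<psi>. c < \<delta> \<Longrightarrow> compact U \<Longrightarrow> bupu G (completion \<mu>) U I x \<psi> \<Longrightarrow>
      (\<And>f. f \<in> B\<phi> \<Longrightarrow> (\<lambda>y. complex_of_real (right_osc G U f y)) \<in> B \<and>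
         nrm (\<lambda>y. complex_of_real (right_osc G U f y)) \<le> c * nrm f) \<Longrightarrow>
      invertible_operator_on B\<phi> nrm (sampling_operator G (completion \<mu>) \<phi> I x \<psi>)"
    by (rule sampling_operator_invertible) blast
  have "eventually (\<lambda>\<epsilon>. C \<epsilon> < \<delta> \<and> \<epsilon> > 0) (at_right 0)"
    by (intro eventually_conj order_tendstoD(2)[OF C_tendsto \<delta>] eventually_at_right_less)
  then obtain \<epsilon> where \<epsilon>: "C \<epsilon> < \<delta>" "\<epsilon> > 0"
    using eventually_happens trivial_limit_at_right_real by blast
  note osc_\<epsilon> = osc[OF \<epsilon>(2), unfolded M]
  show ?thesis
    unfolding M
  proof (intro exI[of _ \<epsilon>] conjI allI impI ballI \<epsilon>(2))
    fix I x \<psi> assume bupu: "bupu G (completion \<mu>) (exp_box G E X n \<epsilon>) I x \<psi>"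
    show "invertible_operator_on B\<phi> nrm (sampling_operator G (completion \<mu>) \<phi> I x \<psi>)"
      by (rule invertible[OF \<epsilon>(1) box bupu osc_\<epsilon>])
    interpret sampling G \<mu> B nrm \<phi> "exp_box G E X n \<epsilon>" I x \<psi>
      by unfold_locales (use box bupu osc_\<epsilon> in auto)
    fix f assume f: "f \<in> B\<phi>"
    show "(\<lambda>i. sampling_term G (completion \<mu>) \<phi> x \<psi> f i y) summable_on I" for y
      using sampling_term_has_sum[OF f] by (rule has_sum_imp_summable)
    show "norm_has_sum B nrm (sampling_term G (completion \<mu>) \<phi> x \<psi> f)
        (sampling_operator G (completion \<mu>) \<phi> I x \<psi> f) I" if "Cc_dense B nrm"
      by (rule sampling_norm_convergence[OF f that])
  qed
qed

end
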